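(* Let $\mathbf{K}$ be a compact set of Borel probability measures on $\mathrm{SL}(2,\mathbb{R})$. Assume that (finite moment condition) there exist $\gamma>0$ and $C$ such that for every $\mu\in\mathbf{K}$ one has $\int_{\mathrm{SL}(2,\mathbb{R})}\|A\|^{\gamma}\,d\mu(A)<C$; (measures condition) for every $\mu\in\mathbf{K}$ there are no Borel probability measures $\nu_1,\nu_2$ on $\mathbb{RP}^{1}$ such that $(f_A)_*\nu_1=\nu_2$ for $\mu$-almost every $A\in\mathrm{SL}(2,\mathbb{R})$. Let $(\mu_i)_{i\in\mathbb{N}}$ be any sequence with $\mu_i\in\mathbf{K}$. Then almost surely there exists a unit vector $\bar v\in\mathbb{R}^2$ such that $|T_n\bar v|\to 0$ as $n\to\infty$, and moreover $$\lim_{n\to\infty}\frac1n\bigl(\log|T_n\bar v|+L_n\bigr)=0 .$$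
   Context: Compactness of $\mathbf{K}$ is with respect to the topology of weak-$*$ (weak) convergence of probability measures. $|\cdot|$ is the Euclidean norm on $\mathbb{R}^2$ and $\|A\|$ is the corresponding operator norm. For $A\in\mathrm{SL}(2,\mathbb{R})$, $f_A:\mathbb{RP}^{1}\to\mathbb{RP}^{1}$ is the induced projective transformation. The matrices $A_i$ are chosen independently at random, $A_i$ having distribution $\mu_i$; $T_n=A_nA_{n-1}\cdots A_1$; and $L_n=\mathbb{E}\log\|T_n\|$, the expectation being over $\mu_1\times\dots\times\mu_n$. "Almost surely" refers to the product measure $\prod_i\mu_i$ (the vector $\bar v$ is random: it depends on the sequence $(A_i)$). *)

theory Defs
  imports "HOL-Probability.Probability"
begin

definition SL2 :: "(real^2^2) set" where
  "SL2 = {A. det A = 1}"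

definition prob_measures_SL2 :: "(real^2^2) measure set" where
  "prob_measures_SL2 = {\<mu>. prob_space \<mu> \<and> sets \<mu> = sets (restrict_space borel SL2)}"

(* The topology of weak convergence: the coarsest one making integration against each
   bounded continuous function on SL(2,R) continuous. *)
definition weak_topology_SL2 :: "(real^2^2) measure topology" where
  "weak_topology_SL2 = topology_generated_by
     {{\<mu> \<in> prob_measures_SL2. (\<integral>A. f A \<partial>\<mu>) \<in> U} | (f :: real^2^2 \<Rightarrow> real) U.
        continuous_on SL2 f \<and> bounded (f ` SL2) \<and> open U}"

lemma topspace_weak_topology_SL2: "topspace weak_topology_SL2 = prob_measures_SL2"
proof -
  have "prob_measures_SL2 \<in> {{\<mu> \<in> prob_measures_SL2. (\<integral>A. f A \<partial>\<mu>) \<in> U} | (f :: real^2^2 \<Rightarrow> real) U.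
        continuous_on SL2 f \<and> bounded (f ` SL2) \<and> open U}"
    by (rule CollectI, rule exI[of _ "\<lambda>_. 0"], rule exI[of _ UNIV]) (auto simp: image_constant_conv)
  then show ?thesis
    unfolding weak_topology_SL2_def topology_generated_by_topspace by auto
qed

(* The operator norm for the Euclidean norm; the type class norm on real^2^2 is the
   Frobenius norm. *)
definition op_norm :: "real^2^2 \<Rightarrow> real" where
  "op_norm A = onorm (\<lambda>v. A *v v)"

(* Points of the projective line are the one-dimensional subspaces of the plane. *)
definition RP1 :: "(real^2) set set" where
  "RP1 = {L. subspace L \<and> dim L = 1}"

(* The quotient topology along v \<mapsto> span {v}, defined on the nonzero vectors. *)
definition RP1_topology :: "(real^2) set topology" where
  "RP1_topology = topology (\<lambda>U. U \<subseteq> RP1 \<and> open {v. v \<noteq> 0 \<and> span {v} \<in> U})"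

lemma openin_RP1_topology:
  "openin RP1_topology U \<longleftrightarrow> U \<subseteq> RP1 \<and> open {v. v \<noteq> 0 \<and> span {v} \<in> U}"
proof -
  have "istopology (\<lambda>U. U \<subseteq> RP1 \<and> open {v::real^2. v \<noteq> 0 \<and> span {v} \<in> U})"
    unfolding istopology_def
  proof (intro conjI allI impI)
    fix S T :: "(real^2) set set"
    assume "S \<subseteq> RP1 \<and> open {v. v \<noteq> 0 \<and> span {v} \<in> S}" "T \<subseteq> RP1 \<and> open {v. v \<noteq> 0 \<and> span {v} \<in> T}"
    then have "open ({v. v \<noteq> 0 \<and> span {v} \<in> S} \<inter> {v. v \<noteq> 0 \<and> span {v} \<in> T})" by blast
    also have "{v. v \<noteq> 0 \<and> span {v} \<in> S} \<inter> {v. v \<noteq> 0 \<and> span {v} \<in> T} = {v. v \<noteq> 0 \<and> span {v} \<in> S \<inter> T}"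
      by auto
    finally show "open {v. v \<noteq> 0 \<and> span {v} \<in> S \<inter> T}" .
  next
    fix \<K> :: "(real^2) set set set"
    assume *: "\<forall>K\<in>\<K>. K \<subseteq> RP1 \<and> open {v. v \<noteq> 0 \<and> span {v} \<in> K}"
    then have "open (\<Union>K\<in>\<K>. {v. v \<noteq> 0 \<and> span {v} \<in> K})" by blast
    also have "(\<Union>K\<in>\<K>. {v. v \<noteq> 0 \<and> span {v} \<in> K}) = {v. v \<noteq> 0 \<and> span {v} \<in> \<Union>\<K>}" by auto
    finally show "open {v. v \<noteq> 0 \<and> span {v} \<in> \<Union>\<K>}" .
  qed auto
  then show ?thesis
    unfolding RP1_topology_def by (simp add: topology_inverse')
qed

definition RP1_borel :: "(real^2) set measure" where
  "RP1_borel = sigma RP1 {U. openin RP1_topology U}"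

definition prob_measures_RP1 :: "(real^2) set measure set" where
  "prob_measures_RP1 = {\<nu>. prob_space \<nu> \<and> sets \<nu> = sets RP1_borel}"

definition proj_map :: "real^2^2 \<Rightarrow> (real^2) set \<Rightarrow> (real^2) set" where
  "proj_map A L = (\<lambda>v. A *v v) ` L"

(* distr would be a junk value if proj_map A were not measurable. *)
lemma measurable_proj_map:
  assumes "A \<in> SL2"
  shows "proj_map A \<in> measurable RP1_borel RP1_borel"
proof -
  have inv: "invertible A"
    using assms by (simp add: SL2_def invertible_det_nz)
  then have inj: "inj (\<lambda>v. A *v v)"
    by (simp add: inj_matrix_vector_mult)
  have RP1: "proj_map A L \<in> RP1" if "L \<in> RP1" for L
  proof -
    have "dim ((\<lambda>v. A *v v) ` L) = dim L"
      by (rule dim_image_eq) (use inj in \<open>auto intro: inj_on_subset\<close>)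
    moreover have "subspace ((\<lambda>v. A *v v) ` L)"
      using that by (intro linear_subspace_image) (auto simp: RP1_def)
    ultimately show ?thesis
      using that by (simp add: RP1_def proj_map_def)
  qed
  have span: "span {A *v v} = proj_map A (span {v})" for v
    unfolding proj_map_def using linear_span_image[of "\<lambda>v. A *v v" "{v}"] by simp
  have nz: "A *v v = 0 \<longleftrightarrow> v = 0" for v
    using inj by (metis injD matrix_vector_mult_0_right)
  show ?thesis
    unfolding RP1_borel_def
  proof (rule measurable_measure_of)
    show "{U. openin RP1_topology U} \<subseteq> Pow RP1"
      by (auto simp: openin_RP1_topology)
    show "proj_map A \<in> space (sigma RP1 {U. openin RP1_topology U}) \<rightarrow> RP1"
      using RP1 by (auto simp: space_measure_of_conv)
    fix U assume "U \<in> {U. openin RP1_topology U}"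
    then have U: "U \<subseteq> RP1" "open {v. v \<noteq> 0 \<and> span {v} \<in> U}"
      by (auto simp: openin_RP1_topology)
    have "open ((\<lambda>v. A *v v) -` {v. v \<noteq> 0 \<and> span {v} \<in> U})"
      using U(2) by (intro open_vimage) (auto intro: linear_continuous_on simp: linear_linear)
    also have "(\<lambda>v. A *v v) -` {v. v \<noteq> 0 \<and> span {v} \<in> U}
        = {v. v \<noteq> 0 \<and> span {v} \<in> proj_map A -` U \<inter> RP1}"
      by (auto simp: nz span RP1_def dim_span subspace_span)
    finally have "openin RP1_topology (proj_map A -` U \<inter> RP1)"
      by (simp add: openin_RP1_topology)
    then show "proj_map A -` U \<inter> space (sigma RP1 {U. openin RP1_topology U})
        \<in> sets (sigma RP1 {U. openin RP1_topology U})"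
      by (auto simp: space_measure_of_conv openin_RP1_topology intro!: sigma_sets.Basic)
  qed
qed

primrec matrix_prod :: "(nat \<Rightarrow> real^2^2) \<Rightarrow> nat \<Rightarrow> real^2^2" where
  "matrix_prod A 0 = mat 1"
| "matrix_prod A (Suc n) = A (Suc n) ** matrix_prod A n"

definition mean_log_norm :: "(nat \<Rightarrow> (real^2^2) measure) \<Rightarrow> nat \<Rightarrow> real" where
  "mean_log_norm \<mu> n = (\<integral>A. ln (op_norm (matrix_prod A n)) \<partial>(\<Pi>\<^sub>M i\<in>{1..n}. \<mu> i))"

end

theory Submission
  imports Defs "HOL-Real_Asymp.Real_Asymp"
begin

text \<open>
  The group \<open>SL(2)\<close> acts on the square-integrable functions of the plane by the unitary operators
  \<open>f \<mapsto> f \<circ> A\<inverse>\<close>. The source of everything is a spectral gap: averaging these operators over a law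
  in \<open>K\<close> multiplies the squared norm by at most some \<open>\<rho> < 1\<close>, the same for all laws in \<open>K\<close>
  (\<open>spectral_gap\<close>). If this failed, there would be functions \<open>f\<close> that are almost preserved by the
  averages. Projecting the densities \<open>f\<^sup>2\<close> to the projective line and passing to the limit, by
  compactness of \<open>K\<close>, would give a measure that almost every \<open>A\<close> moves to one and the same
  measure, contrary to the hypothesis. For a product \<open>T\<close> of \<open>k\<close> independent factors the averages
  multiply, and the expected overlap of a plane region with the image of another one decays like
  \<open>sqrt (\<rho> ^ k)\<close> (\<open>expected_overlap\<close>). Two choices of regions are used.

  For discs, the overlap is at least of order \<open>norm T ^ (-2)\<close>. So the expectation of
  \<open>norm T ^ (-2)\<close> decays exponentially, and the mean of \<open>ln (norm T)\<close> grows linearly.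

  For the neighbourhoods \<open>1 \<le> |x| \<le> 2 ^ J\<close>, \<open>|x y| \<le> 1\<close> of lines, which look alike at \<open>J\<close> scales,
  the overlap is of the order of the full area whenever \<open>T\<close> brings one line close to the other.
  So \<open>T u\<close> is rarely close to a prescribed direction (\<open>near_direction\<close>), and \<open>norm (T u)\<close> is
  rarely much smaller than \<open>norm T\<close>. With second moments of the logarithmic norms, the
  expectation of \<open>ln (norm (T u))\<close> is that of \<open>ln (norm T)\<close> up to \<open>o(k)\<close>, uniformly in the unit
  vector \<open>u\<close> and in the starting time (\<open>uniform_expansion\<close>).

  This gives the law of large numbers. Cut the product into long blocks. The logarithm of
  \<open>norm (T\<^sub>n u)\<close> is the sum over the blocks of the logarithmic stretch of the current direction.
  Subtracting the conditional expectations given the past leaves orthogonal differences, whose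
  averages tend to zero (\<open>orthogonal_strong_law\<close>); by uniform expansion the conditional
  expectations do not depend on the current direction, up to a small proportion. Hence
  \<open>ln (norm T\<^sub>n) = L\<^sub>n + o(n)\<close> almost surely (\<open>log_norm_law\<close>).

  The rest is deterministic (\<open>contracted_direction_converges\<close>). Let \<open>w\<^sub>n\<close> be a unit vector that
  \<open>T\<^sub>n\<close> contracts to a length comparable with \<open>1 / norm T\<^sub>n\<close>. As \<open>T\<^sub>n\<close> preserves area, the angle
  between \<open>w\<^sub>n\<close> and \<open>w\<^sub>n\<^sub>+\<^sub>1\<close> is at most of order \<open>norm A\<^sub>n\<^sub>+\<^sub>1 ^ 2 / norm T\<^sub>n ^ 2\<close>, so the lines
  converge exponentially fast, and the limit \<open>v\<close> satisfies \<open>norm (T\<^sub>n v) = exp (- L\<^sub>n + o(n))\<close>.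

  Matrices are measured by the Frobenius norm. It is submultiplicative, invariant under inversion
  in \<open>SL(2)\<close>, and within a factor of two of the operator norm, which does not affect the rates.
\<close>

section \<open>Matrices of determinant one\<close>

lemma square_add_le: "(x + y)\<^sup>2 \<le> 2 * x\<^sup>2 + 2 * (y :: real)\<^sup>2"
  using zero_le_power2[of "x - y"] by (simp add: power2_eq_square algebra_simps)

lemma square_diff_le: "(x - y)\<^sup>2 \<le> 2 * x\<^sup>2 + 2 * (y :: real)\<^sup>2"
  using square_add_le[of x "- y"] by simp

text \<open>The adjugate: the inverse in determinant one, and a linear function of the entries, hence
  continuous and measurable on the whole matrix space.\<close>
definition adj2 :: "real^2^2 \<Rightarrow> real^2^2" where
  "adj2 A = vector [vector [A$2$2, - A$1$2], vector [- A$2$1, A$1$1]]"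

text \<open>For unit vectors this is the sine of the oriented angle. It is preserved by determinant-one
  matrices, so the lengths of the images of two vectors bound the angle between their lines.\<close>
definition wedge :: "real^2 \<Rightarrow> real^2 \<Rightarrow> real" where
  "wedge u w = u$1 * w$2 - u$2 * w$1"

lemma adj2_nth [simp]:
  "adj2 A $ 1 $ 1 = A$2$2" "adj2 A $ 1 $ 2 = - A$1$2"
  "adj2 A $ 2 $ 1 = - A$2$1" "adj2 A $ 2 $ 2 = A$1$1"
  by (simp_all add: adj2_def)

lemma matrix_vector_nth_2:
  fixes A :: "real^2^2"
  shows "(A *v v) $ i = A$i$1 * v$1 + A$i$2 * v$2"
  by (simp add: matrix_vector_mult_def sum_2)

lemma matrix_matrix_nth_2:
  fixes A B :: "real^2^2"
  shows "(A ** B) $ i $ j = A$i$1 * B$1$j + A$i$2 * B$2$j"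
  by (simp add: matrix_matrix_mult_def sum_2)

lemma power2_norm_2:
  fixes v :: "real^2"
  shows "(norm v)\<^sup>2 = (v$1)\<^sup>2 + (v$2)\<^sup>2"
  by (simp add: norm_vec_def L2_set_def sum_2 real_norm_def)

lemma power2_norm_2_2:
  fixes A :: "real^2^2"
  shows "(norm A)\<^sup>2 = (A$1$1)\<^sup>2 + (A$1$2)\<^sup>2 + (A$2$1)\<^sup>2 + (A$2$2)\<^sup>2"
proof -
  have "(norm A)\<^sup>2 = (norm (A$1))\<^sup>2 + (norm (A$2))\<^sup>2"
    by (simp add: norm_vec_def[of A] L2_set_def sum_2)
  then show ?thesis by (simp add: power2_norm_2)
qed

lemma vec2_eq_iff: "(u::'a^2) = v \<longleftrightarrow> u$1 = v$1 \<and> u$2 = v$2"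
  by (simp add: vec_eq_iff forall_2)

lemma norm_matrix_vector_le:
  fixes A :: "real^2^2"
  shows "norm (A *v v) \<le> norm A * norm v"
proof (rule power2_le_imp_le)
  have "(norm A * norm v)\<^sup>2 - (norm (A *v v))\<^sup>2
      = (A$1$1 * v$2 - A$1$2 * v$1)\<^sup>2 + (A$2$1 * v$2 - A$2$2 * v$1)\<^sup>2"
    unfolding power_mult_distrib power2_norm_2 power2_norm_2_2 matrix_vector_nth_2
    by (simp add: algebra_simps power2_eq_square)
  then show "(norm (A *v v))\<^sup>2 \<le> (norm A * norm v)\<^sup>2"
    by (metis add_nonneg_nonneg diff_ge_0_iff_ge zero_le_power2)
qed simp

lemma norm_matrix_matrix_le:
  fixes A B :: "real^2^2"
  shows "norm (A ** B) \<le> norm A * norm B"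
proof (rule power2_le_imp_le)
  have "(norm A * norm B)\<^sup>2 - (norm (A ** B))\<^sup>2
      = (A$1$1 * B$2$1 - A$1$2 * B$1$1)\<^sup>2 + (A$2$1 * B$2$1 - A$2$2 * B$1$1)\<^sup>2
      + (A$1$1 * B$2$2 - A$1$2 * B$1$2)\<^sup>2 + (A$2$1 * B$2$2 - A$2$2 * B$1$2)\<^sup>2"
    unfolding power_mult_distrib power2_norm_2_2 matrix_matrix_nth_2
    by (simp add: algebra_simps power2_eq_square)
  then show "(norm (A ** B))\<^sup>2 \<le> (norm A * norm B)\<^sup>2"
    by (metis add_nonneg_nonneg diff_ge_0_iff_ge zero_le_power2)
qed simp

lemma abs_wedge_le: "\<bar>wedge u w\<bar> \<le> norm u * norm w"
proof (rule power2_le_imp_le)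
  have "(norm u * norm w)\<^sup>2 - (wedge u w)\<^sup>2 = (u$1 * w$1 + u$2 * w$2)\<^sup>2"
    unfolding power_mult_distrib power2_norm_2 wedge_def
    by (simp add: algebra_simps power2_eq_square)
  then show "\<bar>wedge u w\<bar>\<^sup>2 \<le> (norm u * norm w)\<^sup>2"
    by (metis diff_ge_0_iff_ge zero_le_power2 power2_abs)
qed simp

lemma SL2_det: "A \<in> SL2 \<longleftrightarrow> A$1$1 * A$2$2 - A$1$2 * A$2$1 = 1"
  by (simp add: SL2_def det_2)

lemma wedge_SL2: "A \<in> SL2 \<Longrightarrow> wedge (A *v u) (A *v w) = wedge u w"
proof -
  assume "A \<in> SL2"
  moreover have "wedge (A *v u) (A *v w) = (A$1$1 * A$2$2 - A$1$2 * A$2$1) * wedge u w"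
    unfolding wedge_def matrix_vector_nth_2 by (simp add: algebra_simps)
  ultimately show ?thesis by (simp add: SL2_det)
qed

lemma matrix_mult_SL2: "A \<in> SL2 \<Longrightarrow> B \<in> SL2 \<Longrightarrow> A ** B \<in> SL2"
  by (simp add: SL2_def det_mul)

lemma mat_1_SL2: "mat 1 \<in> SL2"
  by (simp add: SL2_def)

lemma adj2_SL2: "A \<in> SL2 \<Longrightarrow> adj2 A \<in> SL2"
  unfolding SL2_det by (simp add: mult.commute)

lemma adj2_mult: "adj2 (A ** B) = adj2 B ** adj2 A"
  by (simp add: vec2_eq_iff matrix_matrix_nth_2)

lemma adj2_adj2 [simp]: "adj2 (adj2 A) = A"
  by (simp add: vec2_eq_iff)

lemma adj2_mat_1 [simp]: "adj2 (mat 1) = mat 1"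
  by (simp add: vec2_eq_iff mat_def)

lemma norm_adj2 [simp]: "norm (adj2 A) = norm A"
proof (rule power2_eq_imp_eq)
  show "(norm (adj2 A))\<^sup>2 = (norm A)\<^sup>2" by (simp add: power2_norm_2_2)
qed simp_all

lemma mult_adj2_vec: "A \<in> SL2 \<Longrightarrow> A *v (adj2 A *v v) = v"
proof -
  assume "A \<in> SL2"
  moreover have "A *v (adj2 A *v v) = (A$1$1 * A$2$2 - A$1$2 * A$2$1) *\<^sub>R v"
    unfolding vec2_eq_iff matrix_vector_nth_2 by (simp add: algebra_simps matrix_vector_nth_2)
  ultimately show ?thesis by (simp add: SL2_det)
qed

lemma adj2_mult_vec: "A \<in> SL2 \<Longrightarrow> adj2 A *v (A *v v) = v"
  using mult_adj2_vec[OF adj2_SL2] by simp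

lemma adj2_mult_self: "A \<in> SL2 \<Longrightarrow> adj2 A ** A = mat 1"
  by (simp add: SL2_det vec2_eq_iff matrix_matrix_nth_2 mat_def algebra_simps)

lemma norm_SL2_ge_1:
  assumes "A \<in> SL2" shows "norm A \<ge> 1"
proof -
  have "(norm A)\<^sup>2 = (A$1$1 - A$2$2)\<^sup>2 + (A$1$2 + A$2$1)\<^sup>2 + 2"
    using assms unfolding power2_norm_2_2 SL2_det by (simp add: algebra_simps power2_eq_square)
  moreover have "0 \<le> (A$1$1 - A$2$2)\<^sup>2" "0 \<le> (A$1$2 + A$2$1)\<^sup>2" by simp_all
  ultimately have "1\<^sup>2 \<le> (norm A)\<^sup>2" unfolding one_power2 by linarith
  then show ?thesis by (rule power2_le_imp_le) simp
qed

text \<open>A matrix and its inverse have the same Frobenius norm in \<open>SL(2)\<close>, so an upper bound for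
  the norm is also a bound for the contraction of vectors.\<close>
lemma norm_le_SL2_vec: "A \<in> SL2 \<Longrightarrow> norm v \<le> norm A * norm (A *v v)"
  using norm_matrix_vector_le[of "adj2 A" "A *v v"] by (simp add: adj2_mult_vec)

lemma SL2_vec_eq_0_iff: "A \<in> SL2 \<Longrightarrow> A *v v = 0 \<longleftrightarrow> v = 0"
  using norm_le_SL2_vec[of A v] by auto

lemma norm_le_columns:
  fixes A :: "real^2^2"
  shows "norm A \<le> norm (A *v axis 1 1) + norm (A *v axis 2 1)"
proof (rule power2_le_imp_le)
  have "(norm A)\<^sup>2 = (norm (A *v axis 1 1))\<^sup>2 + (norm (A *v axis 2 1))\<^sup>2"
    by (simp add: power2_norm_2_2 power2_norm_2 matrix_vector_nth_2 axis_def)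
  then show "(norm A)\<^sup>2 \<le> (norm (A *v axis 1 1) + norm (A *v axis 2 1))\<^sup>2"
    by (simp add: power2_sum)
qed simp

text \<open>One of the two coordinate vectors is stretched by a fixed fraction of the norm. This replaces
  singular vectors throughout: constant factors disappear in every exponential rate.\<close>
lemma ex_axis_norm_ge:
  fixes A :: "real^2^2"
  shows "\<exists>e::real^2. norm e = 1 \<and> norm A \<le> 2 * norm (A *v e)"
proof -
  have "norm (axis 1 1 :: real^2) = 1" "norm (axis 2 1 :: real^2) = 1"
    by (simp_all)
  moreover have "norm A \<le> 2 * norm (A *v axis 1 1) \<or> norm A \<le> 2 * norm (A *v axis 2 1)"
    using norm_le_columns[of A] by linarith
  ultimately show ?thesis by blast
qed

lemma op_norm_le_norm: "op_norm A \<le> norm A"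
  unfolding op_norm_def by (rule onorm_bound) (simp_all add: norm_matrix_vector_le)

lemma norm_le_op_norm: "norm A \<le> 2 * op_norm A"
proof -
  obtain e :: "real^2" where e: "norm e = 1" "norm A \<le> 2 * norm (A *v e)"
    using ex_axis_norm_ge by blast
  have "bounded_linear (\<lambda>v. A *v v)" by (simp add: linear_linear matrix_vector_mul_linear)
  then have "norm (A *v e) \<le> op_norm A * norm e"
    unfolding op_norm_def by (rule onorm)
  with e show ?thesis by simp
qed

lemma continuous_on_matrix_vector [continuous_intros]:
  fixes f :: "'a::topological_space \<Rightarrow> real^2^2" and g :: "'a \<Rightarrow> real^2"
  assumes "continuous_on S f" "continuous_on S g"
  shows "continuous_on S (\<lambda>x. f x *v g x)"
  unfolding matrix_vector_mult_def
  by (intro continuous_on_vec_lambda continuous_intros assms)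

lemma continuous_on_matrix_matrix [continuous_intros]:
  fixes f g :: "'a::topological_space \<Rightarrow> real^2^2"
  assumes "continuous_on S f" "continuous_on S g"
  shows "continuous_on S (\<lambda>x. f x ** g x)"
  unfolding matrix_matrix_mult_def
  by (intro continuous_on_vec_lambda continuous_intros assms)

lemma continuous_on_adj2: "continuous_on UNIV adj2"
proof -
  have "continuous_on UNIV (\<lambda>A. \<chi> i j. if i = 1 then if j = 1 then A$2$2 else - A$1$2
     else if j = 1 then - A$2$1 else (A::real^2^2)$1$1)"
    apply (intro continuous_on_vec_lambda)
    subgoal for i j by (cases "i = 1"; cases "j = 1"; simp; intro continuous_intros)
    done
  also have "(\<lambda>A. \<chi> i j. if i = 1 then if j = 1 then A$2$2 else - A$1$2
     else if j = 1 then - A$2$1 else (A::real^2^2)$1$1) = adj2"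
    by (auto simp: fun_eq_iff vec2_eq_iff)
  finally show ?thesis .
qed

lemma measurable_matrix_vector [measurable]:
  fixes f :: "'a \<Rightarrow> real^2^2" and g :: "'a \<Rightarrow> real^2"
  assumes [measurable]: "f \<in> borel_measurable M" "g \<in> borel_measurable M"
  shows "(\<lambda>x. f x *v g x) \<in> borel_measurable M"
proof -
  have "(\<lambda>(A, v). A *v v) \<in> borel_measurable (borel \<Otimes>\<^sub>M borel :: ((real^2^2) \<times> (real^2)) measure)"
    unfolding borel_prod case_prod_beta by (intro borel_measurable_continuous_onI continuous_intros)
  then have "(\<lambda>x. (\<lambda>(A, v). A *v v) (f x, g x)) \<in> borel_measurable M" by measurable
  then show ?thesis by simp
qed

lemma measurable_matrix_matrix [measurable]:
  fixes f g :: "'a \<Rightarrow> real^2^2"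
  assumes [measurable]: "f \<in> borel_measurable M" "g \<in> borel_measurable M"
  shows "(\<lambda>x. f x ** g x) \<in> borel_measurable M"
proof -
  have "(\<lambda>(A, B). A ** B) \<in> borel_measurable (borel \<Otimes>\<^sub>M borel :: ((real^2^2) \<times> (real^2^2)) measure)"
    unfolding borel_prod case_prod_beta by (intro borel_measurable_continuous_onI continuous_intros)
  then have "(\<lambda>x. (\<lambda>(A, B). A ** B) (f x, g x)) \<in> borel_measurable M" by measurable
  then show ?thesis by simp
qed

lemma measurable_adj2 [measurable]: "adj2 \<in> borel_measurable borel"
  by (intro borel_measurable_continuous_onI continuous_on_adj2)

lemma SL2_borel [measurable]: "SL2 \<in> sets borel"
proof -
  have "SL2 = {A. A$1$1 * A$2$2 - A$1$2 * A$2$1 = 1}" by (auto simp: SL2_det)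
  also have "closed \<dots>" by (intro closed_Collect_eq continuous_intros)
  finally show ?thesis by (rule borel_closed)
qed

lemma distr_lborel_SL2:
  assumes "A \<in> SL2"
  shows "distr lborel borel (\<lambda>v. A *v v) = lborel"
proof (rule lborel_eqI[symmetric])
  fix l u :: "real^2" assume lu: "\<And>b. b \<in> Basis \<Longrightarrow> l \<bullet> b \<le> u \<bullet> b"
  have eq: "(\<lambda>v. A *v v) -` box l u = (\<lambda>v. adj2 A *v v) ` box l u"
    by (auto simp: adj2_mult_vec[OF assms] mult_adj2_vec[OF assms] image_iff)
       (metis adj2_mult_vec[OF assms])
  have lin: "linear (\<lambda>v. adj2 A *v v)" by simp
  have d: "det (adj2 A) = 1" using adj2_SL2[OF assms] by (simp add: SL2_def)
  have "emeasure (distr lborel borel (\<lambda>v. A *v v)) (box l u) = emeasure lborel ((\<lambda>v. adj2 A *v v) ` box l u)"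
    by (simp add: emeasure_distr eq[symmetric])
  also have "\<dots> = emeasure lebesgue ((\<lambda>v. adj2 A *v v) ` box l u)"
  proof -
    have "(\<lambda>v. A *v v) -` box l u \<in> sets (lborel :: (real^2) measure)"
      using measurable_sets_borel[of "\<lambda>v. A *v v" borel "box l u"] by simp
    then show ?thesis unfolding eq[symmetric] by simp
  qed
  also have "\<dots> = ennreal (measure lebesgue ((\<lambda>v. adj2 A *v v) ` box l u))"
    by (intro emeasure_eq_ennreal_measure fmeasurableD2 measurable_linear_image[OF lin lmeasurable_box])
  also have "measure lebesgue ((\<lambda>v. adj2 A *v v) ` box l u) = measure lebesgue (box l u)"
    by (subst measure_linear_image[OF lin lmeasurable_box]) (simp add: d)
  also have "\<dots> = (\<Prod>b\<in>Basis. (u - l) \<bullet> b)"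
    using lu by (simp add: measure_lborel_box_eq)
  finally show "emeasure (distr lborel borel (\<lambda>v. A *v v)) (box l u) = ennreal (\<Prod>b\<in>Basis. (u - l) \<bullet> b)" .
qed simp

section \<open>Weak compactness\<close>

lemma prob_measures_SL2D:
  assumes "\<kappa> \<in> prob_measures_SL2"
  shows "prob_space \<kappa>" "sets \<kappa> = sets (restrict_space borel SL2)" "space \<kappa> = SL2"
    "(\<lambda>A. A) \<in> measurable \<kappa> borel"
proof -
  show p: "prob_space \<kappa>" and s: "sets \<kappa> = sets (restrict_space borel SL2)"
    using assms by (auto simp: prob_measures_SL2_def)
  show "space \<kappa> = SL2" using sets_eq_imp_space_eq[OF s] by (simp add: space_restrict_space)
  show "(\<lambda>A. A) \<in> measurable \<kappa> borel"
    by (subst measurable_cong_sets[OF s refl]) (rule measurable_restrict_space1, simp)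
qed

lemma continuous_on_SL2_measurable:
  fixes f :: "real^2^2 \<Rightarrow> real"
  assumes "continuous_on SL2 f" and \<kappa>: "\<kappa> \<in> prob_measures_SL2"
  shows "f \<in> borel_measurable \<kappa>"
proof -
  have "f \<in> borel_measurable (restrict_space borel SL2)"
    by (rule borel_measurable_continuous_on_restrict[OF assms(1)])
  then show ?thesis using prob_measures_SL2D(2)[OF \<kappa>] measurable_cong_sets by blast
qed

text \<open>Cluster points are what compactness yields without metrizability. They are enough here, since
  every limit argument only compares finitely many integrals at a time.\<close>
lemma compactin_cluster:
  assumes "compactin X K" and \<kappa>: "\<And>j::nat. \<kappa> j \<in> K"
  obtains k where "k \<in> K" "\<And>U. openin X U \<Longrightarrow> k \<in> U \<Longrightarrow> frequently (\<lambda>j. \<kappa> j \<in> U) sequentially"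
proof -
  have "\<exists>k\<in>K. \<forall>U. openin X U \<and> k \<in> U \<longrightarrow> frequently (\<lambda>j. \<kappa> j \<in> U) sequentially"
  proof (rule ccontr)
    assume "\<not> ?thesis"
    then have "\<forall>k\<in>K. \<exists>U. openin X U \<and> k \<in> U \<and> eventually (\<lambda>j. \<kappa> j \<notin> U) sequentially"
      by (auto simp: not_frequently)
    from bchoice[OF this] obtain U
      where U: "\<And>k. k \<in> K \<Longrightarrow> openin X (U k) \<and> k \<in> U k \<and> eventually (\<lambda>j. \<kappa> j \<notin> U k) sequentially"
      by blast
    then have "(\<forall>V\<in>U ` K. openin X V) \<and> K \<subseteq> \<Union>(U ` K)" by blast
    then have "\<exists>\<F>. finite \<F> \<and> \<F> \<subseteq> U ` K \<and> K \<subseteq> \<Union>\<F>"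
      using assms(1) unfolding compactin_def by blast
    then obtain T where T: "finite T" "T \<subseteq> K" "K \<subseteq> \<Union>(U ` T)"
      by (metis finite_subset_image)
    have "eventually (\<lambda>j. \<forall>k\<in>T. \<kappa> j \<notin> U k) sequentially"
      using T U by (intro eventually_ball_finite) auto
    then obtain j where "\<forall>k\<in>T. \<kappa> j \<notin> U k" by (auto simp: eventually_sequentially)
    with T(3) \<kappa>[of j] show False by auto
  qed
  with that show thesis by blast
qed

lemma openin_weak_topology_SL2:
  fixes f :: "real^2^2 \<Rightarrow> real"
  assumes "continuous_on SL2 f" "bounded (f ` SL2)" "open U"
  shows "openin weak_topology_SL2 {\<mu> \<in> prob_measures_SL2. (\<integral>A. f A \<partial>\<mu>) \<in> U}"
  unfolding weak_topology_SL2_def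
  by (rule topology_generated_by_Basis, rule CollectI, rule exI[of _ f], rule exI[of _ U],
      intro conjI refl) (rule assms)+

section \<open>Test functions on lines\<close>

definition dir :: "real \<Rightarrow> real^2" where "dir t = vector [cos t, sin t]"

text \<open>The slope angle of the line through a vector, with the vertical line placed at the end point
  \<open>\<pi>/2\<close>. All values lie in a bounded interval, so that any family of laws of angles is tight. The
  zero vector is sent to \<open>\<pi>/2\<close> as well; it carries no mass below.\<close>
definition angle :: "real^2 \<Rightarrow> real" where
  "angle v = (if v$1 = 0 then pi/2 else arctan (v$2 / v$1))"

lemma norm_dir [simp]: "norm (dir t) = 1"
  by (rule power2_eq_imp_eq) (simp_all add: power2_norm_2 dir_def)

lemma dir_nonzero [simp]: "dir t \<noteq> 0"
  using norm_dir[of t] by force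

lemma continuous_on_dir [continuous_intros]: "continuous_on S dir"
proof -
  have "continuous_on S (\<lambda>t. (\<chi> i. if i = (1::2) then cos t else sin t) :: real^2)"
    apply (intro continuous_on_vec_lambda)
    subgoal for i by (cases "i = 1") (auto intro!: continuous_intros)
    done
  also have "(\<lambda>t. (\<chi> i. if i = (1::2) then cos t else sin t) :: real^2) = dir"
    by (auto simp: fun_eq_iff vec2_eq_iff dir_def)
  finally show ?thesis .
qed

lemma measurable_dir [measurable]: "dir \<in> borel_measurable borel"
  by (intro borel_measurable_continuous_onI continuous_intros)

lemma measurable_angle [measurable]: "angle \<in> borel_measurable borel"
  unfolding angle_def by measurable

lemma dir_angle: "v \<noteq> 0 \<Longrightarrow> \<exists>c. c \<noteq> 0 \<and> v = c *\<^sub>R dir (angle v)"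
proof (cases "v$1 = 0")
  case True
  assume "v \<noteq> 0" with True show ?thesis
    by (intro exI[of _ "v$2"]) (auto simp: vec2_eq_iff dir_def angle_def)
next
  case False
  have c: "cos (arctan (v$2 / v$1)) \<noteq> 0" by (rule cos_arctan_not_zero)
  have "sin (arctan (v$2 / v$1)) = v$2 / v$1 * cos (arctan (v$2 / v$1))"
    using tan_arctan[of "v$2 / v$1"] c unfolding tan_def by (metis nonzero_eq_divide_eq)
  with False c show ?thesis
    by (intro exI[of _ "v$1 / cos (angle v)"]) (simp add: vec2_eq_iff dir_def angle_def)
qed

text \<open>Evenness makes \<open>v \<mapsto> \<phi> (sgn v)\<close> a function of the line through \<open>v\<close>; the common Lipschitz
  constant provides the equicontinuity behind the uniform convergence below.\<close>
definition even_lipschitz :: "real \<Rightarrow> (real^2 \<Rightarrow> real) \<Rightarrow> bool" where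
  "even_lipschitz L \<phi> \<longleftrightarrow> 0 \<le> L \<and> (\<forall>x. 0 \<le> \<phi> x \<and> \<phi> x \<le> 1) \<and> (\<forall>x. \<phi> (- x) = \<phi> x)
     \<and> (\<forall>x y. \<bar>\<phi> x - \<phi> y\<bar> \<le> L * dist x y)"

lemma continuous_on_even_lipschitz:
  assumes "even_lipschitz L \<phi>" shows "continuous_on S \<phi>"
proof -
  have "L-lipschitz_on S \<phi>"
    using assms by (auto simp: even_lipschitz_def dist_real_def intro!: lipschitz_onI)
  then show ?thesis by (rule lipschitz_on_continuous_on)
qed

lemma measurable_sgn_vec [measurable]: "sgn \<in> borel_measurable (borel :: (real^2) measure)"
  unfolding sgn_div_norm[abs_def] by measurable

lemma measurable_even_lipschitz:
  "even_lipschitz L \<phi> \<Longrightarrow> \<phi> \<in> borel_measurable borel"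
  by (intro borel_measurable_continuous_onI continuous_on_even_lipschitz)

lemma even_sgn_scaleR:
  assumes "even_lipschitz L \<phi>" "c \<noteq> 0"
  shows "\<phi> (sgn (c *\<^sub>R v)) = \<phi> (sgn v)"
  using assms by (cases "c > 0") (auto simp: even_lipschitz_def sgn_scaleR sgn_real_def)

text \<open>If \<open>N\<close> is the law of the angle of a random line, this integrates the test function against the
  image of that random line under \<open>A\<close>.\<close>
definition image_integral :: "real measure \<Rightarrow> (real^2 \<Rightarrow> real) \<Rightarrow> real^2^2 \<Rightarrow> real" where
  "image_integral N \<phi> A = (\<integral>t. \<phi> (sgn (A *v dir t)) \<partial>N)"

lemma dist_sgn_le:
  fixes x y :: "'a::real_normed_vector"
  assumes "x \<noteq> 0" "y \<noteq> 0"
  shows "dist (sgn x) (sgn y) \<le> 2 / norm x * dist x y"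
proof -
  have "sgn x - sgn y = (x - y) /\<^sub>R norm x + (inverse (norm x) - inverse (norm y)) *\<^sub>R y"
    by (simp add: sgn_div_norm algebra_simps)
  then have "norm (sgn x - sgn y) \<le> norm ((x - y) /\<^sub>R norm x) + norm ((inverse (norm x) - inverse (norm y)) *\<^sub>R y)"
    by (simp only: norm_triangle_ineq)
  also have "norm ((inverse (norm x) - inverse (norm y)) *\<^sub>R y) = \<bar>norm y - norm x\<bar> / norm x"
  proof -
    have "(inverse (norm x) - inverse (norm y)) * norm y = (norm y - norm x) / norm x"
      using assms by (simp add: divide_simps)
    moreover have "norm ((inverse (norm x) - inverse (norm y)) *\<^sub>R y)
        = \<bar>(inverse (norm x) - inverse (norm y)) * norm y\<bar>"
      by (simp add: abs_mult)
    ultimately show ?thesis by simp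
  qed
  also have "\<dots> \<le> norm (x - y) / norm x"
    using norm_triangle_ineq3[of y x] by (intro divide_right_mono) (simp_all add: norm_minus_commute)
  finally show ?thesis by (simp add: dist_norm divide_inverse mult.commute mult.left_commute)
qed

context
  fixes N :: "real measure" and L and \<phi>
  assumes N: "real_distribution N" and \<phi>: "even_lipschitz L \<phi>"
begin

interpretation N: real_distribution N by (fact N)

lemmas test_function_measurable [measurable] = measurable_even_lipschitz[OF \<phi>]

lemma test_function_range: "0 \<le> \<phi> x" "\<phi> x \<le> 1"
  using \<phi> by (auto simp: even_lipschitz_def)

lemma integrable_image_integral: "integrable N (\<lambda>t. \<phi> (sgn (A *v dir t)))"
  by (rule N.integrable_const_bound[of _ 1]) (auto simp: test_function_range)

lemma image_integral_range: "0 \<le> image_integral N \<phi> A" "image_integral N \<phi> A \<le> 1"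
proof -
  show "0 \<le> image_integral N \<phi> A" unfolding image_integral_def by (rule Bochner_Integration.integral_nonneg) (simp add: test_function_range)
  have "image_integral N \<phi> A \<le> (\<integral>t. 1 \<partial>N)" unfolding image_integral_def
    by (rule integral_mono) (auto simp: test_function_range integrable_image_integral)
  then show "image_integral N \<phi> A \<le> 1" using N.prob_space by simp
qed

text \<open>Matrices of norm at most \<open>M\<close> keep unit vectors at distance at least \<open>1/M\<close> from the origin, and
  there normalization is Lipschitz with constant \<open>2 M\<close>.\<close>
lemma image_integral_lipschitz:
  assumes A: "A \<in> SL2" "norm A \<le> M" and B: "B \<in> SL2"
  shows "\<bar>image_integral N \<phi> A - image_integral N \<phi> B\<bar> \<le> 2 * L * M * norm (A - B)"
proof -
  have L: "0 \<le> L" using \<phi> by (simp add: even_lipschitz_def)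
  have M: "1 \<le> M" using norm_SL2_ge_1[OF A(1)] A(2) by simp
  have *: "\<bar>\<phi> (sgn (A *v dir t)) - \<phi> (sgn (B *v dir t))\<bar> \<le> 2 * L * M * norm (A - B)" for t
  proof -
    have ge: "1 / M \<le> norm (A *v dir t)"
    proof -
      have "1 \<le> norm A * norm (A *v dir t)" using norm_le_SL2_vec[OF A(1), of "dir t"] by simp
      also have "\<dots> \<le> M * norm (A *v dir t)" using A(2) by (intro mult_right_mono) auto
      finally show ?thesis using M by (simp add: field_simps)
    qed
    have "\<bar>\<phi> (sgn (A *v dir t)) - \<phi> (sgn (B *v dir t))\<bar> \<le> L * dist (sgn (A *v dir t)) (sgn (B *v dir t))"
      using \<phi> by (simp add: even_lipschitz_def)
    also have "\<dots> \<le> L * (2 / norm (A *v dir t) * dist (A *v dir t) (B *v dir t))"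
      using L A B by (intro mult_left_mono dist_sgn_le) (auto simp: SL2_vec_eq_0_iff)
    also have "2 / norm (A *v dir t) * dist (A *v dir t) (B *v dir t) \<le> 2 * M * norm (A - B)"
    proof (rule mult_mono)
      have "inverse (norm (A *v dir t)) \<le> inverse (1 / M)"
        using ge M by (intro le_imp_inverse_le) auto
      then show "2 / norm (A *v dir t) \<le> 2 * M" by (simp add: divide_inverse)
      show "dist (A *v dir t) (B *v dir t) \<le> norm (A - B)"
        using norm_matrix_vector_le[of "A - B" "dir t"]
        by (simp add: dist_norm matrix_vector_mult_diff_rdistrib)
    qed (use M in auto)
    then have "L * (2 / norm (A *v dir t) * dist (A *v dir t) (B *v dir t)) \<le> L * (2 * M * norm (A - B))"
      using L by (rule mult_left_mono)
    finally show ?thesis by (simp add: mult.commute mult.left_commute)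
  qed
  have "image_integral N \<phi> A - image_integral N \<phi> B = (\<integral>t. \<phi> (sgn (A *v dir t)) - \<phi> (sgn (B *v dir t)) \<partial>N)"
    unfolding image_integral_def by (rule Bochner_Integration.integral_diff[symmetric]) (rule integrable_image_integral)+
  also have "\<bar>\<dots>\<bar> \<le> (\<integral>t. \<bar>\<phi> (sgn (A *v dir t)) - \<phi> (sgn (B *v dir t))\<bar> \<partial>N)"
    by (rule integral_abs_bound)
  also have "\<dots> \<le> (\<integral>t. 2 * L * M * norm (A - B) \<partial>N)"
    by (rule integral_mono) (auto intro!: integrable_image_integral simp: *)
  finally show ?thesis using N.prob_space by simp
qed

lemma continuous_on_image_integral: "continuous_on SL2 (image_integral N \<phi>)"
  unfolding continuous_on_iff
proof (intro ballI allI impI)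
  fix A e assume A: "A \<in> SL2" and e: "(0::real) < e"
  define C where "C = 2 * L * norm A + 1"
  have C: "C > 0" using \<phi> by (auto simp: C_def even_lipschitz_def intro!: add_nonneg_pos)
  show "\<exists>d>0. \<forall>B\<in>SL2. dist B A < d \<longrightarrow> dist (image_integral N \<phi> B) (image_integral N \<phi> A) < e"
  proof (intro exI[of _ "e / C"] conjI ballI impI)
    show "0 < e / C" using e C by simp
    fix B assume B: "B \<in> SL2" "dist B A < e / C"
    have "dist (image_integral N \<phi> B) (image_integral N \<phi> A) \<le> 2 * L * norm A * dist B A"
      using image_integral_lipschitz[OF A order_refl B(1)]
      by (simp add: dist_norm norm_minus_commute abs_minus_commute)
    also have "\<dots> \<le> C * dist B A" by (intro mult_right_mono) (auto simp: C_def)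
    also have "\<dots> < e" using B(2) C by (simp add: field_simps)
    finally show "dist (image_integral N \<phi> B) (image_integral N \<phi> A) < e" .
  qed
qed

end

lemma image_integral_tendsto:
  assumes \<phi>: "even_lipschitz L \<phi>" and N: "\<And>j. real_distribution (Nj j)" "real_distribution N"
    and w: "weak_conv_m Nj N" and A: "A \<in> SL2"
  shows "(\<lambda>j. image_integral (Nj j) \<phi> A) \<longlonglongrightarrow> image_integral N \<phi> A"
  unfolding image_integral_def
proof (rule weak_conv_imp_integral_bdd_continuous_conv[OF N w, of _ 1])
  have "continuous_on UNIV (\<lambda>t. \<phi> (sgn (A *v dir t)))"
    unfolding sgn_div_norm using A
    by (intro continuous_on_compose2[OF continuous_on_even_lipschitz[OF \<phi>, of UNIV]] continuous_intros)
       (auto simp: SL2_vec_eq_0_iff)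
  then show "isCont (\<lambda>t. \<phi> (sgn (A *v dir t))) x" for x
    by (simp add: continuous_on_eq_continuous_within)
  show "norm (\<phi> (sgn (A *v dir x))) \<le> 1" for x
    using \<phi> by (auto simp: even_lipschitz_def)
qed

text \<open>Pointwise convergence becomes uniform on the compact set of matrices of norm at most \<open>M\<close>,
  because the functions are equicontinuous there: a finite net suffices.\<close>
lemma image_integral_uniform:
  assumes \<phi>: "even_lipschitz L \<phi>" and N: "\<And>j. real_distribution (Nj j)" "real_distribution N"
    and w: "weak_conv_m Nj N" and e: "0 < e"
  shows "eventually (\<lambda>j. \<forall>A\<in>SL2. norm A \<le> M \<longrightarrow> \<bar>image_integral (Nj j) \<phi> A - image_integral N \<phi> A\<bar> \<le> e) sequentially"
proof -
  define Q where "Q = {A \<in> SL2. norm A \<le> M}"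
  have L: "0 \<le> L" using \<phi> by (simp add: even_lipschitz_def)
  define d where "d = e / (3 * (2 * L * \<bar>M\<bar> + 1))"
  have d: "d > 0" using e L by (auto simp: d_def intro!: divide_pos_pos add_nonneg_pos)
  have "compact Q"
  proof -
    have "closed {A::real^2^2. A$1$1 * A$2$2 - A$1$2 * A$2$1 = 1}"
      by (intro closed_Collect_eq continuous_intros)
    moreover have "SL2 = {A::real^2^2. A$1$1 * A$2$2 - A$1$2 * A$2$1 = 1}"
      by (auto simp: SL2_det)
    ultimately have "closed (SL2 \<inter> cball 0 M)" by auto
    moreover have "Q = SL2 \<inter> cball 0 M" by (auto simp: Q_def)
    moreover have "bounded (SL2 \<inter> cball 0 M)" by (rule bounded_subset[OF bounded_cball]) auto
    ultimately show ?thesis by (simp add: compact_eq_bounded_closed)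
  qed
  then have "\<forall>e>0. \<exists>T. finite T \<and> T \<subseteq> Q \<and> Q \<subseteq> (\<Union>x\<in>T. ball x e)"
    by (intro seq_compact_imp_totally_bounded compact_imp_seq_compact)
  from this[rule_format, OF d] obtain T where T: "finite T" "T \<subseteq> Q" "Q \<subseteq> (\<Union>x\<in>T. ball x d)"
    by (elim exE conjE)
  have "eventually (\<lambda>j. \<forall>B\<in>T. \<bar>image_integral (Nj j) \<phi> B - image_integral N \<phi> B\<bar> < e / 3) sequentially"
  proof (intro eventually_ball_finite T ballI)
    fix B assume "B \<in> T"
    then have "B \<in> SL2" using T by (auto simp: Q_def)
    from tendstoD[OF image_integral_tendsto[OF \<phi> N w this], of "e/3"] e
    show "eventually (\<lambda>j. \<bar>image_integral (Nj j) \<phi> B - image_integral N \<phi> B\<bar> < e / 3) sequentially"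
      by (simp add: dist_real_def)
  qed
  then show ?thesis
  proof eventually_elim
    case (elim j)
    show ?case
    proof (intro ballI impI)
      fix A assume A: "A \<in> SL2" "norm A \<le> M"
      then obtain B where B: "B \<in> T" "dist B A < d" using T(3) by (force simp: Q_def)
      then have BS: "B \<in> SL2" using T by (auto simp: Q_def)
      have M: "M \<ge> 0" using A(2) norm_ge_zero[of A] by linarith
      have "2 * L * M * norm (A - B) \<le> (2 * L * \<bar>M\<bar> + 1) * d"
        using B(2) M L by (intro mult_mono) (auto simp: dist_norm norm_minus_commute)
      also have "\<dots> = e / 3"
      proof -
        have "2 * L * \<bar>M\<bar> + 1 > 0" using L by (intro add_nonneg_pos) auto
        moreover have "x * (e / (3 * x)) = e / 3" if "x > 0" for x :: real
          using that by (simp add: divide_simps)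
        ultimately show ?thesis unfolding d_def by blast
      qed
      finally have s: "2 * L * M * norm (A - B) \<le> e / 3" .
      have 1: "\<bar>image_integral (Nj j) \<phi> A - image_integral (Nj j) \<phi> B\<bar> \<le> e / 3"
        using image_integral_lipschitz[OF N(1) \<phi> A BS, of j] s by linarith
      have 2: "\<bar>image_integral N \<phi> A - image_integral N \<phi> B\<bar> \<le> e / 3"
        using image_integral_lipschitz[OF N(2) \<phi> A BS] s by linarith
      show "\<bar>image_integral (Nj j) \<phi> A - image_integral N \<phi> A\<bar> \<le> e"
        using 1 2 elim[rule_format, OF B(1)] by linarith
    qed
  qed
qed

section \<open>Passing to the limit in a variance\<close>

text \<open>Both the matrix law and the law of the line vary here, and the former only clusters. The
  function \<open>A \<mapsto> image_integral (Nj j) \<phi> A\<close> has variance tending to zero under \<open>\<kappa>j j\<close>. Uniform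
  convergence on bounded matrices, and tightness for the others, transfer this to the fixed
  function \<open>image_integral N \<phi>\<close>. The variance of a fixed bounded continuous function is
  determined by two weakly continuous functionals, so it vanishes under the cluster point.\<close>
lemma variance_limit:
  assumes \<phi>: "even_lipschitz L \<phi>"
    and N: "\<And>j. real_distribution (Nj j)" "real_distribution N" and w: "weak_conv_m Nj N"
    and \<kappa>j: "\<And>j. \<kappa>j j \<in> prob_measures_SL2" and \<kappa>: "\<kappa> \<in> prob_measures_SL2"
    and cluster: "\<And>U. openin weak_topology_SL2 U \<Longrightarrow> \<kappa> \<in> U \<Longrightarrow> frequently (\<lambda>j. \<kappa>j j \<in> U) sequentially"
    and tight: "\<And>e. 0 < e \<Longrightarrow> \<exists>M. \<forall>j. measure (\<kappa>j j) {A \<in> SL2. M < norm A} \<le> e"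
    and var: "(\<lambda>j. \<integral>A. (image_integral (Nj j) \<phi> A - c j)\<^sup>2 \<partial>\<kappa>j j) \<longlonglongrightarrow> 0"
    and c: "\<And>j. 0 \<le> c j" "\<And>j. c j \<le> 1"
  shows "AE A in \<kappa>. image_integral N \<phi> A = (\<integral>A. image_integral N \<phi> A \<partial>\<kappa>)"
proof -
  interpret K: prob_space \<kappa> by (rule prob_measures_SL2D[OF \<kappa>])
  interpret Kj: prob_space "\<kappa>j j" for j by (rule prob_measures_SL2D[OF \<kappa>j])
  define F where "F = image_integral N \<phi>"
  define Fj where "Fj j = image_integral (Nj j) \<phi>" for j
  have cont: "continuous_on SL2 F" "\<And>j. continuous_on SL2 (Fj j)"
    unfolding F_def Fj_def by (rule continuous_on_image_integral[OF N(2) \<phi>] continuous_on_image_integral[OF N(1) \<phi>])+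
  have rng: "0 \<le> F A" "F A \<le> 1" "0 \<le> Fj j A" "Fj j A \<le> 1" for j A
    unfolding F_def Fj_def
    using image_integral_range[OF N(2) \<phi>] image_integral_range[OF N(1) \<phi>] by auto
  note [measurable] = continuous_on_SL2_measurable[OF cont(1) \<kappa>]
    continuous_on_SL2_measurable[OF cont(1) \<kappa>j] continuous_on_SL2_measurable[OF cont(2) \<kappa>j]
  define a where "a = (\<integral>A. F A \<partial>\<kappa>)"
  have a: "0 \<le> a" "a \<le> 1"
  proof -
    show "0 \<le> a" unfolding a_def by (rule Bochner_Integration.integral_nonneg) (rule rng)
    have "a \<le> (\<integral>A. 1 \<partial>\<kappa>)" unfolding a_def
      by (rule integral_mono) (auto intro!: K.integrable_const_bound[of _ 1] simp: rng)
    then show "a \<le> 1" using K.prob_space by simp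
  qed
  have sq: "(x - y)\<^sup>2 \<le> 1" if "0 \<le> x" "x \<le> 1" "0 \<le> y" "y \<le> 1" for x y :: real
    using that by (intro power2_le_iff_abs_le[THEN iffD2, of 1, simplified]) auto
  have int: "integrable k (\<lambda>A. (f A - x)\<^sup>2)" "integrable k f"
    if "prob_space k" "f \<in> borel_measurable k" "\<And>A. 0 \<le> f A" "\<And>A. f A \<le> 1" "0 \<le> x" "x \<le> 1"
    for k :: "(real^2^2) measure" and f :: "real^2^2 \<Rightarrow> real" and x :: real
  proof -
    interpret prob_space k by fact
    show "integrable k (\<lambda>A. (f A - x)\<^sup>2)" "integrable k f"
      using that sq[OF that(3,4,5,6)] by (auto intro!: integrable_const_bound[of _ 1])
  qed
  define V where "V = (\<integral>A. (F A - a)\<^sup>2 \<partial>\<kappa>)"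
  have "V \<le> 8 * e" if e: "0 < e" "e \<le> 1" for e
  proof -
    obtain M where M: "\<And>j. measure (\<kappa>j j) {A \<in> SL2. M < norm A} \<le> e"
      using tight[OF e(1)] by blast
    define S1 where "S1 = {k \<in> prob_measures_SL2. (\<integral>A. (F A - a)\<^sup>2 \<partial>k) \<in> ball V e}"
    define S2 where "S2 = {k \<in> prob_measures_SL2. (\<integral>A. F A \<partial>k) \<in> ball a e}"
    have bF: "bounded (F ` SL2)" unfolding bounded_iff using rng by (intro exI[of _ 1]) auto
    have bF2: "bounded ((\<lambda>A. (F A - a)\<^sup>2) ` SL2)"
      unfolding bounded_iff using sq[OF rng(1,2) a] by (intro exI[of _ 1]) auto
    have "openin weak_topology_SL2 (S1 \<inter> S2)"
      unfolding S1_def S2_def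
      by (intro openin_Int openin_weak_topology_SL2 bF bF2 continuous_intros cont open_ball)
    moreover have "\<kappa> \<in> S1 \<inter> S2" using \<kappa> e by (simp add: S1_def S2_def V_def a_def)
    ultimately have fr: "frequently (\<lambda>j. \<kappa>j j \<in> S1 \<inter> S2) sequentially" by (rule cluster)
    have ev1: "eventually (\<lambda>j. \<forall>A\<in>SL2. norm A \<le> M \<longrightarrow> \<bar>Fj j A - F A\<bar> \<le> e) sequentially"
      unfolding F_def Fj_def by (rule image_integral_uniform[OF \<phi> N w e(1)])
    have ev2: "eventually (\<lambda>j. (\<integral>A. (Fj j A - c j)\<^sup>2 \<partial>\<kappa>j j) < e) sequentially"
      using order_tendstoD(2)[OF var e(1)] by (simp add: Fj_def)
    obtain j where j: "\<kappa>j j \<in> S1 \<inter> S2" "\<forall>A\<in>SL2. norm A \<le> M \<longrightarrow> \<bar>Fj j A - F A\<bar> \<le> e"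
      "(\<integral>A. (Fj j A - c j)\<^sup>2 \<partial>\<kappa>j j) < e"
    proof -
      from frequently_eventually_frequently[OF fr eventually_conj[OF ev1 ev2]]
      have "\<exists>j. \<kappa>j j \<in> S1 \<inter> S2 \<and> (\<forall>A\<in>SL2. norm A \<le> M \<longrightarrow> \<bar>Fj j A - F A\<bar> \<le> e) \<and> (\<integral>A. (Fj j A - c j)\<^sup>2 \<partial>\<kappa>j j) < e"
        using frequently_ex by fast
      then show thesis using that by blast
    qed
    define b where "b = (\<integral>A. F A \<partial>\<kappa>j j)"
    have b: "\<bar>a - b\<bar> < e" and V: "V < (\<integral>A. (F A - a)\<^sup>2 \<partial>\<kappa>j j) + e"
      using j(1) by (auto simp: S1_def S2_def b_def dist_real_def)
    have [measurable]: "F \<in> borel_measurable (\<kappa>j j)" "Fj j \<in> borel_measurable (\<kappa>j j)" by measurable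
    have iF: "integrable (\<kappa>j j) (\<lambda>A. (F A - x)\<^sup>2)" "integrable (\<kappa>j j) F" if "0 \<le> x" "x \<le> 1" for x
      by (rule int[OF Kj.prob_space_axioms _ rng(1,2) that]; measurable)+
    have iFj: "integrable (\<kappa>j j) (\<lambda>A. (Fj j A - c j)\<^sup>2)"
      by (rule int(1)[OF Kj.prob_space_axioms _ rng(3,4) c]) measurable
    define B where "B = {A \<in> SL2. M < norm A}"
    have Bm: "B \<in> sets (\<kappa>j j)"
    proof -
      have "B = {A \<in> space (\<kappa>j j). M < norm A}" by (simp add: B_def prob_measures_SL2D(3)[OF \<kappa>j])
      also have "\<dots> \<in> sets (\<kappa>j j)" using prob_measures_SL2D(4)[OF \<kappa>j] by measurable
      finally show ?thesis .
    qed
    \<comment> \<open>the mean square around \<open>a\<close> exceeds the one around \<open>c j\<close> by at most \<open>(a - b)\<^sup>2\<close>, as \<open>b\<close> is the mean\<close>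
    have e1: "(\<integral>A. (F A - a)\<^sup>2 \<partial>\<kappa>j j) = (\<integral>A. (F A - c j)\<^sup>2 \<partial>\<kappa>j j) + (a - b)\<^sup>2 - (c j - b)\<^sup>2"
    proof -
      have "(\<integral>A. (F A - a)\<^sup>2 - (F A - c j)\<^sup>2 \<partial>\<kappa>j j) = (\<integral>A. 2 * (c j - a) * F A + (a\<^sup>2 - (c j)\<^sup>2) \<partial>\<kappa>j j)"
        by (rule Bochner_Integration.integral_cong) (auto simp: power2_eq_square algebra_simps)
      also have "\<dots> = 2 * (c j - a) * b + (a\<^sup>2 - (c j)\<^sup>2)"
        using iF[of 0] Kj.prob_space by (simp add: b_def)
      finally have "(\<integral>A. (F A - a)\<^sup>2 \<partial>\<kappa>j j) - (\<integral>A. (F A - c j)\<^sup>2 \<partial>\<kappa>j j) = 2 * (c j - a) * b + (a\<^sup>2 - (c j)\<^sup>2)"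
        by (simp only: Bochner_Integration.integral_diff[OF iF(1)[OF a] iF(1)[OF c]])
      moreover have "2 * (c j - a) * b + (a\<^sup>2 - (c j)\<^sup>2) = (a - b)\<^sup>2 - (c j - b)\<^sup>2"
        by (simp add: power2_eq_square algebra_simps)
      ultimately show ?thesis by linarith
    qed
    have "(\<integral>A. (F A - c j)\<^sup>2 \<partial>\<kappa>j j) \<le> (\<integral>A. 2 * (Fj j A - c j)\<^sup>2 + (2 * e\<^sup>2 + 2 * indicator B A) \<partial>\<kappa>j j)"
    proof (rule integral_mono)
      show "integrable (\<kappa>j j) (\<lambda>A. (F A - c j)\<^sup>2)" using iF c by blast
      show "integrable (\<kappa>j j) (\<lambda>A. 2 * (Fj j A - c j)\<^sup>2 + (2 * e\<^sup>2 + 2 * indicator B A))"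
        using iFj Bm by (intro Bochner_Integration.integrable_add integrable_mult_right) (auto simp: Kj.emeasure_eq_measure)
      fix A assume "A \<in> space (\<kappa>j j)"
      then have A: "A \<in> SL2" by (simp add: prob_measures_SL2D(3)[OF \<kappa>j])
      have "(Fj j A - F A)\<^sup>2 \<le> e\<^sup>2 + indicator B A"
      proof (cases "A \<in> B")
        case True then show ?thesis using sq[OF rng(3,4) rng(1,2), of j A A] by (simp add: add_increasing)
      next
        case False
        then have "\<bar>Fj j A - F A\<bar> \<le> e" using j(2) A by (auto simp: B_def)
        then have "(Fj j A - F A)\<^sup>2 \<le> e\<^sup>2" by (intro power2_le_iff_abs_le[THEN iffD2]) (use e in auto)
        then show ?thesis using False by simp
      qed
      moreover have "(F A - c j)\<^sup>2 \<le> 2 * (Fj j A - c j)\<^sup>2 + 2 * (Fj j A - F A)\<^sup>2"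
        using square_diff_le[of "Fj j A - c j" "Fj j A - F A"] by simp
      ultimately show "(F A - c j)\<^sup>2 \<le> 2 * (Fj j A - c j)\<^sup>2 + (2 * e\<^sup>2 + 2 * indicator B A)"
        by linarith
    qed
    also have "\<dots> = 2 * (\<integral>A. (Fj j A - c j)\<^sup>2 \<partial>\<kappa>j j) + 2 * e\<^sup>2 + 2 * measure (\<kappa>j j) B"
      using iFj Bm Kj.prob_space
      by (subst Bochner_Integration.integral_add) (auto simp: Kj.emeasure_eq_measure)
    also have "\<dots> \<le> 2 * e + 2 * e\<^sup>2 + 2 * e" using j(3) M[of j] by (simp add: B_def)
    finally have "(\<integral>A. (F A - c j)\<^sup>2 \<partial>\<kappa>j j) \<le> 2 * e + 2 * e\<^sup>2 + 2 * e" .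
    moreover have "e\<^sup>2 \<le> e" using e by (simp add: power2_eq_square mult_left_le)
    moreover have "(a - b)\<^sup>2 \<le> e\<^sup>2" using b by (intro power2_le_iff_abs_le[THEN iffD2]) auto
    moreover have "0 \<le> (c j - b)\<^sup>2" by simp
    ultimately show ?thesis using V e1 by linarith
  qed
  then have "V \<le> 0"
  proof -
    assume *: "\<And>e. 0 < e \<Longrightarrow> e \<le> 1 \<Longrightarrow> V \<le> 8 * e"
    show ?thesis
    proof (rule ccontr)
      assume "\<not> V \<le> 0"
      then have "V \<le> 8 * (min 1 (V / 16))" by (intro *) auto
      with \<open>\<not> V \<le> 0\<close> show False by (simp add: min_def split: if_splits)
    qed
  qed
  moreover have "0 \<le> V" unfolding V_def by simp
  ultimately have "V = 0" by simp
  then have "AE A in \<kappa>. (F A - a)\<^sup>2 = 0"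
    unfolding V_def using int(1)[OF K.prob_space_axioms _ rng(1,2) a]
    by (subst (asm) integral_nonneg_eq_0_iff_AE) auto
  then show ?thesis by (simp add: F_def a_def)
qed

section \<open>Measures on the projective line\<close>

text \<open>The topology of the projective line is that of scale-invariant open sets in the punctured plane.
  The cones over finite unions of basic open sets form a countable family that exhausts each of
  them from inside.\<close>
definition line_cone :: "(real^2) set set \<Rightarrow> (real^2) set" where
  "line_cone W = {v. v \<noteq> 0 \<and> (\<exists>c. c \<noteq> 0 \<and> c *\<^sub>R v \<in> \<Union>W)}"

text \<open>Lipschitz cutoffs increasing to the indicator of a cone, evaluated on unit vectors.\<close>
definition bump :: "(real^2) set set \<Rightarrow> nat \<Rightarrow> real^2 \<Rightarrow> real" where
  "bump W n x = min 1 (real n * infdist x (- line_cone W))"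

lemma cone_scaleR: "c \<noteq> 0 \<Longrightarrow> c *\<^sub>R v \<in> line_cone W \<longleftrightarrow> v \<in> line_cone W"
proof -
  assume c: "c \<noteq> 0"
  have "(\<exists>d. d \<noteq> 0 \<and> d *\<^sub>R (c *\<^sub>R v) \<in> \<Union>W) \<longleftrightarrow> (\<exists>d. d \<noteq> 0 \<and> d *\<^sub>R v \<in> \<Union>W)"
  proof
    assume "\<exists>d. d \<noteq> 0 \<and> d *\<^sub>R v \<in> \<Union>W"
    then obtain d where "d \<noteq> 0" "d *\<^sub>R v \<in> \<Union>W" by blast
    with c show "\<exists>d. d \<noteq> 0 \<and> d *\<^sub>R (c *\<^sub>R v) \<in> \<Union>W" by (intro exI[of _ "d / c"]) auto
  next
    assume "\<exists>d. d \<noteq> 0 \<and> d *\<^sub>R (c *\<^sub>R v) \<in> \<Union>W"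
    then obtain d where "d \<noteq> 0" "d *\<^sub>R (c *\<^sub>R v) \<in> \<Union>W" by blast
    with c show "\<exists>d. d \<noteq> 0 \<and> d *\<^sub>R v \<in> \<Union>W" by (intro exI[of _ "d * c"]) auto
  qed
  with c show ?thesis by (auto simp: line_cone_def)
qed

lemma open_cone:
  assumes "\<And>U. U \<in> W \<Longrightarrow> open U" shows "open (line_cone W)"
proof -
  have "open ((\<lambda>v. c *\<^sub>R v) -` \<Union>W)" for c :: real
    using assms by (intro open_vimage continuous_intros open_Union) auto
  then have "open ((\<Union>c\<in>-{0}. (\<lambda>v. c *\<^sub>R v) -` \<Union>W) \<inter> - {0})"
    by (intro open_Int open_UN) auto
  also have "(\<Union>c\<in>-{0}. (\<lambda>v. c *\<^sub>R v) -` \<Union>W) \<inter> - {0} = line_cone W"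
    by (auto simp: line_cone_def)
  finally show ?thesis .
qed

lemma even_lipschitz_bump: "even_lipschitz (real n) (bump W n)"
  unfolding even_lipschitz_def
proof (intro conjI allI)
  fix x y :: "real^2"
  show "0 \<le> bump W n x" "bump W n x \<le> 1" by (auto simp: bump_def infdist_nonneg)
  have "- v \<in> line_cone W \<longleftrightarrow> v \<in> line_cone W" for v
    using cone_scaleR[of "-1" v W] by simp
  moreover have "uminus ` D = {v. - v \<in> D}" for D :: "(real^2) set"
    using image_iff by fastforce
  ultimately have "- line_cone W = uminus ` (- line_cone W)" by auto
  then have "infdist (- x) (- line_cone W) = infdist (- x) (uminus ` (- line_cone W))" by simp
  also have "\<dots> = infdist x (- line_cone W)"
    unfolding infdist_def by (simp add: image_image dist_minus)
  finally show "bump W n (- x) = bump W n x" by (simp add: bump_def)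
  have "\<bar>bump W n x - bump W n y\<bar> \<le> \<bar>real n * infdist x (- line_cone W) - real n * infdist y (- line_cone W)\<bar>"
    unfolding bump_def by (auto simp: min_def)
  also have "\<dots> = real n * \<bar>infdist x (- line_cone W) - infdist y (- line_cone W)\<bar>"
    by (simp add: abs_mult right_diff_distrib[symmetric])
  also have "\<dots> \<le> real n * dist x y"
    by (intro mult_left_mono infdist_triangle_abs) simp
  finally show "\<bar>bump W n x - bump W n y\<bar> \<le> real n * dist x y" .
qed simp

lemma bump_tendsto:
  assumes "\<And>U. U \<in> W \<Longrightarrow> open U" "x \<noteq> 0"
  shows "(\<lambda>n. bump W n (sgn x)) \<longlonglongrightarrow> indicator (line_cone W) x"
proof (cases "x \<in> line_cone W")
  case False
  then have "sgn x \<in> - line_cone W"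
    using assms(2) cone_scaleR[of "inverse (norm x)" x W] by (simp add: sgn_div_norm)
  then have "infdist (sgn x) (- line_cone W) = 0" by (rule infdist_zero)
  then show ?thesis using False by (simp add: bump_def)
next
  case True
  then have s: "sgn x \<in> line_cone W"
    using assms(2) cone_scaleR[of "inverse (norm x)" x W] by (simp add: sgn_div_norm)
  have cl: "closed (- line_cone W)" using open_cone[OF assms(1)] by (simp add: open_closed)
  have "0 \<in> - line_cone W" by (simp add: line_cone_def)
  then have ne: "- line_cone W \<noteq> {}" by blast
  have pos: "infdist (sgn x) (- line_cone W) > 0"
    using in_closed_iff_infdist_zero[OF cl ne, of "sgn x"] s infdist_nonneg[of "sgn x" "- line_cone W"] by force
  have "eventually (\<lambda>n. bump W n (sgn x) = 1) sequentially"
  proof -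
    obtain k :: nat where k: "1 / infdist (sgn x) (- line_cone W) < real k" using reals_Archimedean2 by blast
    show ?thesis unfolding eventually_sequentially
    proof (intro exI[of _ k] allI impI)
      fix n assume "k \<le> n"
      then have "1 / infdist (sgn x) (- line_cone W) < real n" using k by linarith
      then have "1 < real n * infdist (sgn x) (- line_cone W)" using pos by (simp add: field_simps)
      then show "bump W n (sgn x) = 1" by (simp add: bump_def)
    qed
  qed
  then show ?thesis using True by (simp add: tendsto_eventually)
qed

lemma span_scaleR: "c \<noteq> 0 \<Longrightarrow> span {c *\<^sub>R v} = span {v :: real^2}"
  using span_image_scale[of "{v}" "\<lambda>_. c"] by simp

lemma span_in_RP1: "v \<noteq> 0 \<Longrightarrow> span {v} \<in> RP1"
  by (simp add: RP1_def subspace_span dim_span)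

lemma measurable_span_RP1:
  fixes f :: "real \<Rightarrow> real^2"
  assumes f: "continuous_on UNIV f" "\<And>t. f t \<noteq> 0"
  shows "(\<lambda>t. span {f t}) \<in> measurable borel RP1_borel"
  unfolding RP1_borel_def
proof (rule measurable_measure_of)
  show "{U. openin RP1_topology U} \<subseteq> Pow RP1" by (auto simp: openin_RP1_topology)
  show "(\<lambda>t. span {f t}) \<in> space borel \<rightarrow> RP1" using f(2) by (simp add: span_in_RP1)
  fix U assume "U \<in> {U. openin RP1_topology U}"
  then have "open {v. v \<noteq> 0 \<and> span {v} \<in> U}" by (simp add: openin_RP1_topology)
  then have "open (f -` {v. v \<noteq> 0 \<and> span {v} \<in> U})" using f(1) by (intro open_vimage)
  also have "f -` {v. v \<noteq> 0 \<and> span {v} \<in> U} = (\<lambda>t. span {f t}) -` U \<inter> space borel"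
    using f(2) by auto
  finally show "(\<lambda>t. span {f t}) -` U \<inter> space borel \<in> sets borel" by simp
qed

lemma measurable_span_action:
  assumes "real_distribution N" "A \<in> SL2"
  shows "(\<lambda>t. span {A *v dir t}) \<in> measurable N RP1_borel"
proof -
  interpret real_distribution N by fact
  have "(\<lambda>t. span {A *v dir t}) \<in> measurable borel RP1_borel"
    using assms(2) by (intro measurable_span_RP1 continuous_intros) (auto simp: SL2_vec_eq_0_iff)
  then show ?thesis by (subst measurable_cong_sets[OF events_eq_borel refl])
qed

lemma measure_cone_limit:
  assumes N: "real_distribution N" and A: "A \<in> SL2" and W: "\<And>U. U \<in> W \<Longrightarrow> open U"
  shows "(\<lambda>n. image_integral N (bump W n) A) \<longlonglongrightarrow> measure N {t. A *v dir t \<in> line_cone W}"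
proof -
  interpret N: real_distribution N by (fact N)
  have [measurable]: "line_cone W \<in> sets borel" by (rule borel_open, rule open_cone, rule W)
  have "(\<lambda>n. \<integral>t. bump W n (sgn (A *v dir t)) \<partial>N) \<longlonglongrightarrow> (\<integral>t. indicator (line_cone W) (A *v dir t) \<partial>N)"
  proof (rule integral_dominated_convergence[where w = "\<lambda>_. 1"])
    show "(\<lambda>t. bump W n (sgn (A *v dir t))) \<in> borel_measurable N" for n
      using measurable_even_lipschitz[OF even_lipschitz_bump[of n W]] by measurable
    show "AE t in N. norm (bump W n (sgn (A *v dir t))) \<le> 1" for n
      using even_lipschitz_bump[of n W] by (auto simp: even_lipschitz_def)
    show "AE t in N. (\<lambda>n. bump W n (sgn (A *v dir t))) \<longlonglongrightarrow> indicator (line_cone W) (A *v dir t)"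
      using A by (intro AE_I2 bump_tendsto W) (auto simp: SL2_vec_eq_0_iff)
  qed (auto simp: N.integrable_const)
  also have "(\<integral>t. indicator (line_cone W) (A *v dir t) \<partial>N) = (\<integral>t. indicator {t. A *v dir t \<in> line_cone W} t \<partial>N)"
    by (rule Bochner_Integration.integral_cong) (auto simp: indicator_def)
  also have "\<dots> = measure N {t. A *v dir t \<in> line_cone W}" by simp
  finally show ?thesis by (simp add: image_integral_def)
qed

text \<open>Countably many test functions determine a measure on the projective line: they fix the mass of
  the cones over finite unions of basic sets, by continuity from below the mass of every open set,
  and the open sets are stable under intersection and generate the Borel sets.\<close>
lemma distr_RP1_eq:
  fixes \<B> :: "(real^2) set set"
  assumes N: "real_distribution N" and A: "A \<in> SL2" and B: "B \<in> SL2"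
    and \<B>: "countable \<B>" "topological_basis \<B>"
    and eq: "\<And>W n. finite W \<Longrightarrow> W \<subseteq> \<B> \<Longrightarrow> image_integral N (bump W n) A = image_integral N (bump W n) B"
  shows "distr N RP1_borel (\<lambda>t. span {A *v dir t}) = distr N RP1_borel (\<lambda>t. span {B *v dir t})"
proof -
  interpret N: real_distribution N by (fact N)
  have op: "open U" if "U \<in> \<B>" for U using \<B>(2) that by (rule topological_basis_open)
  have cone_eq: "measure N {t. A *v dir t \<in> line_cone W} = measure N {t. B *v dir t \<in> line_cone W}"
    if "finite W" "W \<subseteq> \<B>" for W
  proof (rule LIMSEQ_unique)
    have "\<And>U. U \<in> W \<Longrightarrow> open U" using op that by auto
    then show "(\<lambda>n. image_integral N (bump W n) A) \<longlonglongrightarrow> measure N {t. A *v dir t \<in> line_cone W}"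
      and "(\<lambda>n. image_integral N (bump W n) A) \<longlonglongrightarrow> measure N {t. B *v dir t \<in> line_cone W}"
      using measure_cone_limit[OF N A, of W] measure_cone_limit[OF N B, of W] eq[OF that] by auto
  qed
  note [measurable] = measurable_span_action[OF N]
  have key: "measure N {t. span {A *v dir t} \<in> U} = measure N {t. span {B *v dir t} \<in> U}"
    if "openin RP1_topology U" for U
  proof -
    define O' where "O' = {v. v \<noteq> 0 \<and> span {v} \<in> U}"
    have "open O'" using that by (simp add: openin_RP1_topology O'_def)
    then obtain \<B>' where \<B>': "\<B>' \<subseteq> \<B>" "\<Union>\<B>' = O'" using \<B>(2) unfolding topological_basis_def by blast
    have scale: "c *\<^sub>R v \<in> O' \<longleftrightarrow> v \<in> O'" if "c \<noteq> 0" for c v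
      using that by (simp add: O'_def span_scaleR)
    have setC: "{t. span {C *v dir t} \<in> U} = {t. C *v dir t \<in> O'}" if "C \<in> SL2" for C
      using that by (auto simp: O'_def SL2_vec_eq_0_iff)
    show ?thesis
    proof (cases "\<B>' = {}")
      case True
      then show ?thesis using \<B>' setC[OF A] setC[OF B] by simp
    next
      case False
      have cB': "countable \<B>'" using \<B>(1) \<B>'(1) countable_subset by blast
      define W where "W n = from_nat_into \<B>' ` {..n}" for n
      have W: "finite (W n)" "W n \<subseteq> \<B>'" for n
        using from_nat_into[OF False] by (auto simp: W_def)
      have UW: "(\<Union>n. W n) = \<B>'"
      proof -
        have "(\<Union>n. W n) = from_nat_into \<B>' ` (\<Union>n. {..n})" by (simp only: W_def image_UN)
        also have "(\<Union>n::nat. {..n}) = UNIV" by auto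
        finally show ?thesis using range_from_nat_into[OF False cB'] by simp
      qed
      have inc: "incseq (\<lambda>n. {t. C *v dir t \<in> line_cone (W n)})" for C
        unfolding incseq_def W_def line_cone_def by fastforce
      have lim: "(\<lambda>n. measure N {t. C *v dir t \<in> line_cone (W n)}) \<longlonglongrightarrow> measure N {t. C *v dir t \<in> O'}" if "C \<in> SL2" for C
      proof -
        have Un: "(\<Union>n. {t. C *v dir t \<in> line_cone (W n)}) = {t. C *v dir t \<in> O'}"
        proof (intro set_eqI iffI)
          fix t assume "t \<in> {t. C *v dir t \<in> O'}"
          then have "C *v dir t \<in> \<Union>\<B>'" by (simp add: \<B>')
          then obtain n where "C *v dir t \<in> \<Union>(W n)" using UW by blast
          then show "t \<in> (\<Union>n. {t. C *v dir t \<in> line_cone (W n)})"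
            using that by (auto simp: line_cone_def SL2_vec_eq_0_iff intro!: exI[of _ n] exI[of _ "1::real"])
        next
          fix t assume "t \<in> (\<Union>n. {t. C *v dir t \<in> line_cone (W n)})"
          then obtain n c where "c \<noteq> 0" "c *\<^sub>R (C *v dir t) \<in> \<Union>(W n)" by (auto simp: line_cone_def)
          then have "c *\<^sub>R (C *v dir t) \<in> O'" using W(2)[of n] \<B>'(2) by blast
          then show "t \<in> {t. C *v dir t \<in> O'}" using scale[OF \<open>c \<noteq> 0\<close>] by simp
        qed
        have "range (\<lambda>n. {t. C *v dir t \<in> line_cone (W n)}) \<subseteq> sets N"
        proof clarify
          fix n
          have [measurable]: "line_cone (W n) \<in> sets borel"
            by (rule borel_open, rule open_cone) (use op W(2)[of n] \<B>'(1) in blast)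
          show "{t. C *v dir t \<in> line_cone (W n)} \<in> sets N" by measurable
        qed
        from N.finite_Lim_measure_incseq[OF this inc] show ?thesis unfolding Un .
      qed
      have "(\<lambda>n. measure N {t. A *v dir t \<in> line_cone (W n)}) = (\<lambda>n. measure N {t. B *v dir t \<in> line_cone (W n)})"
        by (rule ext, rule cone_eq[OF W(1)]) (use W(2) \<B>'(1) in blast)
      then have "measure N {t. A *v dir t \<in> O'} = measure N {t. B *v dir t \<in> O'}"
        using lim[OF A] lim[OF B] LIMSEQ_unique by metis
      then show ?thesis using setC[OF A] setC[OF B] by simp
    qed
  qed
  show ?thesis
  proof (rule measure_eqI_generator_eq[where E = "{U. openin RP1_topology U}" and \<Omega> = RP1 and A = "\<lambda>_. RP1"])
    show "Int_stable {U. openin RP1_topology U}" by (auto simp: Int_stable_def)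
    show "{U. openin RP1_topology U} \<subseteq> Pow RP1" by (auto simp: openin_RP1_topology)
    have "open {v::real^2. v \<noteq> 0 \<and> span {v} \<in> RP1}"
    proof -
      have "{v::real^2. v \<noteq> 0 \<and> span {v} \<in> RP1} = - {0}" by (auto simp: span_in_RP1)
      then show ?thesis by (simp add: open_Compl)
    qed
    then have "openin RP1_topology RP1" by (simp add: openin_RP1_topology)
    then show "range (\<lambda>_. RP1) \<subseteq> {U. openin RP1_topology U}" by auto
    have s: "sets RP1_borel = sigma_sets RP1 {U. openin RP1_topology U}"
      unfolding RP1_borel_def by (rule sets_measure_of) (auto simp: openin_RP1_topology)
    then show "sets (distr N RP1_borel (\<lambda>t. span {A *v dir t})) = sigma_sets RP1 {U. openin RP1_topology U}"
      "sets (distr N RP1_borel (\<lambda>t. span {B *v dir t})) = sigma_sets RP1 {U. openin RP1_topology U}" by auto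
    fix U assume U: "U \<in> {U. openin RP1_topology U}"
    then have Us: "U \<in> sets RP1_borel" unfolding s by blast
    have "emeasure (distr N RP1_borel (\<lambda>t. span {C *v dir t})) U = ennreal (measure N {t. span {C *v dir t} \<in> U})"
      if "C \<in> SL2" for C
      using that Us by (subst emeasure_distr) (auto simp: N.emeasure_eq_measure vimage_def)
    with key[of U] U A B
    show "emeasure (distr N RP1_borel (\<lambda>t. span {A *v dir t})) U = emeasure (distr N RP1_borel (\<lambda>t. span {B *v dir t})) U"
      by simp
  next
    fix i :: nat
    interpret D: prob_space "distr N RP1_borel (\<lambda>t. span {A *v dir t})"
      by (rule N.prob_space_distr) (use A in measurable)
    show "emeasure (distr N RP1_borel (\<lambda>t. span {A *v dir t})) RP1 \<noteq> \<infinity>"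
      by simp
  qed auto
qed

section \<open>Averaging on the square-integrable functions of the plane\<close>

text \<open>The bounds \<open>0 \<le> f \<le> 1\<close> make every average over matrices finite; averaging preserves
  the whole class.\<close>
definition unit_L2 :: "(real^2 \<Rightarrow> real) \<Rightarrow> bool" where
  "unit_L2 f \<longleftrightarrow> f \<in> borel_measurable borel \<and> (\<forall>v. 0 \<le> f v \<and> f v \<le> 1) \<and> integrable lborel (\<lambda>v. (f v)\<^sup>2)"

abbreviation energy :: "(real^2 \<Rightarrow> real) \<Rightarrow> real" where
  "energy f \<equiv> \<integral>v. (f v)\<^sup>2 \<partial>lborel"

text \<open>The mean of the unitary operators \<open>f \<mapsto> f \<circ> A\<inverse>\<close>, which represent \<open>SL(2)\<close> on the
  square-integrable functions of the plane.\<close>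
definition avg :: "(real^2^2) measure \<Rightarrow> (real^2 \<Rightarrow> real) \<Rightarrow> real^2 \<Rightarrow> real" where
  "avg \<kappa> f v = (\<integral>A. f (adj2 A *v v) \<partial>\<kappa>)"

lemma integral_lborel_SL2:
  fixes g :: "real^2 \<Rightarrow> real"
  assumes "A \<in> SL2" and [measurable]: "g \<in> borel_measurable borel"
  shows "(\<integral>v. g (A *v v) \<partial>lborel) = (\<integral>v. g v \<partial>lborel)"
    and "integrable lborel (\<lambda>v. g (A *v v)) \<longleftrightarrow> integrable lborel g"
proof -
  show "(\<integral>v. g (A *v v) \<partial>lborel) = (\<integral>v. g v \<partial>lborel)"
    by (subst (2) distr_lborel_SL2[OF assms(1), symmetric], subst integral_distr) auto
  show "integrable lborel (\<lambda>v. g (A *v v)) \<longleftrightarrow> integrable lborel g"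
    by (subst (2) distr_lborel_SL2[OF assms(1), symmetric], subst integrable_distr_eq) auto
qed

lemma Cauchy_Schwarz_integral:
  fixes f g :: "'a \<Rightarrow> real"
  assumes [measurable]: "f \<in> borel_measurable M" "g \<in> borel_measurable M"
    and f: "integrable M (\<lambda>x. (f x)\<^sup>2)" and g: "integrable M (\<lambda>x. (g x)\<^sup>2)"
  shows "integrable M (\<lambda>x. f x * g x)"
    "(\<integral>x. f x * g x \<partial>M)\<^sup>2 \<le> (\<integral>x. (f x)\<^sup>2 \<partial>M) * (\<integral>x. (g x)\<^sup>2 \<partial>M)"
proof -
  have isum: "integrable M (\<lambda>x. (f x)\<^sup>2 + (g x)\<^sup>2)" using f g by simp
  have bnd: "\<bar>f x\<bar> * \<bar>g x\<bar> \<le> (f x)\<^sup>2 + (g x)\<^sup>2" for x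
  proof -
    have "(\<bar>f x\<bar> - \<bar>g x\<bar>)\<^sup>2 = (f x)\<^sup>2 + (g x)\<^sup>2 - 2 * (\<bar>f x\<bar> * \<bar>g x\<bar>)"
      by (simp add: power2_diff)
    moreover have "0 \<le> (\<bar>f x\<bar> - \<bar>g x\<bar>)\<^sup>2" "0 \<le> \<bar>f x\<bar> * \<bar>g x\<bar>" by simp_all
    ultimately show ?thesis by linarith
  qed
  have iabs: "integrable M (\<lambda>x. \<bar>f x\<bar> * \<bar>g x\<bar>)"
    by (rule Bochner_Integration.integrable_bound[OF isum]) (use bnd in \<open>auto simp: abs_mult\<close>)
  then show ifg: "integrable M (\<lambda>x. f x * g x)"
    by (rule Bochner_Integration.integrable_bound) (auto simp: abs_mult)
  define J where "J = (\<integral>x. \<bar>f x\<bar> * \<bar>g x\<bar> \<partial>M)"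
  have nn: "0 \<le> J" by (simp add: J_def)
  have "(\<integral>\<^sup>+x. ennreal \<bar>f x\<bar> * ennreal \<bar>g x\<bar> \<partial>M)\<^sup>2
     \<le> (\<integral>\<^sup>+x. (ennreal \<bar>f x\<bar>)\<^sup>2 \<partial>M) * (\<integral>\<^sup>+x. (ennreal \<bar>g x\<bar>)\<^sup>2 \<partial>M)"
    by (rule Cauchy_Schwarz_nn_integral) measurable
  also have "(\<lambda>x. (ennreal \<bar>f x\<bar>)\<^sup>2) = (\<lambda>x. ennreal ((f x)\<^sup>2))" by (simp add: ennreal_power)
  also have "(\<lambda>x. (ennreal \<bar>g x\<bar>)\<^sup>2) = (\<lambda>x. ennreal ((g x)\<^sup>2))" by (simp add: ennreal_power)
  also have "(\<integral>\<^sup>+x. ennreal ((f x)\<^sup>2) \<partial>M) = ennreal (\<integral>x. (f x)\<^sup>2 \<partial>M)"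
    by (rule nn_integral_eq_integral[OF f]) simp
  also have "(\<integral>\<^sup>+x. ennreal ((g x)\<^sup>2) \<partial>M) = ennreal (\<integral>x. (g x)\<^sup>2 \<partial>M)"
    by (rule nn_integral_eq_integral[OF g]) simp
  also have "(\<integral>\<^sup>+x. ennreal \<bar>f x\<bar> * ennreal \<bar>g x\<bar> \<partial>M) = ennreal J"
    unfolding J_def ennreal_mult[symmetric, OF abs_ge_zero abs_ge_zero]
    by (rule nn_integral_eq_integral[OF iabs]) simp
  finally have "ennreal (J\<^sup>2) \<le> ennreal ((\<integral>x. (f x)\<^sup>2 \<partial>M) * (\<integral>x. (g x)\<^sup>2 \<partial>M))"
    using nn by (simp add: ennreal_power ennreal_mult)
  then have J2: "J\<^sup>2 \<le> (\<integral>x. (f x)\<^sup>2 \<partial>M) * (\<integral>x. (g x)\<^sup>2 \<partial>M)" by (simp add: ennreal_le_iff)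
  have "\<bar>\<integral>x. f x * g x \<partial>M\<bar> \<le> J"
    unfolding J_def using integral_abs_bound[of M "\<lambda>x. f x * g x"] by (simp add: abs_mult)
  then have "(\<integral>x. f x * g x \<partial>M)\<^sup>2 \<le> J\<^sup>2" using nn abs_le_square_iff by fastforce
  with J2 show "(\<integral>x. f x * g x \<partial>M)\<^sup>2 \<le> (\<integral>x. (f x)\<^sup>2 \<partial>M) * (\<integral>x. (g x)\<^sup>2 \<partial>M)" by linarith
qed

text \<open>Closeness of \<open>a\<close> and \<open>m\<close> in mean square makes the densities \<open>a\<^sup>2\<close> and \<open>m\<^sup>2\<close> close against
  bounded functions, since \<open>a\<^sup>2 - m\<^sup>2 = (a - m) (a + m)\<close>.\<close>
lemma square_diff_Cauchy_Schwarz: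
  fixes a m g :: "'a \<Rightarrow> real"
  assumes [measurable]: "a \<in> borel_measurable M" "m \<in> borel_measurable M" "g \<in> borel_measurable M"
    and ia: "integrable M (\<lambda>x. (a x)\<^sup>2)" and im: "integrable M (\<lambda>x. (m x)\<^sup>2)"
    and g: "\<And>x. 0 \<le> g x" "\<And>x. g x \<le> 1"
  shows "((\<integral>x. g x * (a x)\<^sup>2 \<partial>M) - (\<integral>x. g x * (m x)\<^sup>2 \<partial>M))\<^sup>2
    \<le> (\<integral>x. (a x - m x)\<^sup>2 \<partial>M) * (2 * (\<integral>x. (a x)\<^sup>2 \<partial>M) + 2 * (\<integral>x. (m x)\<^sup>2 \<partial>M))"
proof -
  have bnd: "(g x * (a x + m x))\<^sup>2 \<le> 2 * (a x)\<^sup>2 + 2 * (m x)\<^sup>2" for x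
  proof -
    have "(g x)\<^sup>2 * (a x + m x)\<^sup>2 \<le> (a x + m x)\<^sup>2"
      using g[of x] by (intro mult_left_le_one_le power_le_one) auto
    with square_add_le[of "a x" "m x"] show ?thesis by (simp add: power_mult_distrib)
  qed
  have isum: "integrable M (\<lambda>x. 2 * (a x)\<^sup>2 + 2 * (m x)\<^sup>2)" using ia im by simp
  have id: "integrable M (\<lambda>x. (a x - m x)\<^sup>2)"
    by (rule Bochner_Integration.integrable_bound[OF isum]) (use square_diff_le in auto)
  have ip: "integrable M (\<lambda>x. (g x * (a x + m x))\<^sup>2)"
    by (rule Bochner_Integration.integrable_bound[OF isum]) (use bnd in auto)
  have ig: "integrable M (\<lambda>x. g x * (a x)\<^sup>2)" "integrable M (\<lambda>x. g x * (m x)\<^sup>2)"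
    by (rule Bochner_Integration.integrable_bound[OF ia] Bochner_Integration.integrable_bound[OF im];
        use g in \<open>auto simp: abs_mult intro!: mult_left_le_one_le\<close>)+
  have "(\<integral>x. g x * (a x)\<^sup>2 \<partial>M) - (\<integral>x. g x * (m x)\<^sup>2 \<partial>M) = (\<integral>x. g x * (a x)\<^sup>2 - g x * (m x)\<^sup>2 \<partial>M)"
    by (simp add: Bochner_Integration.integral_diff[OF ig])
  also have "\<dots> = (\<integral>x. (a x - m x) * (g x * (a x + m x)) \<partial>M)"
    by (rule Bochner_Integration.integral_cong) (simp_all add: power2_eq_square algebra_simps)
  also have "\<dots>\<^sup>2 \<le> (\<integral>x. (a x - m x)\<^sup>2 \<partial>M) * (\<integral>x. (g x * (a x + m x))\<^sup>2 \<partial>M)"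
    by (rule Cauchy_Schwarz_integral(2)[OF _ _ id ip]) measurable
  also have "\<dots> \<le> (\<integral>x. (a x - m x)\<^sup>2 \<partial>M) * (\<integral>x. 2 * (a x)\<^sup>2 + 2 * (m x)\<^sup>2 \<partial>M)"
    by (intro mult_left_mono integral_mono ip isum bnd) simp
  finally show ?thesis using ia im by simp
qed

context
  fixes \<kappa> f
  assumes \<kappa>: "\<kappa> \<in> prob_measures_SL2" and f: "unit_L2 f"
begin

interpretation K: prob_space \<kappa> by (rule prob_measures_SL2D[OF \<kappa>])

interpretation KL: pair_sigma_finite \<kappa> "lborel :: (real^2) measure" ..

lemma unit_L2_measurable [measurable]: "f \<in> borel_measurable borel" using f by (simp add: unit_L2_def)

lemma unit_L2_range: "0 \<le> f v" "f v \<le> 1" using f by (auto simp: unit_L2_def)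

lemma unit_L2_integrable: "integrable lborel (\<lambda>v. (f v)\<^sup>2)" using f by (simp add: unit_L2_def)

lemma matrix_measurable [measurable]: "(\<lambda>A. A) \<in> measurable \<kappa> borel" by (rule prob_measures_SL2D[OF \<kappa>])

lemma pullback_measurable [measurable]: "(\<lambda>x. f (adj2 (fst x) *v snd x)) \<in> borel_measurable (\<kappa> \<Otimes>\<^sub>M lborel)"
proof -
  have [measurable]: "fst \<in> measurable (\<kappa> \<Otimes>\<^sub>M lborel) borel"
    by (rule measurable_compose[OF measurable_fst matrix_measurable])
  have [measurable]: "snd \<in> measurable (\<kappa> \<Otimes>\<^sub>M (lborel :: (real^2) measure)) borel"
    using measurable_snd[of \<kappa> "lborel :: (real^2) measure"] by simp
  show ?thesis by measurable
qed

lemma avg_measurable [measurable]: "avg \<kappa> f \<in> borel_measurable borel"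
proof -
  have "(\<lambda>v. \<integral>A. f (adj2 A *v v) \<partial>\<kappa>) \<in> borel_measurable lborel"
  proof (rule K.borel_measurable_lebesgue_integral)
    have [measurable]: "snd \<in> measurable (lborel \<Otimes>\<^sub>M \<kappa>) borel"
      by (rule measurable_compose[OF measurable_snd matrix_measurable])
    have [measurable]: "fst \<in> measurable ((lborel :: (real^2) measure) \<Otimes>\<^sub>M \<kappa>) borel"
      using measurable_fst[of "lborel :: (real^2) measure" \<kappa>] by simp
    have "(\<lambda>x. f (adj2 (snd x) *v fst x)) \<in> borel_measurable (lborel \<Otimes>\<^sub>M \<kappa>)" by measurable
    then show "(\<lambda>(v, A). f (adj2 A *v v)) \<in> borel_measurable (lborel \<Otimes>\<^sub>M \<kappa>)" by (simp add: split_beta')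
  qed
  then show ?thesis by (simp add: avg_def[abs_def])
qed

lemma slice_integrable: "integrable \<kappa> (\<lambda>A. f (adj2 A *v v))" "integrable \<kappa> (\<lambda>A. (f (adj2 A *v v))\<^sup>2)"
  by (rule K.integrable_const_bound[of _ 1]; use unit_L2_range in \<open>auto intro!: power_le_one\<close>)+

lemma avg_range: "0 \<le> avg \<kappa> f v" "avg \<kappa> f v \<le> 1"
proof -
  show "0 \<le> avg \<kappa> f v" unfolding avg_def by (rule Bochner_Integration.integral_nonneg) (rule unit_L2_range)
  have "avg \<kappa> f v \<le> (\<integral>A. 1 \<partial>\<kappa>)" unfolding avg_def
    by (rule integral_mono[OF slice_integrable(1)]) (auto simp: unit_L2_range)
  then show "avg \<kappa> f v \<le> 1" using K.prob_space by simp
qed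

lemma variance_eq: "(\<integral>A. (f (adj2 A *v v) - avg \<kappa> f v)\<^sup>2 \<partial>\<kappa>) = (\<integral>A. (f (adj2 A *v v))\<^sup>2 \<partial>\<kappa>) - (avg \<kappa> f v)\<^sup>2"
  using K.variance_eq[OF slice_integrable, of v] by (simp add: avg_def)

lemma avg_sq_le: "(avg \<kappa> f v)\<^sup>2 \<le> (\<integral>A. (f (adj2 A *v v))\<^sup>2 \<partial>\<kappa>)"
proof -
  have "0 \<le> (\<integral>A. (f (adj2 A *v v) - avg \<kappa> f v)\<^sup>2 \<partial>\<kappa>)" by simp
  then show ?thesis unfolding variance_eq by simp
qed

lemma translate_energy:
  assumes "A \<in> SL2"
  shows "integrable lborel (\<lambda>v. (f (adj2 A *v v))\<^sup>2)" "(\<integral>v. (f (adj2 A *v v))\<^sup>2 \<partial>lborel) = energy f"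
  using integral_lborel_SL2[OF adj2_SL2[OF assms], of "\<lambda>v. (f v)\<^sup>2"] unit_L2_integrable by auto

lemma pullback_integrable: "integrable (\<kappa> \<Otimes>\<^sub>M lborel) (\<lambda>x. (f (adj2 (fst x) *v snd x))\<^sup>2)"
proof (rule KL.Fubini_integrable)
  show "(\<lambda>x. (f (adj2 (fst x) *v snd x))\<^sup>2) \<in> borel_measurable (\<kappa> \<Otimes>\<^sub>M lborel)"
    using pullback_measurable by measurable
  have "integrable \<kappa> (\<lambda>A. \<integral>v. norm ((f (adj2 A *v v))\<^sup>2) \<partial>lborel) \<longleftrightarrow> integrable \<kappa> (\<lambda>A. \<integral>v. (f v)\<^sup>2 \<partial>lborel)"
    by (rule Bochner_Integration.integrable_cong) (auto simp: prob_measures_SL2D(3)[OF \<kappa>] translate_energy)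
  then show "integrable \<kappa> (\<lambda>A. \<integral>v. norm ((f (adj2 (fst (A, v)) *v snd (A, v)))\<^sup>2) \<partial>lborel)" by simp
  show "AE A in \<kappa>. integrable lborel (\<lambda>v. (f (adj2 (fst (A, v)) *v snd (A, v)))\<^sup>2)"
    by (rule AE_I2) (auto simp: prob_measures_SL2D(3)[OF \<kappa>] translate_energy)
qed

lemma mean_square_integrable: "integrable lborel (\<lambda>v. \<integral>A. (f (adj2 A *v v))\<^sup>2 \<partial>\<kappa>)"
  using KL.integrable_snd[of "\<lambda>A v. (f (adj2 A *v v))\<^sup>2"] pullback_integrable by (simp add: split_beta')

lemma mean_square_integral: "(\<integral>v. \<integral>A. (f (adj2 A *v v))\<^sup>2 \<partial>\<kappa> \<partial>lborel) = energy f"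
proof -
  have "(\<integral>v. \<integral>A. (f (adj2 A *v v))\<^sup>2 \<partial>\<kappa> \<partial>lborel) = (\<integral>A. \<integral>v. (f (adj2 A *v v))\<^sup>2 \<partial>lborel \<partial>\<kappa>)"
    using KL.Fubini_integral[of "\<lambda>A v. (f (adj2 A *v v))\<^sup>2"] pullback_integrable by (simp add: split_beta')
  also have "\<dots> = (\<integral>A. \<integral>v. (f v)\<^sup>2 \<partial>lborel \<partial>\<kappa>)"
    by (rule Bochner_Integration.integral_cong) (auto simp: prob_measures_SL2D(3)[OF \<kappa>] translate_energy)
  also have "\<dots> = energy f" using K.prob_space by simp
  finally show ?thesis .
qed

lemma avg_integrable: "integrable lborel (\<lambda>v. (avg \<kappa> f v)\<^sup>2)"
  by (rule Bochner_Integration.integrable_bound[OF mean_square_integrable]) (use avg_sq_le in \<open>auto intro: order_trans[OF _ abs_ge_self]\<close>)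

lemma unit_L2_avg: "unit_L2 (avg \<kappa> f)"
  using avg_integrable avg_range by (simp add: unit_L2_def)

lemma avg_le: "energy (avg \<kappa> f) \<le> energy f"
  using integral_mono[OF avg_integrable mean_square_integrable avg_sq_le] mean_square_integral by simp

text \<open>The energy lost by averaging is a variance: at each point of the plane, the spread of the random
  value \<open>f (A\<inverse> v)\<close> around its mean.\<close>
lemma energy_defect:
  shows "integrable \<kappa> (\<lambda>A. \<integral>v. (f (adj2 A *v v) - avg \<kappa> f v)\<^sup>2 \<partial>lborel)"
    "(\<integral>A. \<integral>v. (f (adj2 A *v v) - avg \<kappa> f v)\<^sup>2 \<partial>lborel \<partial>\<kappa>)
       = energy f - energy (avg \<kappa> f)"
proof -
  have m2: "integrable (\<kappa> \<Otimes>\<^sub>M lborel) (\<lambda>x. (avg \<kappa> f (snd x))\<^sup>2)"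
    by (rule KL.Fubini_integrable) (auto intro!: avg_integrable)
  have "integrable (\<kappa> \<Otimes>\<^sub>M lborel) (\<lambda>x. 2 * (f (adj2 (fst x) *v snd x))\<^sup>2 + 2 * (avg \<kappa> f (snd x))\<^sup>2)"
    using pullback_integrable m2 by simp
  then have d: "integrable (\<kappa> \<Otimes>\<^sub>M lborel) (\<lambda>x. (f (adj2 (fst x) *v snd x) - avg \<kappa> f (snd x))\<^sup>2)"
  proof (rule Bochner_Integration.integrable_bound)
    show "(\<lambda>x. (f (adj2 (fst x) *v snd x) - avg \<kappa> f (snd x))\<^sup>2) \<in> borel_measurable (\<kappa> \<Otimes>\<^sub>M lborel)"
      using pullback_measurable by measurable
    show "AE x in \<kappa> \<Otimes>\<^sub>M lborel. norm ((f (adj2 (fst x) *v snd x) - avg \<kappa> f (snd x))\<^sup>2)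
      \<le> norm (2 * (f (adj2 (fst x) *v snd x))\<^sup>2 + 2 * (avg \<kappa> f (snd x))\<^sup>2)"
      using square_diff_le by auto
  qed
  show "integrable \<kappa> (\<lambda>A. \<integral>v. (f (adj2 A *v v) - avg \<kappa> f v)\<^sup>2 \<partial>lborel)"
    using KL.integrable_fst[of "\<lambda>A v. (f (adj2 A *v v) - avg \<kappa> f v)\<^sup>2"] d by (simp add: split_beta')
  have "(\<integral>A. \<integral>v. (f (adj2 A *v v) - avg \<kappa> f v)\<^sup>2 \<partial>lborel \<partial>\<kappa>)
      = (\<integral>v. \<integral>A. (f (adj2 A *v v) - avg \<kappa> f v)\<^sup>2 \<partial>\<kappa> \<partial>lborel)"
    using KL.Fubini_integral[of "\<lambda>A v. (f (adj2 A *v v) - avg \<kappa> f v)\<^sup>2"] d by (simp add: split_beta')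
  also have "\<dots> = energy f - energy (avg \<kappa> f)"
    unfolding variance_eq by (subst Bochner_Integration.integral_diff[OF mean_square_integrable avg_integrable]) (simp add: mean_square_integral)
  finally show "(\<integral>A. \<integral>v. (f (adj2 A *v v) - avg \<kappa> f v)\<^sup>2 \<partial>lborel \<partial>\<kappa>)
       = energy f - energy (avg \<kappa> f)" .
qed

end

text \<open>The law of the line through a random point of the plane with density proportional to \<open>f\<^sup>2\<close>.\<close>
definition angle_law :: "(real^2 \<Rightarrow> real) \<Rightarrow> real measure" where
  "angle_law f = distr (density lborel (\<lambda>v. ennreal ((f v)\<^sup>2 / energy f))) borel angle"

context
  fixes f
  assumes f: "unit_L2 f" and pos: "0 < energy f"
begin

lemma unit_L2_measurable' [measurable]: "f \<in> borel_measurable borel" using f by (simp add: unit_L2_def)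

lemma prob_density: "prob_space (density lborel (\<lambda>v. ennreal ((f v)\<^sup>2 / energy f)))"
proof (rule prob_spaceI)
  have i: "integrable lborel (\<lambda>v. (f v)\<^sup>2 / energy f)"
    using f by (simp add: unit_L2_def)
  have "emeasure (density lborel (\<lambda>v. ennreal ((f v)\<^sup>2 / energy f))) UNIV
    = (\<integral>\<^sup>+v. ennreal ((f v)\<^sup>2 / energy f) \<partial>lborel)"
    by (subst emeasure_density) auto
  also have "\<dots> = ennreal (\<integral>v. (f v)\<^sup>2 / energy f \<partial>lborel)"
    by (rule nn_integral_eq_integral[OF i]) (use pos in auto)
  also have "\<dots> = 1" using pos by simp
  finally show "emeasure (density lborel (\<lambda>v. ennreal ((f v)\<^sup>2 / energy f)))
     (space (density lborel (\<lambda>v. ennreal ((f v)\<^sup>2 / energy f)))) = 1" by simp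
qed

lemma real_distribution_angle_law: "real_distribution (angle_law f)"
proof -
  have "prob_space (angle_law f)" unfolding angle_law_def
    by (rule prob_space.prob_space_distr[OF prob_density]) simp
  then show ?thesis unfolding real_distribution_def real_distribution_axioms_def by (simp add: angle_law_def)
qed

lemma measure_angle_law: "measure (angle_law f) {-2<..2} = 1"
proof -
  interpret real_distribution "angle_law f" by (rule real_distribution_angle_law)
  have *: "angle v \<in> {-2<..2}" for v
    using arctan_bounded[of "v$2 / v$1"] pi_less_4 pi_gt_zero by (auto simp: angle_def)
  have "AE t in angle_law f. t \<in> {-2<..2}"
    unfolding angle_law_def by (subst AE_distr_iff) (use * in auto)
  then show ?thesis by (subst prob_eq_1) auto
qed

lemma image_integral_angle_law:
  assumes \<phi>: "even_lipschitz L \<phi>" and A: "A \<in> SL2"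
  shows "image_integral (angle_law f) \<phi> A = (\<integral>v. \<phi> (sgn v) * (f (adj2 A *v v))\<^sup>2 \<partial>lborel) / energy f"
proof -
  define s where "s = energy f"
  have s: "s > 0" using pos by (simp add: s_def)
  note [measurable] = measurable_even_lipschitz[OF \<phi>]
  have "image_integral (angle_law f) \<phi> A = (\<integral>v. (f v)\<^sup>2 / s * \<phi> (sgn (A *v dir (angle v))) \<partial>lborel)"
    unfolding image_integral_def angle_law_def s_def[symmetric]
    by (subst integral_distr) (use s in \<open>auto simp: integral_density\<close>)
  also have "\<dots> = (\<integral>v. (f v)\<^sup>2 / s * \<phi> (sgn (A *v v)) \<partial>lborel)"
  proof (rule integral_cong_AE)
    have "AE v in lborel. v \<noteq> (0 :: real^2)" by (rule AE_lborel_singleton)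
    then show "AE v in lborel. (f v)\<^sup>2 / s * \<phi> (sgn (A *v dir (angle v))) = (f v)\<^sup>2 / s * \<phi> (sgn (A *v v))"
    proof eventually_elim
      case (elim v)
      then obtain c where c: "c \<noteq> 0" "v = c *\<^sub>R dir (angle v)" using dir_angle by blast
      have "A *v v = c *\<^sub>R (A *v dir (angle v))"
        by (subst c(2)) (simp add: matrix_vector_mult_scaleR)
      then show ?case using even_sgn_scaleR[OF \<phi> c(1)] by simp
    qed
  qed measurable
  also have "\<dots> = (\<integral>v. (\<lambda>w. (f (adj2 A *v w))\<^sup>2 / s * \<phi> (sgn w)) (A *v v) \<partial>lborel)"
    by (simp add: adj2_mult_vec[OF A])
  also have "\<dots> = (\<integral>w. (f (adj2 A *v w))\<^sup>2 / s * \<phi> (sgn w) \<partial>lborel)"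
    by (rule integral_lborel_SL2[OF A]) measurable
  also have "\<dots> = (\<integral>w. \<phi> (sgn w) * (f (adj2 A *v w))\<^sup>2 / s \<partial>lborel)"
    by (rule Bochner_Integration.integral_cong) auto
  finally show ?thesis by (simp add: s_def)
qed

text \<open>When averaging loses little energy, the lines distributed according to \<open>f\<^sup>2\<close> have almost the
  same image law under almost all matrices. The comparison constant is the integral of the test
  function against the squared average.\<close>
lemma variance_image_integral_le:
  assumes \<phi>: "even_lipschitz L \<phi>" and \<kappa>: "\<kappa> \<in> prob_measures_SL2"
  defines "c \<equiv> (\<integral>v. \<phi> (sgn v) * (avg \<kappa> f v)\<^sup>2 \<partial>lborel) / energy f"
  shows "0 \<le> c" "c \<le> 1"
    "(\<integral>A. (image_integral (angle_law f) \<phi> A - c)\<^sup>2 \<partial>\<kappa>) \<le> 4 * (1 - energy (avg \<kappa> f) / energy f)"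
proof -
  define s where "s = energy f"
  have s: "s > 0" using pos by (simp add: s_def)
  note [measurable] = measurable_even_lipschitz[OF \<phi>] avg_measurable[OF \<kappa> f]
  have \<phi>r: "0 \<le> \<phi> x" "\<phi> x \<le> 1" for x using \<phi> by (auto simp: even_lipschitz_def)
  show "0 \<le> c" unfolding c_def s_def[symmetric]
    using s by (intro divide_nonneg_pos Bochner_Integration.integral_nonneg mult_nonneg_nonneg) (auto simp: \<phi>r)
  have "(\<integral>v. \<phi> (sgn v) * (avg \<kappa> f v)\<^sup>2 \<partial>lborel) \<le> energy (avg \<kappa> f)"
    by (rule integral_mono[OF _ avg_integrable[OF \<kappa> f]], rule Bochner_Integration.integrable_bound[OF avg_integrable[OF \<kappa> f]])
       (auto simp: \<phi>r abs_mult intro!: mult_left_le_one_le)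
  also have "\<dots> \<le> s" unfolding s_def by (rule avg_le[OF \<kappa> f])
  finally show "c \<le> 1" unfolding c_def s_def[symmetric] using s by simp
  have *: "(image_integral (angle_law f) \<phi> A - c)\<^sup>2 \<le> 4 / s * (\<integral>v. (f (adj2 A *v v) - avg \<kappa> f v)\<^sup>2 \<partial>lborel)"
    if A: "A \<in> SL2" for A
  proof -
    define D where "D = (\<integral>v. (f (adj2 A *v v) - avg \<kappa> f v)\<^sup>2 \<partial>lborel)"
    have D: "0 \<le> D" by (simp add: D_def)
    have "((\<integral>v. \<phi> (sgn v) * (f (adj2 A *v v))\<^sup>2 \<partial>lborel) - (\<integral>v. \<phi> (sgn v) * (avg \<kappa> f v)\<^sup>2 \<partial>lborel))\<^sup>2
      \<le> D * (2 * (\<integral>v. (f (adj2 A *v v))\<^sup>2 \<partial>lborel) + 2 * energy (avg \<kappa> f))"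
      unfolding D_def
      by (rule square_diff_Cauchy_Schwarz) (auto simp: \<phi>r intro!: translate_energy[OF \<kappa> f A] avg_integrable[OF \<kappa> f])
    also have "\<dots> \<le> D * (4 * s)"
      using avg_le[OF \<kappa> f] by (intro mult_left_mono D) (simp add: translate_energy[OF \<kappa> f A] s_def)
    finally have "((\<integral>v. \<phi> (sgn v) * (f (adj2 A *v v))\<^sup>2 \<partial>lborel) - (\<integral>v. \<phi> (sgn v) * (avg \<kappa> f v)\<^sup>2 \<partial>lborel))\<^sup>2 / s\<^sup>2
       \<le> D * (4 * s) / s\<^sup>2" by (rule divide_right_mono) simp
    moreover have "D * (4 * s) / s\<^sup>2 = 4 / s * D" using s by (simp add: power2_eq_square)
    ultimately show ?thesis
      by (simp add: image_integral_angle_law[OF \<phi> A] c_def s_def[symmetric] D_def diff_divide_distrib[symmetric] power_divide)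
  qed
  interpret K: prob_space \<kappa> by (rule prob_measures_SL2D[OF \<kappa>])
  have meas: "image_integral (angle_law f) \<phi> \<in> borel_measurable \<kappa>"
    by (rule continuous_on_SL2_measurable[OF continuous_on_image_integral[OF real_distribution_angle_law \<phi>] \<kappa>])
  have id: "integrable \<kappa> (\<lambda>A. 4 / s * (\<integral>v. (f (adj2 A *v v) - avg \<kappa> f v)\<^sup>2 \<partial>lborel))"
    using energy_defect(1)[OF \<kappa> f] by simp
  have "(\<integral>A. (image_integral (angle_law f) \<phi> A - c)\<^sup>2 \<partial>\<kappa>) \<le> (\<integral>A. 4 / s * (\<integral>v. (f (adj2 A *v v) - avg \<kappa> f v)\<^sup>2 \<partial>lborel) \<partial>\<kappa>)"
  proof (rule integral_mono[OF _ id])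
    show "integrable \<kappa> (\<lambda>A. (image_integral (angle_law f) \<phi> A - c)\<^sup>2)"
      by (rule Bochner_Integration.integrable_bound[OF id])
         (use meas s * in \<open>auto simp: prob_measures_SL2D(3)[OF \<kappa>] intro!: AE_I2 order_trans[OF _ abs_ge_self]\<close>)
  qed (use * in \<open>auto simp: prob_measures_SL2D(3)[OF \<kappa>]\<close>)
  also have "\<dots> = 4 / s * (s - energy (avg \<kappa> f))"
    using energy_defect(2)[OF \<kappa> f] by (simp add: s_def)
  also have "\<dots> = 4 * (1 - energy (avg \<kappa> f) / s)"
    using s by (simp add: field_simps)
  finally show "(\<integral>A. (image_integral (angle_law f) \<phi> A - c)\<^sup>2 \<partial>\<kappa>) \<le> 4 * (1 - energy (avg \<kappa> f) / energy f)"
    by (simp add: s_def)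
qed

end

section \<open>The spectral gap\<close>

text \<open>Otherwise there are functions whose energy is almost preserved. Their angle laws converge along
  a subsequence and the matrix laws cluster at some \<open>k\<close> in the compact family. In the limit
  the image of one measure \<open>\<nu>\<^sub>1\<close> on the projective line under \<open>A\<close> is the same measure \<open>\<nu>\<^sub>2\<close> for
  \<open>k\<close>-almost every \<open>A\<close>, which is exactly what the hypothesis on the family forbids.\<close>
theorem spectral_gap:
  assumes compact: "compactin weak_topology_SL2 K"
    and tight: "\<And>e. 0 < e \<Longrightarrow> \<exists>M. \<forall>\<kappa>\<in>K. measure \<kappa> {A \<in> SL2. M < norm A} \<le> e"
    and measures: "\<forall>\<kappa>\<in>K. \<not> (\<exists>\<nu>\<^sub>1\<in>prob_measures_RP1. \<exists>\<nu>\<^sub>2\<in>prob_measures_RP1.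
           AE A in \<kappa>. distr \<nu>\<^sub>1 RP1_borel (proj_map A) = \<nu>\<^sub>2)"
  shows "\<exists>\<rho>. 0 < \<rho> \<and> \<rho> < 1 \<and> (\<forall>\<kappa>\<in>K. \<forall>f. unit_L2 f \<longrightarrow>
    energy (avg \<kappa> f) \<le> \<rho> * energy f)"
proof (rule ccontr)
  assume neg: "\<not> ?thesis"
  define \<rho> where "\<rho> j = 1 - 1 / (real j + 2)" for j :: nat
  have \<rho>: "0 < \<rho> j" "\<rho> j < 1" for j by (auto simp: \<rho>_def field_simps)
  have "\<exists>\<kappa> f. \<kappa> \<in> K \<and> unit_L2 f \<and> \<rho> j * energy f < energy (avg \<kappa> f)" for j
  proof (rule ccontr)
    assume "\<nexists>\<kappa> f. \<kappa> \<in> K \<and> unit_L2 f \<and> \<rho> j * energy f < energy (avg \<kappa> f)"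
    then have "0 < \<rho> j \<and> \<rho> j < 1 \<and> (\<forall>\<kappa>\<in>K. \<forall>f. unit_L2 f \<longrightarrow>
      energy (avg \<kappa> f) \<le> \<rho> j * energy f)"
      using \<rho>[of j] by (auto simp: not_less)
    with neg show False by blast
  qed
  then obtain \<kappa> f where \<kappa>: "\<And>j. \<kappa> j \<in> K" and f: "\<And>j. unit_L2 (f j)"
    and gt: "\<And>j. \<rho> j * energy (f j) < energy (avg (\<kappa> j) (f j))"
    by metis
  have KS: "K \<subseteq> prob_measures_SL2"
    using compactin_subset_topspace[OF compact] by (simp add: topspace_weak_topology_SL2)
  have \<kappa>S: "\<kappa> j \<in> prob_measures_SL2" for j using \<kappa> KS by blast
  define s where "s j = energy (f j)" for j
  define m where "m j = energy (avg (\<kappa> j) (f j))" for j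
  have s: "0 < s j" for j
  proof (rule ccontr)
    assume "\<not> 0 < s j"
    moreover have "0 \<le> s j" by (simp add: s_def)
    ultimately have "s j = 0" by simp
    with gt[of j] avg_le[OF \<kappa>S f, of j j] show False by (simp add: s_def)
  qed
  have s': "0 < energy (f j)" for j using s by (simp add: s_def)
  note rd = real_distribution_angle_law[OF f s']
  have "tight (\<lambda>j. angle_law (f j))"
    unfolding tight_def
  proof (intro conjI allI impI rd)
    fix \<epsilon> :: real assume "0 < \<epsilon>"
    then show "\<exists>a b. a < b \<and> (\<forall>n. 1 - \<epsilon> < measure (angle_law (f n)) {a<..b})"
      by (intro exI[of _ "-2"] exI[of _ 2]) (simp add: measure_angle_law[OF f s'])
  qed
  from tight_imp_convergent_subsubsequence[OF this strict_mono_id]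
  obtain r N where r: "strict_mono r" and N: "real_distribution N"
    and w: "weak_conv_m (\<lambda>j. angle_law (f (r j))) N"
    by (auto simp: o_def)
  obtain k where k: "k \<in> K"
    and cluster: "\<And>U. openin weak_topology_SL2 U \<Longrightarrow> k \<in> U \<Longrightarrow> frequently (\<lambda>j. \<kappa> (r j) \<in> U) sequentially"
    using compactin_cluster[OF compact, of "\<lambda>j. \<kappa> (r j)"] \<kappa> by blast
  have kS: "k \<in> prob_measures_SL2" using k KS by blast
  interpret k: prob_space k by (rule prob_measures_SL2D[OF kS])
  interpret N: real_distribution N by (fact N)
  have const: "AE A in k. image_integral N \<phi> A = (\<integral>A. image_integral N \<phi> A \<partial>k)" if \<phi>: "even_lipschitz L \<phi>" for L \<phi>
  proof (rule variance_limit[OF \<phi> rd N w \<kappa>S kS cluster])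
    define c where "c j = (\<integral>v. \<phi> (sgn v) * (avg (\<kappa> j) (f j) v)\<^sup>2 \<partial>lborel) / energy (f j)" for j
    have c: "0 \<le> c j" "c j \<le> 1"
      "(\<integral>A. (image_integral (angle_law (f j)) \<phi> A - c j)\<^sup>2 \<partial>\<kappa> j) \<le> 4 * (1 - m j / s j)" for j
      using variance_image_integral_le[OF f s' \<phi> \<kappa>S, of j j] by (auto simp: c_def m_def s_def)
    show "0 \<le> c (r j)" "c (r j) \<le> 1" for j by (rule c)+
    have le: "4 * (1 - m j / s j) \<le> 4 / (real j + 2)" for j
    proof -
      have "\<rho> j \<le> m j / s j" using gt[of j] s[of j] by (simp add: m_def s_def field_simps)
      then show ?thesis by (simp add: \<rho>_def)
    qed
    have "(\<lambda>j. \<integral>A. (image_integral (angle_law (f j)) \<phi> A - c j)\<^sup>2 \<partial>\<kappa> j) \<longlonglongrightarrow> 0"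
    proof (rule tendsto_sandwich[of "\<lambda>_. 0" _ _ "\<lambda>j. 4 / (real j + 2)"])
      show "(\<lambda>j. 4 / (real j + 2)) \<longlonglongrightarrow> 0"
        by real_asymp
      show "eventually (\<lambda>j. (\<integral>A. (image_integral (angle_law (f j)) \<phi> A - c j)\<^sup>2 \<partial>\<kappa> j) \<le> 4 / (real j + 2)) sequentially"
        using order_trans[OF c(3) le] by simp
    qed auto
    from LIMSEQ_subseq_LIMSEQ[OF this r]
    show "(\<lambda>j. \<integral>A. (image_integral (angle_law (f (r j))) \<phi> A - c (r j))\<^sup>2 \<partial>\<kappa> (r j)) \<longlonglongrightarrow> 0"
      by (simp add: o_def)
    show "\<exists>M. \<forall>j. measure (\<kappa> (r j)) {A \<in> SL2. M < norm A} \<le> e" if "0 < e" for e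
      using tight[OF that] \<kappa> by blast
  qed
  \<comment> \<open>countably many test functions, so that one null set serves all of them\<close>
  obtain \<B> :: "(real^2) set set" where \<B>: "countable \<B>" "topological_basis \<B>"
    using ex_countable_basis by blast
  have cF: "countable {W. finite W \<and> W \<subseteq> \<B>}" by (rule countable_Collect_finite_subset[OF \<B>(1)])
  have "AE A in k. \<forall>W\<in>{W. finite W \<and> W \<subseteq> \<B>}. \<forall>n. image_integral N (bump W n) A = (\<integral>A. image_integral N (bump W n) A \<partial>k)"
    by (subst AE_ball_countable[OF cF], intro ballI, subst AE_all_countable, intro allI const[OF even_lipschitz_bump])
  then have ae: "AE A in k. A \<in> SL2 \<and> (\<forall>W\<in>{W. finite W \<and> W \<subseteq> \<B>}. \<forall>n. image_integral N (bump W n) A = (\<integral>A. image_integral N (bump W n) A \<partial>k))"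
    using AE_space[of k] by eventually_elim (simp add: prob_measures_SL2D(3)[OF kS])
  obtain B where B: "B \<in> SL2" "\<forall>W\<in>{W. finite W \<and> W \<subseteq> \<B>}. \<forall>n. image_integral N (bump W n) B = (\<integral>A. image_integral N (bump W n) A \<partial>k)"
    using ae k.AE_contr[OF ae] by fastforce
  define \<nu> where "\<nu> C = distr N RP1_borel (\<lambda>t. span {C *v dir t})" for C
  note sm = measurable_span_action[OF N.real_distribution_axioms]
  have \<nu>P: "\<nu> C \<in> prob_measures_RP1" if "C \<in> SL2" for C
    using N.prob_space_distr[OF sm[OF that]] by (simp add: prob_measures_RP1_def \<nu>_def)
  have "AE A in k. distr (\<nu> (mat 1)) RP1_borel (proj_map A) = \<nu> B"
    using ae
  proof eventually_elim
    case (elim A)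
    have "distr (\<nu> (mat 1)) RP1_borel (proj_map A) = distr N RP1_borel (proj_map A \<circ> (\<lambda>t. span {mat 1 *v dir t}))"
      unfolding \<nu>_def by (rule distr_distr[OF measurable_proj_map sm[OF mat_1_SL2]]) (use elim in simp)
    also have "proj_map A \<circ> (\<lambda>t. span {mat 1 *v dir t}) = (\<lambda>t. span {A *v dir t})"
      using linear_span_image[of "\<lambda>v. A *v v" "{dir t}" for t] by (auto simp: fun_eq_iff proj_map_def)
    also have "distr N RP1_borel (\<lambda>t. span {A *v dir t}) = \<nu> B"
      unfolding \<nu>_def
      by (rule distr_RP1_eq[OF N _ B(1) \<B>]) (use elim B(2) in auto)
    finally show ?case .
  qed
  with measures k \<nu>P[OF mat_1_SL2] \<nu>P[OF B(1)] show False by blast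
qed

section \<open>Products of independent matrices\<close>

(* keeps the index sets {1..} and {1..n} in the form in which products are taken *)
declare One_nat_def [simp del]

lemma matrix_prod_cong: "(\<And>i. 1 \<le> i \<Longrightarrow> i \<le> n \<Longrightarrow> A i = B i) \<Longrightarrow> matrix_prod A n = matrix_prod B n"
  by (induction n) auto

lemma matrix_prod_SL2: "(\<And>i. 1 \<le> i \<Longrightarrow> i \<le> n \<Longrightarrow> A i \<in> SL2) \<Longrightarrow> matrix_prod A n \<in> SL2"
  by (induction n) (auto intro: matrix_mult_SL2 mat_1_SL2)

text \<open>The product of the \<open>k\<close> factors that follow the first \<open>n\<close>. The factors are not identically
  distributed, so estimates have to be uniform in the starting time \<open>n\<close>.\<close>
definition walk :: "nat \<Rightarrow> nat \<Rightarrow> (nat \<Rightarrow> real^2^2) \<Rightarrow> real^2^2" where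
  "walk n k \<omega> = matrix_prod (\<lambda>i. \<omega> (n + i)) k"

abbreviation log_norm :: "nat \<Rightarrow> nat \<Rightarrow> (nat \<Rightarrow> real^2^2) \<Rightarrow> real" where
  "log_norm n k \<omega> \<equiv> ln (norm (walk n k \<omega>))"

abbreviation log_stretch :: "nat \<Rightarrow> nat \<Rightarrow> real^2 \<Rightarrow> (nat \<Rightarrow> real^2^2) \<Rightarrow> real" where
  "log_stretch n k u \<omega> \<equiv> ln (norm (walk n k \<omega> *v u))"

lemma walk_0 [simp]: "walk n 0 \<omega> = mat 1" by (simp add: walk_def)

lemma walk_Suc: "walk n (Suc k) \<omega> = \<omega> (Suc (n + k)) ** walk n k \<omega>" by (simp add: walk_def)

lemma walk_add: "walk n (j + k) \<omega> = walk (n + j) k \<omega> ** walk n j \<omega>"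
  by (induction k) (auto simp: walk_Suc matrix_mul_assoc add.assoc)

text \<open>The past of one sample continued by the future of another. Independence of past and future
  is used in the form that splicing two independent samples gives a sample of the same law.\<close>
definition splice :: "nat \<Rightarrow> (nat \<Rightarrow> 'a) \<Rightarrow> (nat \<Rightarrow> 'a) \<Rightarrow> nat \<Rightarrow> 'a" where
  "splice n \<omega> \<omega>' i = (if i \<le> n then \<omega> i else \<omega>' i)"

lemma walk_splice_past: "m + k \<le> n \<Longrightarrow> walk m k (splice n \<omega> \<omega>') = walk m k \<omega>"
  unfolding walk_def by (rule matrix_prod_cong) (simp add: splice_def)

lemma walk_splice_future: "n \<le> m \<Longrightarrow> walk m k (splice n \<omega> \<omega>') = walk m k \<omega>'"
  unfolding walk_def by (rule matrix_prod_cong) (simp add: splice_def)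

text \<open>What remains of the family of laws once a sequence has been chosen: a contraction factor for
  the averaging operators and a bound for the second logarithmic moments, common to all factors.\<close>
locale sl2_walk =
  fixes \<mu> :: "nat \<Rightarrow> (real^2^2) measure" and \<rho> C :: real
  assumes \<mu>: "\<And>i. \<mu> i \<in> prob_measures_SL2"
    and \<rho>: "0 < \<rho>" "\<rho> < 1"
    and gap: "\<And>i f. unit_L2 f \<Longrightarrow> energy (avg (\<mu> i) f) \<le> \<rho> * energy f"
    and C: "\<And>i. integrable (\<mu> i) (\<lambda>A. (ln (norm A))\<^sup>2)" "\<And>i. (\<integral>A. (ln (norm A))\<^sup>2 \<partial>\<mu> i) \<le> C"
begin

sublocale product_prob_space \<mu> "{1..} :: nat set"
  by (simp add: product_prob_space_def product_prob_space_axioms_def product_sigma_finite_def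
      prob_measures_SL2D(1)[OF \<mu>] prob_space_imp_sigma_finite)

abbreviation "\<Omega> \<equiv> \<Pi>\<^sub>M i\<in>{1..}. \<mu> i"

sublocale PP: pair_prob_space \<Omega> \<Omega> ..

lemma component_SL2: "\<omega> \<in> space \<Omega> \<Longrightarrow> 1 \<le> i \<Longrightarrow> \<omega> i \<in> SL2"
  using prob_measures_SL2D(3)[OF \<mu>, of i] by (auto simp: space_PiM PiE_iff)

lemma component_meas [measurable]: "1 \<le> i \<Longrightarrow> (\<lambda>\<omega>. \<omega> i) \<in> measurable \<Omega> borel"
  by (rule measurable_compose[OF measurable_component_singleton[of i "{1..}" \<mu>] prob_measures_SL2D(4)[OF \<mu>[of i]]]) simp

lemma walk_SL2: "\<omega> \<in> space \<Omega> \<Longrightarrow> walk n k \<omega> \<in> SL2"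
  unfolding walk_def by (rule matrix_prod_SL2) (simp add: component_SL2)

lemma walk_meas [measurable]: "walk n k \<in> measurable \<Omega> borel"
  by (induction k) (simp_all add: walk_Suc[abs_def] walk_0[abs_def])

lemma splice_meas: "(\<lambda>(\<omega>, \<omega>'). splice n \<omega> \<omega>') \<in> measurable (\<Omega> \<Otimes>\<^sub>M \<Omega>) \<Omega>"
proof (rule measurable_PiM_single')
  fix i :: nat assume i: "i \<in> {1..}"
  have "(\<lambda>x. if i \<le> n then fst x i else snd x i) \<in> measurable (\<Omega> \<Otimes>\<^sub>M \<Omega>) (\<mu> i)"
    by (cases "i \<le> n") (auto intro: measurable_compose[OF measurable_fst measurable_component_singleton[OF i]]
      measurable_compose[OF measurable_snd measurable_component_singleton[OF i]])
  then show "(\<lambda>x. (case x of (\<omega>, \<omega>') \<Rightarrow> splice n \<omega> \<omega>') i) \<in> measurable (\<Omega> \<Otimes>\<^sub>M \<Omega>) (\<mu> i)"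
    by (simp add: splice_def split_beta')
qed (auto simp: splice_def space_pair_measure space_PiM PiE_iff extensional_def)

lemma splice_distr: "distr (\<Omega> \<Otimes>\<^sub>M \<Omega>) \<Omega> (\<lambda>(\<omega>, \<omega>'). splice n \<omega> \<omega>') = \<Omega>" (is "?D = _")
proof (rule PiM_eq)
  let "distr _ _ ?f" = "?D"
  fix J E assume J: "finite J" "J \<subseteq> {1::nat..}" "\<And>j. j \<in> J \<Longrightarrow> E j \<in> sets (\<mu> j)"
  let ?X = "prod_emb {1..} \<mu> J (\<Pi>\<^sub>E j\<in>J. E j)"
  let ?E = "prod_emb {1..} \<mu> (J \<inter> {..n}) (\<Pi>\<^sub>E j\<in>J \<inter> {..n}. E j)"
  let ?F = "prod_emb {1..} \<mu> (J \<inter> {n<..}) (\<Pi>\<^sub>E j\<in>J \<inter> {n<..}. E j)"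
  have eq: "?f -` ?X \<inter> space (\<Omega> \<Otimes>\<^sub>M \<Omega>) = ?E \<times> ?F"
    by (auto simp: space_pair_measure space_PiM prod_emb_def PiE_iff splice_def extensional_def Ball_def
        linorder_not_le[symmetric] split: if_splits)
  have "emeasure ?D ?X = emeasure (\<Omega> \<Otimes>\<^sub>M \<Omega>) (?f -` ?X \<inter> space (\<Omega> \<Otimes>\<^sub>M \<Omega>))"
    using J by (intro emeasure_distr splice_meas sets_PiM_I) auto
  also have "\<dots> = emeasure \<Omega> ?E * emeasure \<Omega> ?F"
    unfolding eq using J by (intro P.emeasure_pair_measure_Times) (auto intro!: sets_PiM_I)
  also have "emeasure \<Omega> ?F = (\<Prod>j\<in>J \<inter> {n<..}. emeasure (\<mu> j) (E j))"
    using J by (intro emeasure_PiM_emb) auto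
  also have "emeasure \<Omega> ?E = (\<Prod>j\<in>J \<inter> {..n}. emeasure (\<mu> j) (E j))"
    using J by (intro emeasure_PiM_emb) auto
  also have "(\<Prod>j\<in>J \<inter> {..n}. emeasure (\<mu> j) (E j)) * (\<Prod>j\<in>J \<inter> {n<..}. emeasure (\<mu> j) (E j))
      = (\<Prod>j\<in>(J \<inter> {..n}) \<union> (J \<inter> {n<..}). emeasure (\<mu> j) (E j))"
    using J by (intro prod.union_disjoint[symmetric]) auto
  also have "(J \<inter> {..n}) \<union> (J \<inter> {n<..}) = J" by auto
  finally show "emeasure ?D ?X = (\<Prod>j\<in>J. emeasure (\<mu> j) (E j))" .
qed simp_all

lemma splice_integrable:
  fixes h :: "_ \<Rightarrow> real"
  assumes "integrable \<Omega> h"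
  shows "integrable (\<Omega> \<Otimes>\<^sub>M \<Omega>) (\<lambda>(\<omega>, \<omega>'). h (splice n \<omega> \<omega>'))"
proof -
  have "integrable (distr (\<Omega> \<Otimes>\<^sub>M \<Omega>) \<Omega> (\<lambda>(\<omega>, \<omega>'). splice n \<omega> \<omega>')) h"
    by (subst splice_distr) (rule assms)
  then show ?thesis
    by (subst (asm) integrable_distr_eq[OF splice_meas borel_measurable_integrable[OF assms]]) (simp add: split_beta')
qed

lemma splice_integral:
  fixes h :: "_ \<Rightarrow> real"
  assumes h: "integrable \<Omega> h"
  shows "(\<integral>\<omega>. h \<omega> \<partial>\<Omega>) = (\<integral>\<omega>. \<integral>\<omega>'. h (splice n \<omega> \<omega>') \<partial>\<Omega> \<partial>\<Omega>)"
    "(\<integral>\<omega>. h \<omega> \<partial>\<Omega>) = (\<integral>\<omega>'. \<integral>\<omega>. h (splice n \<omega> \<omega>') \<partial>\<Omega> \<partial>\<Omega>)"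
proof -
  have "(\<integral>\<omega>. h \<omega> \<partial>\<Omega>) = (\<integral>\<omega>. h \<omega> \<partial>(distr (\<Omega> \<Otimes>\<^sub>M \<Omega>) \<Omega> (\<lambda>(\<omega>, \<omega>'). splice n \<omega> \<omega>')))"
    by (subst splice_distr) rule
  also have "\<dots> = (\<integral>x. h (splice n (fst x) (snd x)) \<partial>(\<Omega> \<Otimes>\<^sub>M \<Omega>))"
    by (subst integral_distr[OF splice_meas borel_measurable_integrable[OF h]]) (simp add: split_beta')
  finally have *: "(\<integral>\<omega>. h \<omega> \<partial>\<Omega>) = (\<integral>x. h (splice n (fst x) (snd x)) \<partial>(\<Omega> \<Otimes>\<^sub>M \<Omega>))" .
  then show "(\<integral>\<omega>. h \<omega> \<partial>\<Omega>) = (\<integral>\<omega>. \<integral>\<omega>'. h (splice n \<omega> \<omega>') \<partial>\<Omega> \<partial>\<Omega>)"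
    using PP.integral_fst[OF splice_integrable[OF h, of n]] by (simp add: split_beta')
  then show "(\<integral>\<omega>. h \<omega> \<partial>\<Omega>) = (\<integral>\<omega>'. \<integral>\<omega>. h (splice n \<omega> \<omega>') \<partial>\<Omega> \<partial>\<Omega>)"
    using PP.Fubini_integral[OF splice_integrable[OF h, of n]] by simp
qed

lemma integral_component:
  fixes h :: "real^2^2 \<Rightarrow> real"
  assumes "1 \<le> i" "h \<in> borel_measurable (\<mu> i)"
  shows "(\<integral>\<omega>. h (\<omega> i) \<partial>\<Omega>) = (\<integral>A. h A \<partial>\<mu> i)" "integrable \<Omega> (\<lambda>\<omega>. h (\<omega> i)) \<longleftrightarrow> integrable (\<mu> i) h"
proof -
  have m: "(\<lambda>\<omega>. \<omega> i) \<in> measurable \<Omega> (\<mu> i)" using assms(1) by simp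
  show "(\<integral>\<omega>. h (\<omega> i) \<partial>\<Omega>) = (\<integral>A. h A \<partial>\<mu> i)"
    using integral_distr[OF m assms(2)] PiM_component[of i] assms(1) by simp
  show "integrable \<Omega> (\<lambda>\<omega>. h (\<omega> i)) \<longleftrightarrow> integrable (\<mu> i) h"
    using integrable_distr_eq[OF m assms(2)] PiM_component[of i] assms(1) by simp
qed

definition pull :: "(real^2 \<Rightarrow> real) \<Rightarrow> nat \<Rightarrow> nat \<Rightarrow> real^2 \<Rightarrow> real" where
  "pull g n k v = (\<integral>\<omega>. g (adj2 (walk n k \<omega>) *v v) \<partial>\<Omega>)"

text \<open>A new factor enters \<open>(A T)\<inverse> = T\<inverse> A\<inverse>\<close> on the inside, so that averaging over it applies one
  more averaging operator to the function already averaged over \<open>T\<close>.\<close>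
lemma pull_contract:
  assumes g: "unit_L2 g"
  shows "unit_L2 (pull g n k) \<and> energy (pull g n k) \<le> \<rho> ^ k * energy g"
proof (induction k)
  case 0
  have "pull g n 0 = g" using P.prob_space by (simp add: pull_def fun_eq_iff)
  then show ?case using g by simp
next
  case (Suc k)
  have [measurable]: "g \<in> borel_measurable borel" and gr: "\<And>v. 0 \<le> g v" "\<And>v. g v \<le> 1"
    using g unfolding unit_L2_def by blast+
  have pm [measurable]: "pull g n k \<in> borel_measurable borel"
    using Suc unfolding unit_L2_def by (elim conjE)
  have id [measurable]: "(\<lambda>A. A) \<in> measurable (\<mu> i) borel" for i by (rule prob_measures_SL2D[OF \<mu>])
  have "pull g n (Suc k) v = avg (\<mu> (Suc (n + k))) (pull g n k) v" for v
  proof -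
    have i: "integrable \<Omega> (\<lambda>\<omega>. g (adj2 (walk n (Suc k) \<omega>) *v v))"
      by (rule P.integrable_const_bound[of _ 1]) (auto simp: gr)
    have "pull g n (Suc k) v = (\<integral>\<omega>'. \<integral>\<omega>. g (adj2 (walk n (Suc k) (splice (n + k) \<omega> \<omega>')) *v v) \<partial>\<Omega> \<partial>\<Omega>)"
      unfolding pull_def by (rule splice_integral(2)[OF i])
    also have "\<dots> = (\<integral>\<omega>'. pull g n k (adj2 (\<omega>' (Suc (n + k))) *v v) \<partial>\<Omega>)"
      by (simp add: walk_Suc walk_splice_past splice_def adj2_mult matrix_vector_mul_assoc[symmetric] pull_def)
    also have "\<dots> = (\<integral>A. pull g n k (adj2 A *v v) \<partial>\<mu> (Suc (n + k)))"
      by (rule integral_component) auto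
    finally show ?thesis by (simp add: avg_def)
  qed
  then have eq: "pull g n (Suc k) = avg (\<mu> (Suc (n + k))) (pull g n k)" by (simp add: fun_eq_iff)
  have "energy (pull g n (Suc k)) \<le> \<rho> * energy (pull g n k)"
    unfolding eq using Suc by (intro gap) simp
  also have "\<dots> \<le> \<rho> * (\<rho> ^ k * energy g)"
    using Suc \<rho> by (intro mult_left_mono) auto
  finally show ?case using unit_L2_avg[OF \<mu>] Suc unfolding eq by (simp add: mult.assoc)
qed

text \<open>By Cauchy-Schwarz the decay of energies bounds the expected area of the part of \<open>S\<close> that
  the inverse product sends into \<open>T\<close>. Both consequences of the spectral gap are instances of this
  for suitable regions.\<close>
lemma expected_overlap:
  assumes S [measurable]: "S \<in> sets borel" "emeasure lborel S < \<infinity>"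
    and T [measurable]: "T \<in> sets borel" "emeasure lborel T < \<infinity>"
  shows "integrable \<Omega> (\<lambda>\<omega>. measure lborel {v \<in> S. adj2 (walk n k \<omega>) *v v \<in> T})"
    "(\<integral>\<omega>. measure lborel {v \<in> S. adj2 (walk n k \<omega>) *v v \<in> T} \<partial>\<Omega>)
      \<le> sqrt (\<rho> ^ k * measure lborel S * measure lborel T)"
proof -
  define g where "g = (indicator T :: real^2 \<Rightarrow> real)"
  define f where "f = (indicator S :: real^2 \<Rightarrow> real)"
  have [measurable]: "f \<in> borel_measurable borel" "g \<in> borel_measurable borel"
    unfolding f_def g_def by measurable
  have sq: "(f v)\<^sup>2 = f v" "(g v)\<^sup>2 = g v" for v by (auto simp: f_def g_def indicator_def)
  have fi: "integrable lborel f" "(\<integral>v. f v \<partial>lborel) = measure lborel S"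
    using S by (simp_all add: f_def)
  have gi: "integrable lborel g" "(\<integral>v. g v \<partial>lborel) = measure lborel T"
    using T by (simp_all add: g_def)
  have g: "unit_L2 g"
    unfolding unit_L2_def sq using gi(1) by (auto simp: g_def)
  interpret OL: pair_sigma_finite \<Omega> "lborel :: (real^2) measure" ..
  have [measurable]: "snd \<in> measurable (\<Omega> \<Otimes>\<^sub>M (lborel :: (real^2) measure)) borel"
    using measurable_snd[of \<Omega> "lborel :: (real^2) measure"] by simp
  have i0: "integrable (\<Omega> \<Otimes>\<^sub>M lborel) (\<lambda>x. f (snd x))"
    by (rule OL.Fubini_integrable) (auto intro!: fi)
  have ij: "integrable (\<Omega> \<Otimes>\<^sub>M lborel) (\<lambda>x. f (snd x) * g (adj2 (walk n k (fst x)) *v snd x))"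
    by (rule Bochner_Integration.integrable_bound[OF i0]) (auto simp: g_def f_def abs_mult indicator_def)
  have eq: "measure lborel {v \<in> S. adj2 (walk n k \<omega>) *v v \<in> T} = (\<integral>v. f v * g (adj2 (walk n k \<omega>) *v v) \<partial>lborel)" for \<omega>
  proof -
    have "(\<lambda>v. f v * g (adj2 (walk n k \<omega>) *v v)) = indicator {v \<in> S. adj2 (walk n k \<omega>) *v v \<in> T}"
      by (auto simp: f_def g_def fun_eq_iff indicator_def)
    moreover have "{v \<in> S. adj2 (walk n k \<omega>) *v v \<in> T} \<in> sets borel" by measurable
    ultimately show ?thesis by simp
  qed
  show "integrable \<Omega> (\<lambda>\<omega>. measure lborel {v \<in> S. adj2 (walk n k \<omega>) *v v \<in> T})"
    unfolding eq using OL.integrable_fst[of "\<lambda>\<omega> v. f v * g (adj2 (walk n k \<omega>) *v v)"] ij by (simp add: split_beta')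
  have "(\<integral>\<omega>. measure lborel {v \<in> S. adj2 (walk n k \<omega>) *v v \<in> T} \<partial>\<Omega>)
     = (\<integral>v. \<integral>\<omega>. f v * g (adj2 (walk n k \<omega>) *v v) \<partial>\<Omega> \<partial>lborel)"
    unfolding eq using OL.Fubini_integral[of "\<lambda>\<omega> v. f v * g (adj2 (walk n k \<omega>) *v v)"] ij by (simp add: split_beta')
  also have "\<dots> = (\<integral>v. f v * pull g n k v \<partial>lborel)" by (simp add: pull_def)
  also have "\<dots> \<le> sqrt (\<rho> ^ k * measure lborel S * measure lborel T)"
  proof (rule real_le_rsqrt)
    have p: "unit_L2 (pull g n k)" "energy (pull g n k) \<le> \<rho> ^ k * measure lborel T"
      using pull_contract[OF g, of n k] gi by (simp_all add: sq)
    have pm: "pull g n k \<in> borel_measurable borel" "integrable lborel (\<lambda>v. (pull g n k v)\<^sup>2)"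
      using p(1) unfolding unit_L2_def by blast+
    have "(\<integral>v. f v * pull g n k v \<partial>lborel)\<^sup>2 \<le> energy f * energy (pull g n k)"
      by (rule Cauchy_Schwarz_integral) (simp_all add: sq fi pm)
    also have "\<dots> \<le> measure lborel S * (\<rho> ^ k * measure lborel T)"
      using p(2) fi(2) by (intro mult_mono) (simp_all add: sq)
    finally show "(\<integral>v. f v * pull g n k v \<partial>lborel)\<^sup>2 \<le> \<rho> ^ k * measure lborel S * measure lborel T"
      by (simp add: mult.commute mult.left_commute)
  qed
  finally show "(\<integral>\<omega>. measure lborel {v \<in> S. adj2 (walk n k \<omega>) *v v \<in> T} \<partial>\<Omega>)
      \<le> sqrt (\<rho> ^ k * measure lborel S * measure lborel T)" .
qed

text \<open>A product of norm \<open>r\<close> has an inverse of norm \<open>r\<close>, which keeps the disc of radius \<open>1/r\<close> inside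
  the unit disc; hence the unit disc overlaps its image in area at least \<open>\<pi> / r\<^sup>2\<close>.\<close>
lemma expected_inverse_norm:
  "(\<integral>\<omega>. (1 / norm (walk n k \<omega>))\<^sup>2 \<partial>\<Omega>) \<le> sqrt (\<rho> ^ k)"
proof -
  define c where "c = unit_ball_vol 2"
  have c: "c > 0" by (simp add: c_def)
  have vol: "measure lborel (cball (0::real^2) r) = c * r\<^sup>2" if "0 \<le> r" for r
    using content_cball[OF that, of "0::real^2"] by (simp add: c_def)
  have fin: "emeasure lborel (cball (0::real^2) 1) < \<infinity>" using emeasure_lborel_cball_finite by auto
  have W: "1 \<le> norm (walk n k \<omega>)" if "\<omega> \<in> space \<Omega>" for \<omega>
    using norm_SL2_ge_1[OF walk_SL2[OF that]] .
  have le: "c * (1 / norm (walk n k \<omega>))\<^sup>2 \<le> measure lborel {v \<in> cball 0 1. adj2 (walk n k \<omega>) *v v \<in> cball 0 1}"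
    if w: "\<omega> \<in> space \<Omega>" for \<omega>
  proof -
    have pos: "norm (walk n k \<omega>) > 0" using W[OF w] by linarith
    have "c * (1 / norm (walk n k \<omega>))\<^sup>2 = measure lborel (cball (0::real^2) (1 / norm (walk n k \<omega>)))"
      by (rule vol[symmetric]) simp
    also have "\<dots> \<le> measure lborel {v \<in> cball 0 1. adj2 (walk n k \<omega>) *v v \<in> cball 0 1}"
    proof (rule measure_mono_fmeasurable)
      show "cball 0 (1 / norm (walk n k \<omega>)) \<subseteq> {v \<in> cball 0 1. adj2 (walk n k \<omega>) *v v \<in> cball 0 1}"
      proof clarify
        fix v :: "real^2" assume v: "v \<in> cball 0 (1 / norm (walk n k \<omega>))"
        then have *: "norm (walk n k \<omega>) * norm v \<le> 1" using pos by (simp add: field_simps)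
        moreover have "norm v \<le> norm (walk n k \<omega>) * norm v" using mult_right_mono[OF W[OF w] norm_ge_zero[of v]] by simp
        moreover have "norm (adj2 (walk n k \<omega>) *v v) \<le> norm (walk n k \<omega>) * norm v"
          using norm_matrix_vector_le[of "adj2 (walk n k \<omega>)" v] by simp
        ultimately show "v \<in> cball 0 1 \<and> adj2 (walk n k \<omega>) *v v \<in> cball 0 1" by simp
      qed
      have "{v \<in> cball 0 1. adj2 (walk n k \<omega>) *v v \<in> cball 0 1} \<in> sets borel"
        unfolding mem_cball by measurable
      moreover have "emeasure lborel {v \<in> cball 0 1. adj2 (walk n k \<omega>) *v v \<in> cball 0 1} \<le> emeasure lborel (cball (0::real^2) 1)"
        by (rule emeasure_mono) auto
      ultimately show "{v \<in> cball 0 1. adj2 (walk n k \<omega>) *v v \<in> cball 0 1} \<in> fmeasurable lborel"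
        using fin by (intro fmeasurableI) (auto intro: le_less_trans)
    qed simp
    finally show ?thesis .
  qed
  note ov = expected_overlap[OF borel_closed[OF closed_cball] fin borel_closed[OF closed_cball] fin, of n k]
  have i: "integrable \<Omega> (\<lambda>\<omega>. (1 / norm (walk n k \<omega>))\<^sup>2)"
    by (rule P.integrable_const_bound[of _ 1]) (use W in \<open>auto intro!: AE_I2 power_le_one simp: power_one_over[symmetric] divide_le_eq\<close>)
  have "c * (\<integral>\<omega>. (1 / norm (walk n k \<omega>))\<^sup>2 \<partial>\<Omega>) = (\<integral>\<omega>. c * (1 / norm (walk n k \<omega>))\<^sup>2 \<partial>\<Omega>)" by simp
  also have "\<dots> \<le> (\<integral>\<omega>. measure lborel {v \<in> cball 0 1. adj2 (walk n k \<omega>) *v v \<in> cball 0 1} \<partial>\<Omega>)"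
    by (rule integral_mono[OF integrable_mult_right[OF i] ov(1)]) (rule le)
  also have "\<dots> \<le> sqrt (\<rho> ^ k * measure lborel (cball (0::real^2) 1) * measure lborel (cball (0::real^2) 1))"
    by (rule ov(2))
  also have "\<dots> = c * sqrt (\<rho> ^ k)"
    using c by (simp add: vol real_sqrt_mult)
  finally show ?thesis using c by simp
qed

end

section \<open>Logarithmic moments and exponential growth\<close>

lemma ln_norm_SL2_nonneg: "A \<in> SL2 \<Longrightarrow> 0 \<le> ln (norm A)"
  using norm_SL2_ge_1[of A] by simp

definition log_norm_sum :: "nat \<Rightarrow> nat \<Rightarrow> (nat \<Rightarrow> real^2^2) \<Rightarrow> real" where
  "log_norm_sum n k \<omega> = (\<Sum>i<k. ln (norm (\<omega> (Suc (n + i)))))"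

context sl2_walk begin

lemma log_norm_sum_nonneg: "\<omega> \<in> space \<Omega> \<Longrightarrow> 0 \<le> log_norm_sum n k \<omega>"
  unfolding log_norm_sum_def by (intro sum_nonneg ln_norm_SL2_nonneg component_SL2) auto

lemma walk_vec_pos: "\<omega> \<in> space \<Omega> \<Longrightarrow> norm u = 1 \<Longrightarrow> 0 < norm (walk n k \<omega> *v u)"
  using SL2_vec_eq_0_iff[OF walk_SL2, of \<omega> n k u] by force

lemma walk_norm_pos: "\<omega> \<in> space \<Omega> \<Longrightarrow> 0 < norm (walk n k \<omega>)"
  using norm_SL2_ge_1[OF walk_SL2, of \<omega> n k] by linarith

lemma abs_ln_walk_vec_le:
  assumes w: "\<omega> \<in> space \<Omega>" and u: "norm u = 1"
  shows "\<bar>log_stretch n k u \<omega>\<bar> \<le> log_norm_sum n k \<omega>"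
proof (induction k)
  case 0 show ?case by (simp add: u log_norm_sum_def)
next
  case (Suc k)
  define A where "A = \<omega> (Suc (n + k))"
  define v where "v = walk n k \<omega> *v u"
  have A: "A \<in> SL2" unfolding A_def by (rule component_SL2[OF w]) simp
  have v: "0 < norm v" unfolding v_def by (rule walk_vec_pos[OF w u])
  have pA: "0 < norm A" using norm_SL2_ge_1[OF A] by linarith
  have Av: "0 < norm (A *v v)" using SL2_vec_eq_0_iff[OF A, of v] v by auto
  have "ln (norm (A *v v)) \<le> ln (norm A * norm v)"
    using norm_matrix_vector_le[of A v] Av pA v by (subst ln_le_cancel_iff) auto
  moreover have "ln (norm v) \<le> ln (norm A * norm (A *v v))"
    using norm_le_SL2_vec[OF A, of v] Av pA v by (subst ln_le_cancel_iff) auto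
  ultimately have "\<bar>ln (norm (A *v v)) - ln (norm v)\<bar> \<le> ln (norm A)"
    using Av pA v by (simp add: ln_mult)
  moreover have "log_stretch n (Suc k) u \<omega> = ln (norm (A *v v))"
    by (simp add: walk_Suc A_def v_def matrix_vector_mul_assoc)
  moreover have "log_norm_sum n (Suc k) \<omega> = log_norm_sum n k \<omega> + ln (norm A)"
    by (simp add: log_norm_sum_def A_def)
  ultimately show ?case using Suc unfolding v_def by linarith
qed

lemma ln_walk_vec_le_norm:
  assumes w: "\<omega> \<in> space \<Omega>" and u: "norm u = 1"
  shows "log_stretch n k u \<omega> \<le> log_norm n k \<omega>"
  using norm_matrix_vector_le[of "walk n k \<omega>" u] walk_vec_pos[OF w u, of n k] u
  by (subst ln_le_cancel_iff) auto

text \<open>The additive constant accounts for the empty product: the identity has Frobenius norm \<open>sqrt 2\<close>.\<close>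
lemma ln_walk_norm_le:
  assumes w: "\<omega> \<in> space \<Omega>"
  shows "log_norm n k \<omega> \<le> ln 2 + log_norm_sum n k \<omega>"
proof -
  obtain e :: "real^2" where e: "norm e = 1" "norm (walk n k \<omega>) \<le> 2 * norm (walk n k \<omega> *v e)"
    using ex_axis_norm_ge by blast
  have "log_norm n k \<omega> \<le> ln (2 * norm (walk n k \<omega> *v e))"
    using e(2) walk_norm_pos[OF w, of n k] by (subst ln_le_cancel_iff) auto
  also have "\<dots> = ln 2 + log_stretch n k e \<omega>"
    using walk_vec_pos[OF w e(1), of n k] by (simp add: ln_mult)
  finally show ?thesis using abs_ln_walk_vec_le[OF w e(1), of n k] by linarith
qed

lemma C_nonneg: "0 \<le> C"
proof -
  have "0 \<le> (\<integral>A. (ln (norm A))\<^sup>2 \<partial>\<mu> 0)" by simp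
  with C(2)[of 0] show ?thesis by linarith
qed

lemma component_sq:
  assumes "1 \<le> i"
  shows "integrable \<Omega> (\<lambda>\<omega>. (ln (norm (\<omega> i)))\<^sup>2)" "(\<integral>\<omega>. (ln (norm (\<omega> i)))\<^sup>2 \<partial>\<Omega>) \<le> C"
proof -
  have [measurable]: "(\<lambda>A. A) \<in> measurable (\<mu> i) borel" by (rule prob_measures_SL2D[OF \<mu>])
  have "(\<lambda>A. (ln (norm A))\<^sup>2) \<in> borel_measurable (\<mu> i)" by measurable
  from integral_component[OF assms this]
  show "integrable \<Omega> (\<lambda>\<omega>. (ln (norm (\<omega> i)))\<^sup>2)" "(\<integral>\<omega>. (ln (norm (\<omega> i)))\<^sup>2 \<partial>\<Omega>) \<le> C"
    using C by auto
qed

lemma log_norm_sum_meas [measurable]: "log_norm_sum n k \<in> borel_measurable \<Omega>"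
  unfolding log_norm_sum_def by measurable

lemma log_norm_sum_sq:
  shows "integrable \<Omega> (\<lambda>\<omega>. (log_norm_sum n k \<omega>)\<^sup>2)"
    "(\<integral>\<omega>. (log_norm_sum n k \<omega>)\<^sup>2 \<partial>\<Omega>) \<le> (real k)\<^sup>2 * C"
proof -
  have bnd: "(log_norm_sum n k \<omega>)\<^sup>2 \<le> real k * (\<Sum>i<k. (ln (norm (\<omega> (Suc (n + i)))))\<^sup>2)" for \<omega>
    using Cauchy_Schwarz_ineq_sum[of "\<lambda>_. 1" "\<lambda>i. ln (norm (\<omega> (Suc (n + i))))" "{..<k}"]
    by (simp add: log_norm_sum_def)
  have i: "integrable \<Omega> (\<lambda>\<omega>. real k * (\<Sum>i<k. (ln (norm (\<omega> (Suc (n + i)))))\<^sup>2))"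
    by (intro integrable_mult_right Bochner_Integration.integrable_sum component_sq) simp
  show *: "integrable \<Omega> (\<lambda>\<omega>. (log_norm_sum n k \<omega>)\<^sup>2)"
    by (rule Bochner_Integration.integrable_bound[OF i]) (use bnd in \<open>auto intro: order_trans[OF _ abs_ge_self]\<close>)
  have "(\<integral>\<omega>. (log_norm_sum n k \<omega>)\<^sup>2 \<partial>\<Omega>) \<le> (\<integral>\<omega>. real k * (\<Sum>i<k. (ln (norm (\<omega> (Suc (n + i)))))\<^sup>2) \<partial>\<Omega>)"
    by (rule integral_mono[OF * i]) (rule bnd)
  also have "\<dots> = real k * (\<Sum>i<k. \<integral>\<omega>. (ln (norm (\<omega> (Suc (n + i)))))\<^sup>2 \<partial>\<Omega>)"
    by (subst integral_mult_right_zero, subst Bochner_Integration.integral_sum) (auto intro!: component_sq)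
  also have "\<dots> \<le> real k * (\<Sum>i<k. C)"
    by (intro mult_left_mono sum_mono component_sq) auto
  finally show "(\<integral>\<omega>. (log_norm_sum n k \<omega>)\<^sup>2 \<partial>\<Omega>) \<le> (real k)\<^sup>2 * C"
    by (simp add: power2_eq_square mult.assoc)
qed

lemma log_norm_sum_int:
  shows "integrable \<Omega> (log_norm_sum n k)" "(\<integral>\<omega>. log_norm_sum n k \<omega> \<partial>\<Omega>) \<le> real k * (1 + C)"
proof -
  have le: "x \<le> 1 + x\<^sup>2" "\<bar>x\<bar> \<le> 1 + x\<^sup>2" for x :: real
  proof -
    have "0 \<le> (\<bar>x\<bar> - 1)\<^sup>2" by simp
    then have "2 * \<bar>x\<bar> \<le> 1 + x\<^sup>2" by (simp add: power2_diff)
    then show "x \<le> 1 + x\<^sup>2" "\<bar>x\<bar> \<le> 1 + x\<^sup>2" using zero_le_power2[of x] by linarith+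
  qed
  have ci: "integrable \<Omega> (\<lambda>\<omega>. ln (norm (\<omega> i)))" if "1 \<le> i" for i
  proof (rule Bochner_Integration.integrable_bound)
    show "integrable \<Omega> (\<lambda>\<omega>. 1 + (ln (norm (\<omega> i)))\<^sup>2)" using component_sq[OF that] by simp
  qed (use that le in \<open>auto intro!: order_trans[OF _ abs_ge_self]\<close>)
  show "integrable \<Omega> (log_norm_sum n k)"
    unfolding log_norm_sum_def by (intro Bochner_Integration.integrable_sum ci) simp
  have "(\<integral>\<omega>. log_norm_sum n k \<omega> \<partial>\<Omega>) = (\<Sum>i<k. \<integral>\<omega>. ln (norm (\<omega> (Suc (n + i)))) \<partial>\<Omega>)"
    unfolding log_norm_sum_def by (intro Bochner_Integration.integral_sum ci) simp
  also have "\<dots> \<le> (\<Sum>i<k. 1 + C)"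
  proof (rule sum_mono)
    fix i assume "i \<in> {..<k}"
    have "(\<integral>\<omega>. ln (norm (\<omega> (Suc (n + i)))) \<partial>\<Omega>) \<le> (\<integral>\<omega>. 1 + (ln (norm (\<omega> (Suc (n + i)))))\<^sup>2 \<partial>\<Omega>)"
      by (intro integral_mono ci le(1) Bochner_Integration.integrable_add component_sq) auto
    also have "\<dots> = 1 + (\<integral>\<omega>. (ln (norm (\<omega> (Suc (n + i)))))\<^sup>2 \<partial>\<Omega>)"
      using component_sq[of "Suc (n + i)"] P.prob_space by simp
    also have "\<dots> \<le> 1 + C" using component_sq(2)[of "Suc (n + i)"] by simp
    finally show "(\<integral>\<omega>. ln (norm (\<omega> (Suc (n + i)))) \<partial>\<Omega>) \<le> 1 + C" .
  qed
  finally show "(\<integral>\<omega>. log_norm_sum n k \<omega> \<partial>\<Omega>) \<le> real k * (1 + C)" by simp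
qed

lemma walk_vec_int:
  assumes u: "norm u = 1"
  shows "integrable \<Omega> (\<lambda>\<omega>. log_stretch n k u \<omega>)"
    "integrable \<Omega> (\<lambda>\<omega>. (log_stretch n k u \<omega>)\<^sup>2)"
    "(\<integral>\<omega>. (log_stretch n k u \<omega>)\<^sup>2 \<partial>\<Omega>) \<le> (real k)\<^sup>2 * C"
proof -
  show "integrable \<Omega> (\<lambda>\<omega>. log_stretch n k u \<omega>)"
    by (rule Bochner_Integration.integrable_bound[OF log_norm_sum_int(1)[of n k]])
       (auto intro!: AE_I2 order_trans[OF abs_ln_walk_vec_le[OF _ u] abs_ge_self])
  have sq: "(log_stretch n k u \<omega>)\<^sup>2 \<le> (log_norm_sum n k \<omega>)\<^sup>2" if "\<omega> \<in> space \<Omega>" for \<omega>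
    using abs_ln_walk_vec_le[OF that u, of n k] log_norm_sum_nonneg[OF that, of n k]
    by (intro power2_le_iff_abs_le[THEN iffD2]) auto
  show i: "integrable \<Omega> (\<lambda>\<omega>. (log_stretch n k u \<omega>)\<^sup>2)"
    by (rule Bochner_Integration.integrable_bound[OF log_norm_sum_sq(1)[of n k]]) (use sq in \<open>auto intro!: AE_I2\<close>)
  have "(\<integral>\<omega>. (log_stretch n k u \<omega>)\<^sup>2 \<partial>\<Omega>) \<le> (\<integral>\<omega>. (log_norm_sum n k \<omega>)\<^sup>2 \<partial>\<Omega>)"
    by (rule integral_mono[OF i log_norm_sum_sq(1)]) (rule sq)
  with log_norm_sum_sq(2)[of n k] show "(\<integral>\<omega>. (log_stretch n k u \<omega>)\<^sup>2 \<partial>\<Omega>) \<le> (real k)\<^sup>2 * C"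
    by linarith
qed

lemma walk_norm_int:
  shows "integrable \<Omega> (\<lambda>\<omega>. log_norm n k \<omega>)"
    "(\<integral>\<omega>. log_norm n k \<omega> \<partial>\<Omega>) \<le> ln 2 + real k * (1 + C)"
    "0 \<le> (\<integral>\<omega>. log_norm n k \<omega> \<partial>\<Omega>)"
proof -
  have i2: "integrable \<Omega> (\<lambda>\<omega>. ln 2 + log_norm_sum n k \<omega>)" using log_norm_sum_int(1) by simp
  have nn: "0 \<le> log_norm n k \<omega>" if "\<omega> \<in> space \<Omega>" for \<omega>
    by (rule ln_norm_SL2_nonneg[OF walk_SL2[OF that]])
  show i: "integrable \<Omega> (\<lambda>\<omega>. log_norm n k \<omega>)"
    by (rule Bochner_Integration.integrable_bound[OF i2])
       (use nn ln_walk_norm_le in \<open>auto intro!: AE_I2 order_trans[OF _ abs_ge_self]\<close>)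
  have "(\<integral>\<omega>. log_norm n k \<omega> \<partial>\<Omega>) \<le> (\<integral>\<omega>. ln 2 + log_norm_sum n k \<omega> \<partial>\<Omega>)"
    by (rule integral_mono[OF i i2]) (rule ln_walk_norm_le)
  also have "\<dots> = ln 2 + (\<integral>\<omega>. log_norm_sum n k \<omega> \<partial>\<Omega>)"
    using log_norm_sum_int(1) P.prob_space by simp
  finally show "(\<integral>\<omega>. log_norm n k \<omega> \<partial>\<Omega>) \<le> ln 2 + real k * (1 + C)"
    using log_norm_sum_int(2)[of n k] by linarith
  show "0 \<le> (\<integral>\<omega>. log_norm n k \<omega> \<partial>\<Omega>)"
    by (rule Bochner_Integration.integral_nonneg_AE) (use nn in auto)
qed

text \<open>Jensen's inequality for the logarithm, in the form \<open>ln y \<le> y - 1\<close>.\<close>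
lemma mean_log_norm_growth: "real k * (- ln \<rho> / 4) \<le> (\<integral>\<omega>. log_norm n k \<omega> \<partial>\<Omega>)"
proof -
  define q where "q = sqrt (\<rho> ^ k)"
  have q: "0 < q" using \<rho> by (simp add: q_def)
  have W: "1 \<le> norm (walk n k \<omega>)" if "\<omega> \<in> space \<Omega>" for \<omega>
    using norm_SL2_ge_1[OF walk_SL2[OF that]] .
  have i: "integrable \<Omega> (\<lambda>\<omega>. (1 / norm (walk n k \<omega>))\<^sup>2)"
    by (rule P.integrable_const_bound[of _ 1]) (use W in \<open>auto intro!: AE_I2 power_le_one simp: power_one_over[symmetric] divide_le_eq\<close>)
  have "(\<integral>\<omega>. - ln q - 2 * log_norm n k \<omega> \<partial>\<Omega>) \<le> (\<integral>\<omega>. (1 / norm (walk n k \<omega>))\<^sup>2 / q - 1 \<partial>\<Omega>)"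
  proof (rule integral_mono)
    show "integrable \<Omega> (\<lambda>\<omega>. - ln q - 2 * log_norm n k \<omega>)" using walk_norm_int(1) by simp
    show "integrable \<Omega> (\<lambda>\<omega>. (1 / norm (walk n k \<omega>))\<^sup>2 / q - 1)" using i by simp
    fix \<omega> assume "\<omega> \<in> space \<Omega>"
    then have pos: "0 < norm (walk n k \<omega>)" by (rule walk_norm_pos)
    define y where "y = (1 / norm (walk n k \<omega>))\<^sup>2 / q"
    have y: "0 < y" using pos q by (simp add: y_def)
    have "ln y = ln ((1 / norm (walk n k \<omega>))\<^sup>2) - ln q"
      unfolding y_def using pos q by (subst ln_div) auto
    also have "ln ((1 / norm (walk n k \<omega>))\<^sup>2) = - 2 * log_norm n k \<omega>"
      using pos by (subst ln_realpow) (auto simp: ln_div)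
    finally have "ln y = - ln q - 2 * log_norm n k \<omega>" by simp
    then show "- ln q - 2 * log_norm n k \<omega> \<le> (1 / norm (walk n k \<omega>))\<^sup>2 / q - 1"
      using ln_le_minus_one[OF y] by (simp add: y_def)
  qed
  also have "\<dots> = (\<integral>\<omega>. (1 / norm (walk n k \<omega>))\<^sup>2 \<partial>\<Omega>) / q - 1" using i P.prob_space by simp
  also have "\<dots> \<le> 0" using expected_inverse_norm[of n k] q by (simp add: q_def)
  also have "(\<integral>\<omega>. - ln q - 2 * log_norm n k \<omega> \<partial>\<Omega>) = - ln q - 2 * (\<integral>\<omega>. log_norm n k \<omega> \<partial>\<Omega>)"
    using walk_norm_int(1) P.prob_space by simp
  also have "ln q = real k * ln \<rho> / 2" using \<rho> by (simp add: q_def ln_sqrt ln_realpow)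
  finally show ?thesis by simp
qed

end

section \<open>Directions do not concentrate\<close>

text \<open>A neighbourhood of the horizontal axis whose width at distance \<open>r\<close> is of order \<open>1/r\<close>. Each of
  its \<open>J\<close> dyadic pieces has the same area, and a determinant-one matrix that nearly fixes the axis
  sends the inner quarters of all but boundedly many of them back into the region, the number
  depending only on the norm of the matrix. For \<open>J\<close> large the distortion is therefore negligible, which no region of a single
  scale would achieve.\<close>
definition hyp_region :: "nat \<Rightarrow> (real^2) set" where
  "hyp_region J = {v. 1 \<le> \<bar>v$1\<bar> \<and> \<bar>v$1\<bar> \<le> 2 ^ J \<and> \<bar>v$1 * v$2\<bar> \<le> 1}"

lemma hyp_region_borel [measurable]: "hyp_region J \<in> sets borel"
proof -
  have "closed (hyp_region J)" unfolding hyp_region_def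
    by (intro closed_Collect_conj closed_Collect_le continuous_intros)
  then show ?thesis by (rule borel_closed)
qed

lemma measure_rectangle:
  fixes a b c :: real
  assumes "a \<le> b" "0 \<le> c"
  defines "l \<equiv> vector [a, - c] :: real^2" and "u \<equiv> vector [b, c] :: real^2"
  shows "measure lborel (cbox l u) = (b - a) * (2 * c)" "measure lborel (box l u) = (b - a) * (2 * c)"
proof -
  have "l \<in> cbox l u" using assms by (simp add: mem_box_cart forall_2)
  then have ne: "cbox l u \<noteq> {}" by blast
  show 1: "measure lborel (cbox l u) = (b - a) * (2 * c)"
    using content_cbox_cart[OF ne] by (simp add: UNIV_2 l_def u_def)
  have "\<forall>i\<in>Basis. l \<bullet> i \<le> u \<bullet> i" using ne by (simp add: box_ne_empty)
  then show "measure lborel (box l u) = (b - a) * (2 * c)"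
    unfolding 1[symmetric] by (simp add: measure_lborel_box_eq measure_lborel_cbox_eq)
qed

lemma ex_dyadic:
  fixes x :: real
  assumes "1 \<le> x" "x \<le> 2 ^ J" "0 < J"
  shows "\<exists>k<J. 2 ^ k \<le> x \<and> x \<le> 2 ^ Suc k"
  using assms
proof (induction J)
  case (Suc J)
  show ?case
  proof (cases "2 ^ J \<le> x")
    case True then show ?thesis using Suc.prems by (intro exI[of _ J]) auto
  next
    case False
    then have "0 < J" using Suc.prems by (cases J) auto
    with Suc False obtain k where "k < J" "2 ^ k \<le> x \<and> x \<le> 2 ^ Suc k" by force
    then show ?thesis by (intro exI[of _ k]) auto
  qed
qed simp

lemma hyp_region_size:
  assumes "0 < J"
  shows "emeasure lborel (hyp_region J) < \<infinity>" "measure lborel (hyp_region J) \<le> 4 * real J"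
proof -
  define Q where "Q k = cbox (vector [2 ^ k, - (1 / 2 ^ k)]) (vector [2 ^ Suc k, 1 / 2 ^ k] :: real^2)" for k :: nat
  define Q' where "Q' k = cbox (vector [- (2 ^ Suc k), - (1 / 2 ^ k)]) (vector [- (2 ^ k), 1 / 2 ^ k] :: real^2)" for k :: nat
  have sub: "hyp_region J \<subseteq> (\<Union>k<J. Q k \<union> Q' k)"
  proof
    fix v :: "real^2" assume v: "v \<in> hyp_region J"
    then obtain k where k: "k < J" "2 ^ k \<le> \<bar>v$1\<bar>" "\<bar>v$1\<bar> \<le> 2 ^ Suc k"
      using ex_dyadic[OF _ _ assms, of "\<bar>v$1\<bar>"] by (auto simp: hyp_region_def)
    have "2 ^ k * \<bar>v$2\<bar> \<le> \<bar>v$1\<bar> * \<bar>v$2\<bar>" using k by (intro mult_right_mono) auto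
    also have "\<dots> \<le> 1" using v by (simp add: hyp_region_def abs_mult)
    finally have "\<bar>v$2\<bar> \<le> 1 / 2 ^ k" by (simp add: field_simps)
    then have "v \<in> Q k \<union> Q' k"
      using k by (auto simp: Q_def Q'_def mem_box_cart forall_2 abs_le_iff abs_if split: if_splits)
    with k(1) show "v \<in> (\<Union>k<J. Q k \<union> Q' k)" by blast
  qed
  have fm: "Q k \<union> Q' k \<in> fmeasurable lborel" for k
    unfolding Q_def Q'_def by (intro fmeasurable.Un fmeasurable_cbox)
  have fU: "(\<Union>k<J. Q k \<union> Q' k) \<in> fmeasurable lborel"
    by (intro fmeasurable.finite_UN fm) auto
  have "measure lborel (Q k) = 2" "measure lborel (Q' k) = 2" for k
    unfolding Q_def Q'_def by (subst measure_rectangle; simp)+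
  then have m: "measure lborel (Q k \<union> Q' k) \<le> 4" for k
    using measure_Un_le[of "Q k" lborel "Q' k"] by (simp add: Q_def Q'_def)
  have "measure lborel (hyp_region J) \<le> measure lborel (\<Union>k<J. Q k \<union> Q' k)"
    by (rule measure_mono_fmeasurable[OF sub _ fU]) simp
  also have "\<dots> \<le> (\<Sum>k<J. measure lborel (Q k \<union> Q' k))"
    by (rule measure_UNION_le) (use fm in \<open>auto simp: fmeasurable_def\<close>)
  also have "\<dots> \<le> (\<Sum>k<J. 4)" by (intro sum_mono m)
  finally show "measure lborel (hyp_region J) \<le> 4 * real J" by simp
  have "emeasure lborel (hyp_region J) \<le> emeasure lborel (\<Union>k<J. Q k \<union> Q' k)"
    using fU by (intro emeasure_mono sub) (auto simp: fmeasurable_def)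
  also have "\<dots> < \<infinity>" using fU by (simp add: fmeasurable_def)
  finally show "emeasure lborel (hyp_region J) < \<infinity>" .
qed

text \<open>The product of the two new coordinates is a quadratic form in \<open>s\<close> and \<open>t\<close>. Its mixed
  coefficient \<open>a d + b c = 1 + 2 b c\<close> is close to one since \<open>c\<close> is tiny; the terms in \<open>s\<^sup>2\<close> and \<open>t\<^sup>2\<close>
  are small because \<open>s\<close> is at most of order \<open>N / M\<close> and at least of order \<open>M\<^sup>2\<close>.\<close>
lemma hyp_region_stays:
  fixes a b c d M N s t :: real
  assumes det: "a * d - b * c = 1" and M: "1 \<le> M" and N: "2 * M \<le> N"
    and bnd: "\<bar>a\<bar> \<le> M" "\<bar>b\<bar> \<le> M" "\<bar>d\<bar> \<le> M" "\<bar>c\<bar> \<le> M / N\<^sup>2"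
    and low: "1 / M\<^sup>2 \<le> a\<^sup>2 + c\<^sup>2"
    and s: "4 * M\<^sup>2 \<le> s" "2 * M * s \<le> N" and st: "\<bar>s * t\<bar> \<le> 1 / 4"
  shows "1 \<le> \<bar>a * s + b * t\<bar>" "\<bar>a * s + b * t\<bar> \<le> N" "\<bar>(a * s + b * t) * (c * s + d * t)\<bar> \<le> 1"
proof -
  have M2: "1 \<le> M\<^sup>2" using M by simp
  have s4: "4 \<le> s" using s M2 by linarith
  have N0: "2 \<le> N" using M N by linarith
  have ts: "\<bar>t\<bar> * s \<le> 1 / 4" using st s4 by (simp add: abs_mult mult.commute)
  have Ms: "M \<le> s"
  proof -
    have "M * 1 \<le> M * M" using M by (intro mult_left_mono) auto
    then have "M \<le> M\<^sup>2" by (simp add: power2_eq_square)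
    then show ?thesis using s(1) M2 by linarith
  qed
  have Mt: "M * \<bar>t\<bar> \<le> 1 / 4"
  proof -
    have "M * \<bar>t\<bar> \<le> s * \<bar>t\<bar>" using Ms by (intro mult_right_mono) auto
    with ts show ?thesis by (simp add: mult.commute)
  qed
  have N2: "4 * M\<^sup>2 \<le> N\<^sup>2"
    using power_mono[OF N, of 2] M by (simp add: power_mult_distrib)
  have c2: "c\<^sup>2 \<le> (1 / (2 * M))\<^sup>2"
  proof -
    have "M / N\<^sup>2 \<le> M / (4 * M\<^sup>2)" using N2 M N0 by (intro divide_left_mono) auto
    also have "\<dots> = 1 / (4 * M)" using M by (simp add: power2_eq_square)
    also have "\<dots> \<le> 1 / (2 * M)" using M by (intro divide_left_mono) auto
    finally have "\<bar>c\<bar> \<le> 1 / (2 * M)" using bnd(4) by linarith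
    then show ?thesis using M by (intro power2_le_iff_abs_le[THEN iffD2]) auto
  qed
  have a: "1 / (2 * M) \<le> \<bar>a\<bar>"
  proof (rule power2_le_imp_le)
    have "(1 / (2 * M))\<^sup>2 = (1 / M\<^sup>2) / 4" by (simp add: power_divide power_mult_distrib)
    moreover have "0 \<le> 1 / M\<^sup>2" by simp
    moreover have "z \<le> x" if "z = y / 4" "0 \<le> y" "x' \<le> z" "y \<le> x + x'" for x x' y z :: real
      using that by linarith
    ultimately show "(1 / (2 * M))\<^sup>2 \<le> \<bar>a\<bar>\<^sup>2" using c2 low unfolding power2_abs by blast
  qed simp
  have bt: "\<bar>b * t\<bar> \<le> 1 / 4"
  proof -
    have "\<bar>b * t\<bar> \<le> M * \<bar>t\<bar>" using bnd(2) by (simp add: abs_mult mult_right_mono)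
    with Mt show ?thesis by linarith
  qed
  have "2 * M \<le> \<bar>a * s\<bar>"
  proof -
    have "2 * M = 1 / (2 * M) * (4 * M\<^sup>2)" using M by (simp add: power2_eq_square)
    also have "\<dots> \<le> \<bar>a\<bar> * s" using a s(1) M by (intro mult_mono) auto
    finally show ?thesis using s4 by (simp add: abs_mult)
  qed
  then show "1 \<le> \<bar>a * s + b * t\<bar>" using bt M by linarith
  have "\<bar>a * s\<bar> \<le> M * s" using bnd(1) s4 by (simp add: abs_mult mult_right_mono)
  moreover have "1 \<le> M * s" using mult_mono[OF M, of 1 s] s4 M by simp
  ultimately show "\<bar>a * s + b * t\<bar> \<le> N" using bt s(2) by linarith
  have e: "(a * s + b * t) * (c * s + d * t) = a * c * s\<^sup>2 + (1 + 2 * (b * c)) * (s * t) + b * d * t\<^sup>2"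
  proof -
    have "(a * s + b * t) * (c * s + d * t) = a * c * s\<^sup>2 + (a * d + b * c) * (s * t) + b * d * t\<^sup>2"
      by (simp add: power2_eq_square algebra_simps)
    moreover have "a * d + b * c = 1 + 2 * (b * c)" using det by simp
    ultimately show ?thesis by simp
  qed
  have e1: "\<bar>a * c * s\<^sup>2\<bar> \<le> 1 / 4"
  proof -
    have "\<bar>a * c * s\<^sup>2\<bar> = \<bar>a\<bar> * \<bar>c\<bar> * s\<^sup>2" by (simp add: abs_mult)
    also have "\<dots> \<le> M * (M / N\<^sup>2) * s\<^sup>2" using bnd M by (intro mult_right_mono mult_mono) auto
    also have "\<dots> = (2 * M * s)\<^sup>2 / (4 * N\<^sup>2)" using N0 by (simp add: power2_eq_square)
    also have "\<dots> \<le> N\<^sup>2 / (4 * N\<^sup>2)" using s M s4 by (intro divide_right_mono power_mono) auto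
    finally show ?thesis using N0 by simp
  qed
  have e2: "\<bar>(1 + 2 * (b * c)) * (s * t)\<bar> \<le> 1 / 2"
  proof -
    have "\<bar>b * c\<bar> \<le> M * (M / N\<^sup>2)" using bnd M by (simp only: abs_mult) (intro mult_mono; simp)
    also have "\<dots> \<le> 1 / 4" using N2 N0 by (simp add: power2_eq_square field_simps)
    finally have "\<bar>1 + 2 * (b * c)\<bar> \<le> 2" by linarith
    then have "\<bar>1 + 2 * (b * c)\<bar> * \<bar>s * t\<bar> \<le> 2 * (1 / 4)" using st by (intro mult_mono) auto
    then show ?thesis by (simp add: abs_mult)
  qed
  have e3: "\<bar>b * d * t\<^sup>2\<bar> \<le> 1 / 4"
  proof -
    have "\<bar>b * d * t\<^sup>2\<bar> = (\<bar>b\<bar> * \<bar>t\<bar>) * (\<bar>d\<bar> * \<bar>t\<bar>)" by (simp add: abs_mult power2_eq_square)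
    also have "\<dots> \<le> (M * \<bar>t\<bar>) * (M * \<bar>t\<bar>)" using bnd M by (intro mult_mono) auto
    also have "\<dots> \<le> (1 / 4) * (1 / 4)" using Mt M by (intro mult_mono) auto
    finally show ?thesis by simp
  qed
  show "\<bar>(a * s + b * t) * (c * s + d * t)\<bar> \<le> 1" unfolding e using e1 e2 e3 by linarith
qed

text \<open>About \<open>3 p\<close> of the \<open>J\<close> dyadic pieces are lost, those nearest to the origin and those farthest
  away; every other piece contributes area at least \<open>1/4\<close>.\<close>
lemma overlap_lower:
  assumes T: "T \<in> SL2" "norm T \<le> 2 ^ p" and c: "\<bar>T$2$1\<bar> \<le> 2 ^ p / (2 ^ J)\<^sup>2" and J: "3 * p + 3 \<le> J"
  shows "(real J - real (3 * p + 3)) / 4 \<le> measure lborel {v \<in> hyp_region J. T *v v \<in> hyp_region J}"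
proof -
  define M :: real where "M = 2 ^ p"
  define N :: real where "N = 2 ^ J"
  have M: "1 \<le> M" by (simp add: M_def)
  have N: "2 * M \<le> N"
  proof -
    have "(2::real) ^ Suc p \<le> 2 ^ J" using J by (intro power_increasing) auto
    then show ?thesis by (simp add: M_def N_def)
  qed
  have ent: "\<bar>T$i$j\<bar> \<le> M" for i j
    using component_le_norm_cart[of "T$i" j] Finite_Cartesian_Product.norm_nth_le[of T i] T(2)
    unfolding M_def by linarith
  have low: "1 / M\<^sup>2 \<le> (T$1$1)\<^sup>2 + (T$2$1)\<^sup>2"
  proof -
    have "1 \<le> norm T * norm (T *v axis 1 1)" using norm_le_SL2_vec[OF T(1), of "axis 1 1"] by simp
    also have "\<dots> \<le> M * norm (T *v axis 1 1)" using T(2) by (intro mult_right_mono) (auto simp: M_def)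
    finally have "1 / M \<le> norm (T *v axis 1 1)" using M by (simp add: field_simps)
    then have "(1 / M)\<^sup>2 \<le> (norm (T *v axis 1 1))\<^sup>2" using M by (intro power_mono) auto
    also have "(norm (T *v axis 1 1))\<^sup>2 = (T$1$1)\<^sup>2 + (T$2$1)\<^sup>2"
      by (simp add: power2_norm_2 matrix_vector_nth_2 axis_def)
    finally show ?thesis by (simp add: power_divide)
  qed
  define Q where "Q k = box (vector [2 ^ k, - (1 / 2 ^ (k + 3))]) (vector [2 ^ Suc k, 1 / 2 ^ (k + 3)] :: real^2)" for k :: nat
  define I where "I = {2 * p + 2..<J - p - 1}"
  have mQ: "measure lborel (Q k) = 1 / 4" for k
    unfolding Q_def by (subst measure_rectangle) (simp_all add: power_add)
  have sub: "(\<Union>k\<in>I. Q k) \<subseteq> {v \<in> hyp_region J. T *v v \<in> hyp_region J}"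
  proof clarify
    fix k v assume k: "k \<in> I" and v: "v \<in> Q k"
    define s where "s = v$1"
    define t where "t = v$2"
    have st': "2 ^ k < s" "s < 2 ^ Suc k" "\<bar>t\<bar> < 1 / 2 ^ (k + 3)"
      using v by (auto simp: Q_def mem_box_cart forall_2 s_def t_def abs_less_iff)
    have "4 * M\<^sup>2 \<le> 2 ^ k"
    proof -
      have "4 * M\<^sup>2 = 2 ^ (2 * p + 2)" by (simp add: M_def power_add power_mult[symmetric] mult.commute)
      also have "\<dots> \<le> 2 ^ k" using k by (intro power_increasing) (auto simp: I_def)
      finally show ?thesis .
    qed
    then have s1: "4 * M\<^sup>2 \<le> s" using st' by linarith
    have s2: "2 * M * s \<le> N"
    proof -
      have "2 * M * s \<le> 2 ^ Suc p * 2 ^ Suc k" using st' by (simp add: M_def)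
      also have "\<dots> = 2 ^ (Suc p + Suc k)" by (simp only: power_add)
      also have "\<dots> \<le> 2 ^ J" using k by (intro power_increasing) (auto simp: I_def)
      finally show ?thesis by (simp add: N_def)
    qed
    have s0: "1 \<le> s" using st' one_le_power[of "2::real" k] by linarith
    have st: "\<bar>s * t\<bar> \<le> 1 / 4"
    proof -
      have "\<bar>s * t\<bar> = s * \<bar>t\<bar>" using s0 by (simp add: abs_mult)
      also have "\<dots> \<le> 2 ^ Suc k * (1 / 2 ^ (k + 3))" using st' s0 by (intro mult_mono) auto
      also have "\<dots> = 1 / 4" by (simp add: power_add)
      finally show ?thesis .
    qed
    have det: "T$1$1 * T$2$2 - T$1$2 * T$2$1 = 1" using T(1) by (simp add: SL2_det)
    note * = hyp_region_stays[OF det M N ent ent ent c[folded M_def N_def] low s1 s2 st]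
    have "T *v v \<in> hyp_region J"
      using * by (simp add: hyp_region_def matrix_vector_nth_2 s_def t_def N_def)
    moreover have "v \<in> hyp_region J"
    proof -
      have "s \<le> N" using s2 M s0 mult_mono[OF M order_refl, of s] by linarith
      then show ?thesis using s0 st by (simp add: hyp_region_def s_def t_def N_def)
    qed
    ultimately show "v \<in> hyp_region J \<and> T *v v \<in> hyp_region J" by simp
  qed
  have disj: "disjoint_family_on Q I"
    unfolding disjoint_family_on_def
  proof (intro ballI impI)
    fix i j :: nat assume "i \<noteq> j"
    have "Q i \<inter> Q j = {}" if "i < j" for i j
    proof -
      have "(2::real) ^ Suc i \<le> 2 ^ j" using that by (intro power_increasing) auto
      then show ?thesis by (auto simp: Q_def mem_box_cart forall_2)
    qed
    then show "Q i \<inter> Q j = {}" using \<open>i \<noteq> j\<close> by (metis Int_commute linorder_neqE_nat)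
  qed
  have "0 < J" using J by simp
  note hs = hyp_region_size[OF this]
  have bm: "{v \<in> hyp_region J. T *v v \<in> hyp_region J} \<in> sets borel" by measurable
  have fm: "{v \<in> hyp_region J. T *v v \<in> hyp_region J} \<in> fmeasurable lborel"
  proof (rule fmeasurableI)
    have "emeasure lborel {v \<in> hyp_region J. T *v v \<in> hyp_region J} \<le> emeasure lborel (hyp_region J)"
      by (rule emeasure_mono) auto
    then show "emeasure lborel {v \<in> hyp_region J. T *v v \<in> hyp_region J} < \<infinity>" using hs(1) by (rule le_less_trans)
  qed (use bm in simp)
  have "(real J - real (3 * p + 3)) / 4 = (\<Sum>k\<in>I. measure lborel (Q k))"
    using J by (simp add: mQ I_def of_nat_diff)
  also have "\<dots> = measure lborel (\<Union>k\<in>I. Q k)"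
  proof (rule measure_finite_Union[symmetric, OF _ _ disj])
    show "emeasure lborel (Q k) \<noteq> \<infinity>" for k
      unfolding Q_def by (rule less_imp_neq[OF emeasure_lborel_box_finite])
  qed (auto simp: I_def Q_def)
  also have "\<dots> \<le> measure lborel {v \<in> hyp_region J. T *v v \<in> hyp_region J}"
    by (rule measure_mono_fmeasurable[OF sub _ fm]) (auto simp: Q_def)
  finally show ?thesis .
qed

text \<open>The rotation taking the first coordinate vector to \<open>u\<close>.\<close>
definition frame :: "real^2 \<Rightarrow> real^2^2" where
  "frame u = vector [vector [u$1, - u$2], vector [u$2, u$1]]"

lemma frame_nth [simp]:
  "frame u $ 1 $ 1 = u$1" "frame u $ 1 $ 2 = - u$2" "frame u $ 2 $ 1 = u$2" "frame u $ 2 $ 2 = u$1"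
  by (simp_all add: frame_def)

lemma frame_SL2: "norm u = 1 \<Longrightarrow> frame u \<in> SL2"
  using power2_norm_2[of u] by (simp add: SL2_det power2_eq_square)

lemma norm_frame: "norm u = 1 \<Longrightarrow> norm (frame u) \<le> 2"
proof (rule power2_le_imp_le)
  assume "norm u = 1"
  then show "(norm (frame u))\<^sup>2 \<le> 2\<^sup>2" using power2_norm_2[of u] by (simp add: power2_norm_2_2)
qed simp

lemma measure_vimage_SL2:
  assumes "B \<in> SL2" and [measurable]: "X \<in> sets borel"
  shows "measure lborel {v. B *v v \<in> X} = measure lborel X" "emeasure lborel {v. B *v v \<in> X} = emeasure lborel X"
proof -
  have "emeasure lborel X = emeasure (distr lborel borel (\<lambda>v. B *v v)) X"
    by (simp only: distr_lborel_SL2[OF assms(1)])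
  also have "\<dots> = emeasure lborel {v. B *v v \<in> X}"
    by (subst emeasure_distr) (auto simp: vimage_def)
  finally show "emeasure lborel {v. B *v v \<in> X} = emeasure lborel X" by simp
  then show "measure lborel {v. B *v v \<in> X} = measure lborel X" by (simp add: measure_def)
qed

context sl2_walk begin

text \<open>Whenever the product sends \<open>u\<close> close to the line of \<open>w\<close>, the regions around these two lines
  overlap in area proportional to \<open>J\<close>, while their areas are of order \<open>J\<close> and the expected overlap
  decays with \<open>m\<close>. The scale \<open>\<delta>\<close> depends on the norm bound only, the probability on \<open>m\<close> only.\<close>
lemma near_direction:
  obtains \<delta> where "0 < \<delta>" and "\<And>n m u w. norm u = 1 \<Longrightarrow> norm w = 1 \<Longrightarrow>
    measure \<Omega> {\<omega> \<in> space \<Omega>. norm (walk n m \<omega>) \<le> M \<and>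
       \<bar>wedge w (walk n m \<omega> *v u)\<bar> \<le> \<delta> * norm (walk n m \<omega> *v u)} \<le> 32 * sqrt (\<rho> ^ m)"
proof -
  obtain p :: nat where p: "4 * \<bar>M\<bar> < 2 ^ p" using real_arch_pow[of 2] by auto
  \<comment> \<open>half of the dyadic pieces survive, so the overlap is at least a 32nd part of the total area \<open>4 J\<close>\<close>
  define J where "J = 2 * (3 * p + 3)"
  have J: "0 < J" "3 * p + 3 \<le> J" by (auto simp: J_def)
  define \<delta> where "\<delta> = 1 / ((2::real) ^ J)\<^sup>2"
  have "measure \<Omega> {\<omega> \<in> space \<Omega>. norm (walk n m \<omega>) \<le> M \<and>
       \<bar>wedge w (walk n m \<omega> *v u)\<bar> \<le> \<delta> * norm (walk n m \<omega> *v u)} \<le> 32 * sqrt (\<rho> ^ m)"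
    if u: "norm u = 1" and w: "norm w = 1" for n m u w
  proof -
    define E where "E = {\<omega> \<in> space \<Omega>. norm (walk n m \<omega>) \<le> M \<and>
       \<bar>wedge w (walk n m \<omega> *v u)\<bar> \<le> \<delta> * norm (walk n m \<omega> *v u)}"
    have Em: "E \<in> sets \<Omega>" unfolding E_def wedge_def by measurable
    define S where "S = {v. adj2 (frame w) *v v \<in> hyp_region J}"
    define T where "T = {v. adj2 (frame u) *v v \<in> hyp_region J}"
    have fu: "frame u \<in> SL2" "frame w \<in> SL2" using u w by (auto intro: frame_SL2)
    have Sb [measurable]: "S \<in> sets borel" "T \<in> sets borel" unfolding S_def T_def by measurable
    have Se: "emeasure lborel S < \<infinity>" "emeasure lborel T < \<infinity>" "measure lborel S \<le> 4 * real J" "measure lborel T \<le> 4 * real J"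
      using hyp_region_size[OF J(1)] unfolding S_def T_def by (simp_all add: measure_vimage_SL2 adj2_SL2 fu)
    define q where "q = real (3 * p + 3) / 4"
    have q: "0 < q" by (simp add: q_def)
    have le: "q * indicator E \<omega> \<le> measure lborel {v \<in> S. adj2 (walk n m \<omega>) *v v \<in> T}"
      if om: "\<omega> \<in> space \<Omega>" for \<omega>
    proof (cases "\<omega> \<in> E")
      case True
      define W where "W = walk n m \<omega>"
      have W: "W \<in> SL2" "norm W \<le> M" "\<bar>wedge w (W *v u)\<bar> \<le> \<delta> * norm (W *v u)"
        using True walk_SL2[OF om] by (auto simp: E_def W_def)
      define B where "B = W ** frame u"
      define Q where "Q = adj2 (frame w) ** B"
      have B: "B \<in> SL2" and Q: "Q \<in> SL2" unfolding Q_def B_def by (intro matrix_mult_SL2 adj2_SL2 fu W)+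
      have "norm Q \<le> norm (frame w) * (norm W * norm (frame u))"
        unfolding Q_def B_def using norm_matrix_matrix_le[of "adj2 (frame w)" "W ** frame u"] norm_matrix_matrix_le[of W "frame u"]
        by (metis (no_types, lifting) norm_adj2 mult_left_mono norm_ge_zero order_trans)
      also have "\<dots> \<le> 2 * (M * 2)"
        using norm_frame[OF u] norm_frame[OF w] W(2) order_trans[OF norm_ge_zero W(2)] by (intro mult_mono) auto
      finally have nQ: "norm Q \<le> 2 ^ p" using p by linarith
      have "Q$2$1 = wedge w (W *v u)"
        by (simp add: Q_def B_def wedge_def matrix_matrix_nth_2 matrix_vector_nth_2 algebra_simps)
      then have "\<bar>Q$2$1\<bar> \<le> \<delta> * norm (W *v u)" using W(3) by simp
      also have "\<delta> * norm (W *v u) \<le> \<delta> * 2 ^ p"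
        unfolding \<delta>_def
      proof (rule mult_left_mono)
        show "norm (W *v u) \<le> 2 ^ p"
        using norm_matrix_vector_le[of W u] W(2) p unfolding u by linarith
      qed simp
      finally have c: "\<bar>Q$2$1\<bar> \<le> 2 ^ p / (2 ^ J)\<^sup>2" by (simp add: \<delta>_def)
      have "{v. B *v v \<in> {v \<in> S. adj2 W *v v \<in> T}} = {v \<in> hyp_region J. Q *v v \<in> hyp_region J}"
      proof -
        have "adj2 (frame w) *v (B *v v) = Q *v v" for v by (simp add: Q_def matrix_vector_mul_assoc)
        moreover have "adj2 (frame u) *v (adj2 W *v (B *v v)) = v" for v
          by (simp add: B_def matrix_vector_mul_assoc[symmetric] adj2_mult_vec W fu)
        ultimately show ?thesis by (auto simp: S_def T_def)
      qed
      moreover have "measure lborel {v. B *v v \<in> {v \<in> S. adj2 W *v v \<in> T}} = measure lborel {v \<in> S. adj2 W *v v \<in> T}"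
        by (rule measure_vimage_SL2[OF B]) measurable
      moreover have "(real J - real (3 * p + 3)) / 4 \<le> measure lborel {v \<in> hyp_region J. Q *v v \<in> hyp_region J}"
        by (rule overlap_lower[OF Q nQ c J(2)])
      moreover have "(real J - real (3 * p + 3)) / 4 = q" by (simp add: J_def q_def)
      ultimately show ?thesis using True by (simp add: W_def)
    qed simp
    have "q * measure \<Omega> E = (\<integral>\<omega>. q * indicator E \<omega> \<partial>\<Omega>)" using Em by simp
    also have "\<dots> \<le> (\<integral>\<omega>. measure lborel {v \<in> S. adj2 (walk n m \<omega>) *v v \<in> T} \<partial>\<Omega>)"
      by (rule integral_mono[OF _ expected_overlap(1)[OF Sb(1) Se(1) Sb(2) Se(2)]])
         (use Em le in \<open>auto intro!: integrable_mult_right integrable_real_indicator simp: P.emeasure_eq_measure\<close>)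
    also have "\<dots> \<le> sqrt (\<rho> ^ m * measure lborel S * measure lborel T)"
      by (rule expected_overlap(2)[OF Sb(1) Se(1) Sb(2) Se(2)])
    also have "\<dots> \<le> sqrt (\<rho> ^ m * (4 * real J) * (4 * real J))"
      using \<rho> Se by (intro real_sqrt_le_mono mult_mono) auto
    also have "\<dots> = sqrt (\<rho> ^ m) * (4 * real J)"
      by (simp add: real_sqrt_mult)
    also have "\<dots> = q * (32 * sqrt (\<rho> ^ m))" by (simp add: J_def q_def)
    finally show ?thesis using q unfolding E_def by simp
  qed
  moreover have "0 < \<delta>" by (simp add: \<delta>_def)
  ultimately show thesis using that by blast
qed

end

section \<open>Uniform expansion of vectors\<close>

text \<open>Choose \<open>w\<close> orthogonal to the longer row of \<open>S\<close>.\<close>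
lemma ex_functional:
  fixes S :: "real^2^2"
  assumes "0 < norm S"
  obtains w :: "real^2" where "norm w = 1" "\<And>v. norm S * \<bar>wedge w v\<bar> \<le> 2 * norm (S *v v)"
proof -
  have "\<exists>i. norm S \<le> 2 * norm (S$i)"
  proof (rule ccontr)
    assume "\<not> ?thesis"
    then have "2 * norm (S$1) < norm S" "2 * norm (S$2) < norm S" by (auto simp: not_le)
    then have "(2 * norm (S$1))\<^sup>2 < (norm S)\<^sup>2" "(2 * norm (S$2))\<^sup>2 < (norm S)\<^sup>2"
      by - (rule power_strict_mono; simp)+
    moreover have "(norm S)\<^sup>2 = (norm (S$1))\<^sup>2 + (norm (S$2))\<^sup>2"
      by (simp add: power2_norm_2_2 power2_norm_2)
    moreover have "0 \<le> (norm (S$1))\<^sup>2" "0 \<le> (norm (S$2))\<^sup>2" by simp_all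
    ultimately show False by (simp add: power_mult_distrib)
  qed
  then obtain i where i: "norm S \<le> 2 * norm (S$i)" by blast
  define r where "r = norm (S$i)"
  have r: "0 < r" using i assms unfolding r_def by linarith
  define w :: "real^2" where "w = vector [- (S$i$2) / r, S$i$1 / r]"
  have "norm w = 1"
  proof (rule power2_eq_imp_eq)
    have "(norm w)\<^sup>2 = (norm (S$i))\<^sup>2 / r\<^sup>2" by (simp add: power2_norm_2 w_def power_divide add_divide_distrib add.commute)
    then show "(norm w)\<^sup>2 = 1\<^sup>2" using r by (simp add: r_def)
  qed auto
  moreover have "norm S * \<bar>wedge w v\<bar> \<le> 2 * norm (S *v v)" for v
  proof -
    have "r * wedge w v = - ((S *v v)$i)"
      using r by (simp add: wedge_def w_def matrix_vector_nth_2 field_simps)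
    then have "r * \<bar>wedge w v\<bar> = \<bar>(S *v v)$i\<bar>" using r by (metis abs_minus abs_mult abs_of_pos)
    also have "\<dots> \<le> norm (S *v v)" by (rule component_le_norm_cart)
    finally have "2 * (r * \<bar>wedge w v\<bar>) \<le> 2 * norm (S *v v)" by simp
    moreover have "norm S * \<bar>wedge w v\<bar> \<le> (2 * r) * \<bar>wedge w v\<bar>"
      using i by (intro mult_right_mono) (auto simp: r_def)
    ultimately show ?thesis by simp
  qed
  ultimately show thesis using that by blast
qed

context sl2_walk begin

text \<open>Write the product as \<open>S W\<close> with \<open>W\<close> its first \<open>m\<close> factors. For fixed \<open>S\<close> the vectors
  contracted far below the norm of \<open>S\<close> lie near one line, and by independence \<open>W u\<close> rarely does.
  Only \<open>W\<close> is constrained, so the estimate is uniform in the total length.\<close>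
lemma rarely_contracting:
  assumes \<eta>: "0 < \<eta>"
  shows "\<exists>\<delta> m. 0 < \<delta> \<and> (\<forall>n k u. norm u = 1 \<longrightarrow> m \<le> k \<longrightarrow>
    measure \<Omega> {\<omega> \<in> space \<Omega>. norm (walk n k \<omega> *v u) < \<delta> * norm (walk n k \<omega>)} \<le> \<eta>)"
proof -
  have "0 < (\<eta> / 64)\<^sup>2" using \<eta> by simp
  then obtain m where m: "\<rho> ^ m < (\<eta> / 64)\<^sup>2" using real_arch_pow_inv \<rho>(2) by blast
  have m': "32 * sqrt (\<rho> ^ m) \<le> \<eta> / 2"
  proof -
    have "sqrt (\<rho> ^ m) \<le> sqrt ((\<eta> / 64)\<^sup>2)" by (rule real_sqrt_le_mono[OF less_imp_le[OF m]])
    then have "sqrt (\<rho> ^ m) \<le> \<eta> / 64" using \<eta> by (simp only: real_sqrt_abs)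
    then show ?thesis by simp
  qed
  define B where "B = ln 2 + real m * (1 + C)"
  have B: "0 < B" using C_nonneg by (auto simp: B_def intro!: add_pos_nonneg)
  define l where "l = 2 * B / \<eta>"
  have l: "0 < l" using B \<eta> by (simp add: l_def)
  define M where "M = exp l"
  have M: "0 < M" by (simp add: M_def)
  obtain \<delta> where \<delta>: "0 < \<delta>" and near: "\<And>n m u w. norm u = 1 \<Longrightarrow> norm w = 1 \<Longrightarrow>
    measure \<Omega> {\<omega> \<in> space \<Omega>. norm (walk n m \<omega>) \<le> M \<and>
       \<bar>wedge w (walk n m \<omega> *v u)\<bar> \<le> \<delta> * norm (walk n m \<omega> *v u)} \<le> 32 * sqrt (\<rho> ^ m)"
    using near_direction[of M] by blast
  \<comment> \<open>one factor \<open>M\<close> for the norm of \<open>W\<close>, the other for the length of \<open>W u\<close>\<close>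
  define \<delta>' where "\<delta>' = \<delta> / (2 * M\<^sup>2)"
  have \<delta>': "0 < \<delta>'" using \<delta> M by (simp add: \<delta>'_def)
  have big: "measure \<Omega> {\<omega> \<in> space \<Omega>. M < norm (walk n m \<omega>)} \<le> \<eta> / 2" for n
  proof -
    define G where "G = {\<omega> \<in> space \<Omega>. M < norm (walk n m \<omega>)}"
    have G: "G \<in> sets \<Omega>" unfolding G_def by measurable
    have "l * measure \<Omega> G = (\<integral>\<omega>. l * indicator G \<omega> \<partial>\<Omega>)" using G by simp
    also have "\<dots> \<le> (\<integral>\<omega>. log_norm n m \<omega> \<partial>\<Omega>)"
    proof (rule integral_mono[OF _ walk_norm_int(1)])
      show "integrable \<Omega> (\<lambda>\<omega>. l * indicator G \<omega>)" using G by (auto simp: P.emeasure_eq_measure)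
      fix \<omega> assume om: "\<omega> \<in> space \<Omega>"
      show "l * indicator G \<omega> \<le> log_norm n m \<omega>"
      proof (cases "\<omega> \<in> G")
        case True
        then have "M \<le> norm (walk n m \<omega>)" by (simp add: G_def)
        then have "ln M \<le> log_norm n m \<omega>" using M by (subst ln_le_cancel_iff) auto
        then show ?thesis using True by (simp add: M_def)
      qed (use ln_norm_SL2_nonneg[OF walk_SL2[OF om]] in simp)
    qed
    also have "\<dots> \<le> B" unfolding B_def by (rule walk_norm_int(2))
    finally have "measure \<Omega> G \<le> B / l" using l by (simp add: field_simps)
    also have "B / l = \<eta> / 2" using B \<eta> by (simp add: l_def)
    finally show ?thesis by (simp add: G_def)
  qed
  have main: "measure \<Omega> {\<omega> \<in> space \<Omega>. norm (walk n k \<omega> *v u) < \<delta>' * norm (walk n k \<omega>)} \<le> \<eta>"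
    if u: "norm u = 1" and k: "m \<le> k" for n k u
  proof -
    define E where "E = {\<omega> \<in> space \<Omega>. norm (walk n k \<omega> *v u) < \<delta>' * norm (walk n k \<omega>)}"
    have Em: "E \<in> sets \<Omega>" unfolding E_def by measurable
    have iE: "integrable \<Omega> (indicator E :: _ \<Rightarrow> real)" using Em by (auto simp: P.emeasure_eq_measure)
    have walk_split: "walk n k \<omega> = walk (n + m) (k - m) \<omega> ** walk n m \<omega>" for \<omega>
      using walk_add[of n m "k - m" \<omega>] k by simp
    have inner: "(\<integral>\<omega>. indicator E (splice (n + m) \<omega> \<omega>') \<partial>\<Omega>) \<le> \<eta>" if om': "\<omega>' \<in> space \<Omega>" for \<omega>'
    proof -
      define S where "S = walk (n + m) (k - m) \<omega>'"
      have S: "S \<in> SL2" unfolding S_def by (rule walk_SL2[OF om'])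
      then have Sp: "0 < norm S" using norm_SL2_ge_1[OF S] by linarith
      obtain w where w: "norm w = 1" "\<And>v. norm S * \<bar>wedge w v\<bar> \<le> 2 * norm (S *v v)"
        using ex_functional[OF Sp] by blast
      define E1 where "E1 = {\<omega> \<in> space \<Omega>. M < norm (walk n m \<omega>)}"
      define E2 where "E2 = {\<omega> \<in> space \<Omega>. norm (walk n m \<omega>) \<le> M \<and>
         \<bar>wedge w (walk n m \<omega> *v u)\<bar> \<le> \<delta> * norm (walk n m \<omega> *v u)}"
      have Es: "E1 \<in> sets \<Omega>" "E2 \<in> sets \<Omega>" unfolding E1_def E2_def wedge_def by measurable
      have sub: "indicator E (splice (n + m) \<omega> \<omega>') \<le> (indicator (E1 \<union> E2) \<omega> :: real)" if om: "\<omega> \<in> space \<Omega>" for \<omega>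
      proof (cases "splice (n + m) \<omega> \<omega>' \<in> E")
        case True
        define W where "W = walk n m \<omega>"
        have W: "W \<in> SL2" unfolding W_def by (rule walk_SL2[OF om])
        have "walk n k (splice (n + m) \<omega> \<omega>') = S ** W"
          by (simp add: walk_split walk_splice_past walk_splice_future S_def W_def)
        then have lt: "norm (S *v (W *v u)) < \<delta>' * norm (S ** W)"
          using True by (simp add: E_def matrix_vector_mul_assoc)
        have "\<omega> \<in> E1 \<union> E2"
        proof (rule ccontr)
          assume "\<omega> \<notin> E1 \<union> E2"
          then have nW: "norm W \<le> M" and nw: "\<delta> * norm (W *v u) < \<bar>wedge w (W *v u)\<bar>"
            using om by (auto simp: E1_def E2_def W_def)
          have ge: "1 \<le> M * norm (W *v u)"
          proof -
            have "1 \<le> norm W * norm (W *v u)" using norm_le_SL2_vec[OF W, of u] u by simp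
            also have "\<dots> \<le> M * norm (W *v u)" using nW by (intro mult_right_mono) auto
            finally show ?thesis .
          qed
          have "\<delta> * norm (S ** W) \<le> \<delta> * (norm S * M) * 1"
            using \<delta> norm_matrix_matrix_le[of S W] nW mult_left_mono[OF nW norm_ge_zero[of S]] by simp
          also have "\<dots> \<le> \<delta> * (norm S * M) * (M * norm (W *v u))"
            using ge \<delta> M by (intro mult_left_mono) auto
          also have "\<dots> = M\<^sup>2 * (norm S * (\<delta> * norm (W *v u)))" by (simp add: power2_eq_square)
          also have "\<dots> \<le> M\<^sup>2 * (norm S * \<bar>wedge w (W *v u)\<bar>)"
            using nw by (intro mult_left_mono) auto
          also have "\<dots> \<le> M\<^sup>2 * (2 * norm (S *v (W *v u)))"
            by (intro mult_left_mono w) auto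
          finally have "\<delta>' * norm (S ** W) \<le> norm (S *v (W *v u))"
            using M by (simp add: \<delta>'_def field_simps)
          with lt show False by simp
        qed
        then show ?thesis by simp
      qed simp
      have "(\<integral>\<omega>. indicator E (splice (n + m) \<omega> \<omega>') \<partial>\<Omega>) \<le> (\<integral>\<omega>. (indicator (E1 \<union> E2) \<omega> :: real) \<partial>\<Omega>)"
      proof (rule integral_mono)
        have [measurable]: "(\<lambda>\<omega>. splice (n + m) \<omega> \<omega>') \<in> measurable \<Omega> \<Omega>"
          using measurable_compose[OF measurable_Pair[OF measurable_ident_sets[OF refl] measurable_const[OF om']] splice_meas, of "n + m"]
          by simp
        show "integrable \<Omega> (\<lambda>\<omega>. indicator E (splice (n + m) \<omega> \<omega>') :: real)"
          by (rule P.integrable_const_bound[of _ 1]) (use Em in auto)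
        show "integrable \<Omega> (indicator (E1 \<union> E2) :: _ \<Rightarrow> real)" using Es by (auto simp: P.emeasure_eq_measure)
      qed (rule sub)
      also have "\<dots> = measure \<Omega> (E1 \<union> E2)" using Es by simp
      also have "\<dots> \<le> measure \<Omega> E1 + measure \<Omega> E2" by (rule measure_Un_le[OF Es])
      also have "\<dots> \<le> \<eta>" using big[of n] near[OF u w(1), of n m] m' unfolding E1_def E2_def by linarith
      finally show ?thesis .
    qed
    have "measure \<Omega> E = (\<integral>\<omega>. indicator E \<omega> \<partial>\<Omega>)" using Em by simp
    also have "\<dots> = (\<integral>\<omega>'. \<integral>\<omega>. indicator E (splice (n + m) \<omega> \<omega>') \<partial>\<Omega> \<partial>\<Omega>)"
      by (rule splice_integral(2)[OF iE])
    also have "\<dots> \<le> (\<integral>\<omega>'. \<eta> \<partial>\<Omega>)"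
    proof (rule integral_mono)
      show "integrable \<Omega> (\<lambda>\<omega>'. \<integral>\<omega>. indicator E (splice (n + m) \<omega> \<omega>') \<partial>\<Omega> :: real)"
        by (rule PP.integrable_snd[OF splice_integrable[OF iE, of "n + m"]])
    qed (use inner in auto)
    also have "\<dots> = \<eta>" using P.prob_space by simp
    finally show ?thesis by (simp add: E_def)
  qed
  with \<delta>' show ?thesis by (intro exI[of _ \<delta>'] exI[of _ m]) simp
qed

text \<open>Outside the rare event the two logarithms differ by a constant. On the rare event the difference
  is at most twice the sum of the logarithmic norms of the factors. Truncating each of them at a
  level \<open>H\<close>, in the form \<open>x \<le> H + x\<^sup>2 / H\<close>, bounds its contribution by \<open>H \<eta> + C / H\<close>, which is as
  small as desired for \<open>H\<close> large and then \<open>\<eta>\<close> small.\<close>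
lemma uniform_expansion:
  assumes \<epsilon>: "0 < \<epsilon>"
  shows "\<exists>R\<ge>0. \<forall>n k u. norm u = 1 \<longrightarrow>
    (\<integral>\<omega>. log_norm n k \<omega> \<partial>\<Omega>) - (\<epsilon> * real k + R) \<le> (\<integral>\<omega>. log_stretch n k u \<omega> \<partial>\<Omega>)"
proof -
  define H where "H = 4 * (C + 1) / \<epsilon>"
  have H: "0 < H" using C_nonneg \<epsilon> by (simp add: H_def)
  define \<eta> where "\<eta> = \<epsilon> / (4 * H)"
  have \<eta>: "0 < \<eta>" using \<epsilon> H by (simp add: \<eta>_def)
  from rarely_contracting[OF \<eta>] obtain \<delta> m where rc: "0 < \<delta> \<and> (\<forall>n k u. norm u = 1 \<longrightarrow> m \<le> k \<longrightarrow>
    measure \<Omega> {\<omega> \<in> space \<Omega>. norm (walk n k \<omega> *v u) < \<delta> * norm (walk n k \<omega>)} \<le> \<eta>)"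
    by (elim exE)
  note \<delta> = rc[THEN conjunct1] and rare = rc[THEN conjunct2, rule_format]
  define R where "R = \<bar>ln \<delta>\<bar> + ln 2 + 2 * real m * (1 + C)"
  have R: "0 \<le> R" using C_nonneg by (simp add: R_def)
  have "(\<integral>\<omega>. log_norm n k \<omega> \<partial>\<Omega>) - (\<integral>\<omega>. log_stretch n k u \<omega> \<partial>\<Omega>) \<le> \<epsilon> * real k + R"
    if u: "norm u = 1" for n k u
  proof -
    note i = walk_norm_int(1)[of n k] walk_vec_int(1)[OF u, of n k]
    have Y: "log_norm n k \<omega> - log_stretch n k u \<omega> \<le> ln 2 + 2 * log_norm_sum n k \<omega>"
      if "\<omega> \<in> space \<Omega>" for \<omega>
      using ln_walk_norm_le[OF that, of n k] abs_ln_walk_vec_le[OF that u, of n k] by linarith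
    have eq: "(\<integral>\<omega>. log_norm n k \<omega> \<partial>\<Omega>) - (\<integral>\<omega>. log_stretch n k u \<omega> \<partial>\<Omega>)
       = (\<integral>\<omega>. log_norm n k \<omega> - log_stretch n k u \<omega> \<partial>\<Omega>)"
      using i by simp
    show ?thesis
    proof (cases "m \<le> k")
      case False
      have "(\<integral>\<omega>. log_norm n k \<omega> - log_stretch n k u \<omega> \<partial>\<Omega>) \<le> (\<integral>\<omega>. ln 2 + 2 * log_norm_sum n k \<omega> \<partial>\<Omega>)"
        by (rule integral_mono) (use i log_norm_sum_int Y in auto)
      also have "\<dots> = ln 2 + 2 * (\<integral>\<omega>. log_norm_sum n k \<omega> \<partial>\<Omega>)"
        using log_norm_sum_int(1) P.prob_space by simp
      also have "\<dots> \<le> ln 2 + 2 * (real k * (1 + C))" using log_norm_sum_int(2)[of n k] by simp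
      also have "\<dots> \<le> ln 2 + 2 * (real m * (1 + C))"
        using False C_nonneg by (intro add_left_mono mult_left_mono mult_right_mono) auto
      also have "\<dots> \<le> \<epsilon> * real k + R" using \<epsilon> by (simp add: R_def)
      finally show ?thesis unfolding eq .
    next
      case True
      define E where "E = {\<omega> \<in> space \<Omega>. norm (walk n k \<omega> *v u) < \<delta> * norm (walk n k \<omega>)}"
      have Em: "E \<in> sets \<Omega>" unfolding E_def by measurable
      define Z where "Z \<omega> = (\<Sum>i<k. H * indicator E \<omega> + (ln (norm (\<omega> (Suc (n + i)))))\<^sup>2 / H)" for \<omega>
      have iZ: "integrable \<Omega> (\<lambda>\<omega>. H * indicator E \<omega> + (ln (norm (\<omega> (Suc (n + i)))))\<^sup>2 / H)" for i
        using Em component_sq(1)[of "Suc (n + i)"] by (auto simp: P.emeasure_eq_measure)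
      have iZ': "integrable \<Omega> Z" unfolding Z_def by (intro Bochner_Integration.integrable_sum iZ)
      have Zle: "(\<integral>\<omega>. Z \<omega> \<partial>\<Omega>) \<le> real k * (\<epsilon> / 2)"
      proof -
        have "(\<integral>\<omega>. Z \<omega> \<partial>\<Omega>) = (\<Sum>i<k. \<integral>\<omega>. H * indicator E \<omega> + (ln (norm (\<omega> (Suc (n + i)))))\<^sup>2 / H \<partial>\<Omega>)"
          unfolding Z_def by (rule Bochner_Integration.integral_sum) (rule iZ)
        also have "\<dots> \<le> (\<Sum>i<k. \<epsilon> / 2)"
        proof (rule sum_mono)
          fix i
          have "(\<integral>\<omega>. H * indicator E \<omega> + (ln (norm (\<omega> (Suc (n + i)))))\<^sup>2 / H \<partial>\<Omega>)
            = H * measure \<Omega> E + (\<integral>\<omega>. (ln (norm (\<omega> (Suc (n + i)))))\<^sup>2 \<partial>\<Omega>) / H"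
            using Em component_sq(1)[of "Suc (n + i)"]
            by (subst Bochner_Integration.integral_add) (auto simp: P.emeasure_eq_measure)
          also have "\<dots> \<le> H * \<eta> + C / H"
            using rare[OF u True, of n] component_sq(2)[of "Suc (n + i)"] H
            by (intro add_mono mult_left_mono divide_right_mono) (auto simp: E_def)
          also have "H * \<eta> = \<epsilon> / 4" using H by (simp add: \<eta>_def)
          also have "C / H \<le> \<epsilon> / 4"
          proof -
            have "C * \<epsilon> / (4 * (C + 1)) \<le> (C + 1) * \<epsilon> / (4 * (C + 1))"
              using C_nonneg \<epsilon> by (intro divide_right_mono mult_right_mono) auto
            also have "\<dots> = \<epsilon> / 4"
            proof -
              have "x * \<epsilon> / (4 * x) = \<epsilon> / 4" if "0 < x" for x :: real using that by simp
              then show ?thesis using C_nonneg by (metis add_nonneg_pos zero_less_one)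
            qed
            finally show ?thesis by (simp add: H_def)
          qed
          finally show "(\<integral>\<omega>. H * indicator E \<omega> + (ln (norm (\<omega> (Suc (n + i)))))\<^sup>2 / H \<partial>\<Omega>) \<le> \<epsilon> / 2" by simp
        qed
        finally show ?thesis by simp
      qed
      have "(\<integral>\<omega>. log_norm n k \<omega> - log_stretch n k u \<omega> \<partial>\<Omega>) \<le> (\<integral>\<omega>. (\<bar>ln \<delta>\<bar> + ln 2) + 2 * Z \<omega> \<partial>\<Omega>)"
      proof (rule integral_mono)
        show "integrable \<Omega> (\<lambda>\<omega>. log_norm n k \<omega> - log_stretch n k u \<omega>)" using i by simp
        show "integrable \<Omega> (\<lambda>\<omega>. (\<bar>ln \<delta>\<bar> + ln 2) + 2 * Z \<omega>)" using iZ' by simp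
        fix \<omega> assume om: "\<omega> \<in> space \<Omega>"
        show "log_norm n k \<omega> - log_stretch n k u \<omega> \<le> (\<bar>ln \<delta>\<bar> + ln 2) + 2 * Z \<omega>"
        proof (cases "\<omega> \<in> E")
          case True
          have "log_norm_sum n k \<omega> \<le> Z \<omega>"
            unfolding log_norm_sum_def Z_def
          proof (rule sum_mono)
            fix i
            define x where "x = ln (norm (\<omega> (Suc (n + i))))"
            have "0 \<le> (x - H)\<^sup>2 + x * H"
              unfolding x_def using H by (intro add_nonneg_nonneg mult_nonneg_nonneg ln_norm_SL2_nonneg component_SL2[OF om]) auto
            then have "x * H \<le> H * H + x\<^sup>2" by (simp add: power2_eq_square algebra_simps)
            then have "x \<le> H + x\<^sup>2 / H" using H by (simp add: field_simps power2_eq_square)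
            then show "ln (norm (\<omega> (Suc (n + i)))) \<le> H * indicator E \<omega> + (ln (norm (\<omega> (Suc (n + i)))))\<^sup>2 / H"
              using True by (simp add: x_def)
          qed
          then show ?thesis using Y[OF om] by linarith
        next
          case False
          then have "\<delta> * norm (walk n k \<omega>) \<le> norm (walk n k \<omega> *v u)" using om by (auto simp: E_def)
          then have "ln (\<delta> * norm (walk n k \<omega>)) \<le> log_stretch n k u \<omega>"
            using \<delta> walk_norm_pos[OF om, of n k] walk_vec_pos[OF om u, of n k] by (subst ln_le_cancel_iff) auto
          then have "ln \<delta> + log_norm n k \<omega> \<le> log_stretch n k u \<omega>"
            using \<delta> walk_norm_pos[OF om, of n k] by (simp add: ln_mult)
          moreover have "0 \<le> Z \<omega>" unfolding Z_def using H by (intro sum_nonneg) auto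
          moreover have "0 \<le> ln (2::real)" by simp
          ultimately show ?thesis by linarith
        qed
      qed
      also have "\<dots> = (\<bar>ln \<delta>\<bar> + ln 2) + 2 * (\<integral>\<omega>. Z \<omega> \<partial>\<Omega>)" using iZ' P.prob_space by simp
      also have "\<dots> \<le> \<epsilon> * real k + R"
      proof -
        have "0 \<le> 2 * real m * (1 + C)" using C_nonneg by simp
        then show ?thesis using Zle by (simp add: R_def algebra_simps)
      qed
      finally show ?thesis unfolding eq .
    qed
  qed
  with R show ?thesis by (intro exI[of _ R]) (simp add: algebra_simps)
qed

end

section \<open>A strong law for orthogonal sequences\<close>

lemma AE_tendsto_zero_of_summable:
  fixes f :: "nat \<Rightarrow> 'a \<Rightarrow> real"
  assumes i: "\<And>q. integrable M (f q)" and nn: "\<And>q x. 0 \<le> f q x"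
    and le: "\<And>q. (\<integral>x. f q x \<partial>M) \<le> c q" and sm: "summable c"
  shows "AE x in M. (\<lambda>q. f q x) \<longlonglongrightarrow> 0"
proof -
  have [measurable]: "f q \<in> borel_measurable M" for q using i by simp
  have c: "0 \<le> c q" for q
    using le[of q] Bochner_Integration.integral_nonneg[of M "f q"] nn by (meson order_trans)
  have "(\<integral>\<^sup>+x. (\<Sum>q. ennreal (f q x)) \<partial>M) = (\<Sum>q. \<integral>\<^sup>+x. ennreal (f q x) \<partial>M)"
    by (rule nn_integral_suminf) measurable
  also have "\<dots> \<le> (\<Sum>q. ennreal (c q))"
  proof (rule suminf_le)
    show "(\<integral>\<^sup>+x. ennreal (f q x) \<partial>M) \<le> ennreal (c q)" for q
      using nn_integral_eq_integral[OF i[of q]] nn le[of q] by (simp add: ennreal_leI)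
  qed auto
  also have "\<dots> = ennreal (suminf c)" by (rule suminf_ennreal2[OF c sm])
  finally have "(\<integral>\<^sup>+x. (\<Sum>q. ennreal (f q x)) \<partial>M) \<noteq> \<infinity>"
    by (auto simp: top_unique)
  then have "AE x in M. (\<Sum>q. ennreal (f q x)) \<noteq> \<infinity>"
    by (intro nn_integral_PInf_AE) auto
  then show ?thesis
  proof eventually_elim
    case (elim x)
    then have "summable (\<lambda>q. f q x)" by (intro summable_suminf_not_top nn) auto
    then show ?case by (rule summable_LIMSEQ_zero)
  qed
qed

lemma summable_inverse_square: "summable (\<lambda>q. B / (real (Suc q))\<^sup>2)"
proof -
  have "summable (\<lambda>n. inverse (real n ^ 2))" by (rule inverse_power_summable) simp
  then have "summable (\<lambda>q. B * inverse (real (Suc q) ^ 2))"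
    by (intro summable_mult) (subst summable_Suc_iff)
  then show ?thesis by (simp add: divide_inverse)
qed

lemma tendsto_zero_of_square: "(\<lambda>q. (g q)\<^sup>2) \<longlonglongrightarrow> 0 \<Longrightarrow> g \<longlonglongrightarrow> (0::real)"
proof -
  assume "(\<lambda>q. (g q)\<^sup>2) \<longlonglongrightarrow> 0"
  then have "(\<lambda>q. sqrt ((g q)\<^sup>2)) \<longlonglongrightarrow> sqrt 0" by (rule tendsto_real_sqrt)
  then have "(\<lambda>q. \<bar>g q\<bar>) \<longlonglongrightarrow> 0" by simp
  then show "g \<longlonglongrightarrow> 0" by (simp add: tendsto_rabs_zero_iff)
qed

text \<open>Orthogonality makes the second moment of the sums grow linearly, so the averages converge along
  the squares. Between consecutive squares the sum of the absolute values is negligible, as there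
  are only about \<open>2 q\<close> terms after the first \<open>q\<^sup>2\<close>.\<close>
lemma orthogonal_strong_law:
  fixes D :: "nat \<Rightarrow> 'a \<Rightarrow> real"
  assumes [measurable]: "\<And>j. D j \<in> borel_measurable M"
    and D2: "\<And>j. integrable M (\<lambda>x. (D j x)\<^sup>2)" "\<And>j. (\<integral>x. (D j x)\<^sup>2 \<partial>M) \<le> B"
    and orth: "\<And>i j. i < j \<Longrightarrow> (\<integral>x. D i x * D j x \<partial>M) = 0"
  shows "AE x in M. (\<lambda>N. (\<Sum>j<N. D j x) / real N) \<longlonglongrightarrow> 0"
proof -
  have DD: "integrable M (\<lambda>x. D i x * D j x)" for i j
    by (rule Cauchy_Schwarz_integral(1)) (auto intro: D2)
  have orth': "(\<integral>x. D i x * D j x \<partial>M) = (if i = j then (\<integral>x. (D i x)\<^sup>2 \<partial>M) else 0)" for i j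
  proof (cases "i = j")
    case True then show ?thesis by (simp add: power2_eq_square)
  next
    case False
    then consider "i < j" | "j < i" by linarith
    then show ?thesis using orth[of i j] orth[of j i] False by cases (auto simp: mult.commute)
  qed
  define S where "S N x = (\<Sum>j<N. D j x)" for N x
  have B: "0 \<le> B"
  proof -
    have "0 \<le> (\<integral>x. (D 0 x)\<^sup>2 \<partial>M)" by simp
    with D2(2)[of 0] show ?thesis by linarith
  qed
  have S2: "integrable M (\<lambda>x. (S N x)\<^sup>2)" "(\<integral>x. (S N x)\<^sup>2 \<partial>M) \<le> real N * B" for N
  proof -
    have eq: "(S N x)\<^sup>2 = (\<Sum>i<N. \<Sum>j<N. D i x * D j x)" for x
      by (simp add: S_def power2_eq_square sum_product)
    show "integrable M (\<lambda>x. (S N x)\<^sup>2)"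
      unfolding eq by (intro Bochner_Integration.integrable_sum DD)
    have "(\<integral>x. (S N x)\<^sup>2 \<partial>M) = (\<Sum>i<N. \<Sum>j<N. \<integral>x. D i x * D j x \<partial>M)"
      unfolding eq by (subst Bochner_Integration.integral_sum, intro Bochner_Integration.integrable_sum DD,
        subst Bochner_Integration.integral_sum) (auto intro: DD)
    also have "\<dots> = (\<Sum>i<N. \<integral>x. (D i x)\<^sup>2 \<partial>M)" by (simp add: orth')
    also have "\<dots> \<le> (\<Sum>i<N. B)" by (intro sum_mono D2)
    finally show "(\<integral>x. (S N x)\<^sup>2 \<partial>M) \<le> real N * B" by simp
  qed
  define V where "V q x = (\<Sum>j\<in>{q\<^sup>2..<(Suc q)\<^sup>2}. \<bar>D j x\<bar>)" for q x
  have card: "card {q\<^sup>2..<(Suc q)\<^sup>2} = 2 * q + 1" for q :: nat by (simp add: power2_eq_square)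
  have V2: "integrable M (\<lambda>x. (V q x)\<^sup>2)" "(\<integral>x. (V q x)\<^sup>2 \<partial>M) \<le> (real (2 * q + 1))\<^sup>2 * B" for q
  proof -
    let ?I = "{q\<^sup>2..<(Suc q)\<^sup>2}"
    have bnd: "(V q x)\<^sup>2 \<le> real (2 * q + 1) * (\<Sum>j\<in>?I. (D j x)\<^sup>2)" for x
      using Cauchy_Schwarz_ineq_sum[of "\<lambda>_. 1" "\<lambda>j. \<bar>D j x\<bar>" ?I]
      unfolding V_def by (simp only: power_one sum_constant card mult_1 mult_1_right power2_abs)
    have i: "integrable M (\<lambda>x. real (2 * q + 1) * (\<Sum>j\<in>?I. (D j x)\<^sup>2))"
      by (intro integrable_mult_right Bochner_Integration.integrable_sum D2)
    show *: "integrable M (\<lambda>x. (V q x)\<^sup>2)"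
      by (rule Bochner_Integration.integrable_bound[OF i]) (use bnd in \<open>auto simp: V_def intro: order_trans[OF _ abs_ge_self]\<close>)
    have "(\<integral>x. (V q x)\<^sup>2 \<partial>M) \<le> (\<integral>x. real (2 * q + 1) * (\<Sum>j\<in>?I. (D j x)\<^sup>2) \<partial>M)"
      by (rule integral_mono[OF * i]) (rule bnd)
    also have "\<dots> = real (2 * q + 1) * (\<Sum>j\<in>?I. \<integral>x. (D j x)\<^sup>2 \<partial>M)"
      by (subst integral_mult_right_zero, subst Bochner_Integration.integral_sum) (auto intro: D2)
    also have "\<dots> \<le> real (2 * q + 1) * (\<Sum>j\<in>?I. B)" by (intro mult_left_mono sum_mono D2) auto
    also have "\<dots> = (real (2 * q + 1))\<^sup>2 * B" by (simp only: sum_constant card) (simp add: power2_eq_square)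
    finally show "(\<integral>x. (V q x)\<^sup>2 \<partial>M) \<le> (real (2 * q + 1))\<^sup>2 * B" .
  qed
  have ae1: "AE x in M. (\<lambda>q. (S ((Suc q)\<^sup>2) x / (real (Suc q))\<^sup>2)\<^sup>2) \<longlonglongrightarrow> 0"
  proof (rule AE_tendsto_zero_of_summable[OF _ _ _ summable_inverse_square[of B]])
    fix q
    show "integrable M (\<lambda>x. (S ((Suc q)\<^sup>2) x / (real (Suc q))\<^sup>2)\<^sup>2)"
      unfolding power_divide by (intro integrable_divide S2)
    have "(\<integral>x. (S ((Suc q)\<^sup>2) x / (real (Suc q))\<^sup>2)\<^sup>2 \<partial>M) = (\<integral>x. (S ((Suc q)\<^sup>2) x)\<^sup>2 \<partial>M) / ((real (Suc q))\<^sup>2)\<^sup>2"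
      by (simp add: power_divide)
    also have "\<dots> \<le> real ((Suc q)\<^sup>2) * B / ((real (Suc q))\<^sup>2)\<^sup>2"
      by (intro divide_right_mono S2) simp
    also have "\<dots> = B / (real (Suc q))\<^sup>2"
    proof -
      have "x\<^sup>2 * B / (x\<^sup>2)\<^sup>2 = B / x\<^sup>2" if "x \<noteq> 0" for x :: real using that by (simp add: power2_eq_square)
      then show ?thesis by (metis of_nat_eq_0_iff nat.distinct(1) of_nat_power)
    qed
    finally show "(\<integral>x. (S ((Suc q)\<^sup>2) x / (real (Suc q))\<^sup>2)\<^sup>2 \<partial>M) \<le> B / (real (Suc q))\<^sup>2" .
  qed simp
  have ae2: "AE x in M. (\<lambda>q. (V (Suc q) x / (real (Suc q))\<^sup>2)\<^sup>2) \<longlonglongrightarrow> 0"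
  proof (rule AE_tendsto_zero_of_summable[OF _ _ _ summable_inverse_square[of "9 * B"]])
    fix q
    show "integrable M (\<lambda>x. (V (Suc q) x / (real (Suc q))\<^sup>2)\<^sup>2)"
      unfolding power_divide by (intro integrable_divide V2)
    define x where "x = real (Suc q)"
    have x: "1 \<le> x" by (simp add: x_def)
    have "(\<integral>y. (V (Suc q) y / x\<^sup>2)\<^sup>2 \<partial>M) = (\<integral>y. (V (Suc q) y)\<^sup>2 \<partial>M) / (x\<^sup>2)\<^sup>2"
      by (simp add: power_divide)
    also have "\<dots> \<le> ((real (2 * Suc q + 1))\<^sup>2 * B) / (x\<^sup>2)\<^sup>2"
      by (intro divide_right_mono V2) simp
    also have "\<dots> \<le> ((3 * x)\<^sup>2 * B) / (x\<^sup>2)\<^sup>2"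
      using B by (intro divide_right_mono mult_right_mono power_mono) (auto simp: x_def)
    also have "\<dots> = 9 * B / x\<^sup>2" using x by (simp add: power2_eq_square)
    finally show "(\<integral>y. (V (Suc q) y / (real (Suc q))\<^sup>2)\<^sup>2 \<partial>M) \<le> 9 * B / (real (Suc q))\<^sup>2" by (simp add: x_def)
  qed simp
  from ae1 ae2 show ?thesis
  proof eventually_elim
    case (elim x)
    define a where "a q = \<bar>S (q\<^sup>2) x / (real q)\<^sup>2\<bar> + \<bar>V q x / (real q)\<^sup>2\<bar>" for q
    have "(\<lambda>q. a (Suc q)) \<longlonglongrightarrow> \<bar>0\<bar> + \<bar>0\<bar>"
      unfolding a_def
      by (intro tendsto_add tendsto_rabs tendsto_zero_of_square[OF elim(1)] tendsto_zero_of_square[OF elim(2)])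
    then have a: "a \<longlonglongrightarrow> 0" by (simp add: filterlim_sequentially_Suc[of a])
    \<comment> \<open>\<open>N\<close> lies between the square of \<open>q N\<close> and the next square\<close>
    define q where "q N = nat \<lfloor>sqrt (real N)\<rfloor>" for N
    have qtop: "filterlim q at_top sequentially" unfolding q_def
      by (intro filterlim_compose[OF filterlim_nat_sequentially] filterlim_compose[OF filterlim_floor_sequentially]
        filterlim_compose[OF sqrt_at_top] filterlim_real_sequentially)
    have "(\<lambda>N. a (q N)) \<longlonglongrightarrow> 0" by (rule filterlim_compose[OF a qtop])
    moreover have "eventually (\<lambda>N. norm (S N x / real N) \<le> a (q N)) sequentially"
      using eventually_ge_at_top[of 1]
    proof eventually_elim
      case (elim N)
      have sq: "real (q N) \<le> sqrt (real N)" "sqrt (real N) < real (q N) + 1" "1 \<le> q N"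
        using elim by (auto simp: q_def le_nat_iff intro: floor_correct)
      have l: "(q N)\<^sup>2 \<le> N"
      proof -
        have "(real (q N))\<^sup>2 \<le> (sqrt (real N))\<^sup>2" using sq by (intro power_mono) auto
        then show ?thesis by (simp flip: of_nat_power)
      qed
      have u: "N < (Suc (q N))\<^sup>2"
      proof -
        have "(sqrt (real N))\<^sup>2 < (real (q N) + 1)\<^sup>2" using sq by (intro power_strict_mono) auto
        then have "real N < (real (Suc (q N)))\<^sup>2" by (simp add: add.commute)
        then show ?thesis by (simp only: of_nat_power[symmetric] of_nat_less_iff)
      qed
      have "S N x = S ((q N)\<^sup>2) x + (\<Sum>j\<in>{(q N)\<^sup>2..<N}. D j x)"
        unfolding S_def lessThan_atLeast0 using l by (simp add: sum.atLeastLessThan_concat)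
      then have "\<bar>S N x\<bar> \<le> \<bar>S ((q N)\<^sup>2) x\<bar> + \<bar>\<Sum>j\<in>{(q N)\<^sup>2..<N}. D j x\<bar>" by linarith
      also have "\<bar>\<Sum>j\<in>{(q N)\<^sup>2..<N}. D j x\<bar> \<le> (\<Sum>j\<in>{(q N)\<^sup>2..<N}. \<bar>D j x\<bar>)" by (rule sum_abs)
      also have "\<dots> \<le> V (q N) x" unfolding V_def using u by (intro sum_mono2) auto
      finally have s: "\<bar>S N x\<bar> \<le> \<bar>S ((q N)\<^sup>2) x\<bar> + V (q N) x" by simp
      have V0: "0 \<le> V (q N) x" unfolding V_def by (intro sum_nonneg) auto
      have qq: "0 < (real (q N))\<^sup>2" "(real (q N))\<^sup>2 \<le> real N"
        using sq(3) l by (auto simp flip: of_nat_power)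
      have "norm (S N x / real N) \<le> (\<bar>S ((q N)\<^sup>2) x\<bar> + V (q N) x) / real N"
        using s by (simp add: divide_right_mono)
      also have "\<dots> \<le> (\<bar>S ((q N)\<^sup>2) x\<bar> + V (q N) x) / (real (q N))\<^sup>2"
        using qq V0 order.strict_trans2[OF qq] by (intro divide_left_mono mult_pos_pos) auto
      also have "\<dots> = a (q N)" using V0 by (simp add: a_def add_divide_distrib)
      finally show ?case .
    qed
    ultimately have "(\<lambda>N. S N x / real N) \<longlonglongrightarrow> 0" by (rule Lim_null_comparison[rotated])
    then show ?case by (simp add: S_def)
  qed
qed

section \<open>The law of large numbers for the norm\<close>

context sl2_walk begin

definition mean_log :: "nat \<Rightarrow> nat \<Rightarrow> real" where
  "mean_log n k = (\<integral>\<omega>. log_norm n k \<omega> \<partial>\<Omega>)"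

definition drift :: "nat \<Rightarrow> nat \<Rightarrow> real^2 \<Rightarrow> real" where
  "drift n k v = (\<integral>\<omega>. log_stretch n k v \<omega> \<partial>\<Omega>)"

definition heading :: "real^2 \<Rightarrow> nat \<Rightarrow> (nat \<Rightarrow> real^2^2) \<Rightarrow> real^2" where
  "heading u n \<omega> = sgn (walk 0 n \<omega> *v u)"

lemma heading_meas [measurable]: "heading u n \<in> measurable \<Omega> borel"
  unfolding heading_def[abs_def] by measurable

lemma norm_heading: "\<omega> \<in> space \<Omega> \<Longrightarrow> norm u = 1 \<Longrightarrow> norm (heading u n \<omega>) = 1"
  using walk_vec_pos[of \<omega> u 0 n] by (auto simp: heading_def norm_sgn)

lemma drift_meas [measurable]: "drift n k \<in> borel_measurable borel"
proof -
  have "(\<lambda>(v, \<omega>). log_stretch n k v \<omega>) \<in> borel_measurable (borel \<Otimes>\<^sub>M \<Omega>)"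
    unfolding split_beta' by measurable
  then show ?thesis unfolding drift_def[abs_def] by (rule P.borel_measurable_lebesgue_integral)
qed

lemma drift_le: "norm v = 1 \<Longrightarrow> drift n k v \<le> mean_log n k"
  unfolding drift_def mean_log_def
  by (rule integral_mono[OF walk_vec_int(1) walk_norm_int(1)]) (auto intro: ln_walk_vec_le_norm)

lemma abs_drift_le:
  assumes v: "norm v = 1" shows "\<bar>drift n k v\<bar> \<le> real k * (1 + C)"
proof -
  have "\<bar>drift n k v\<bar> \<le> (\<integral>\<omega>. \<bar>log_stretch n k v \<omega>\<bar> \<partial>\<Omega>)"
    unfolding drift_def by (rule integral_abs_bound)
  also have "\<dots> \<le> (\<integral>\<omega>. log_norm_sum n k \<omega> \<partial>\<Omega>)"
    by (rule integral_mono) (use walk_vec_int(1)[OF v] log_norm_sum_int(1) abs_ln_walk_vec_le[OF _ v] in auto)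
  also have "\<dots> \<le> real k * (1 + C)" by (rule log_norm_sum_int(2))
  finally show ?thesis .
qed

lemma ln_walk_split:
  assumes w: "\<omega> \<in> space \<Omega>" and u: "norm u = 1"
  shows "log_stretch 0 (n + k) u \<omega> = log_stretch 0 n u \<omega> + log_stretch n k (heading u n \<omega>) \<omega>"
proof -
  define v where "v = walk 0 n \<omega> *v u"
  have v: "0 < norm v" unfolding v_def by (rule walk_vec_pos[OF w u])
  have "v = norm v *\<^sub>R heading u n \<omega>" using v by (simp add: heading_def v_def sgn_div_norm)
  then have "walk 0 (n + k) \<omega> *v u = norm v *\<^sub>R (walk n k \<omega> *v heading u n \<omega>)"
    by (metis add_0 matrix_vector_mul_assoc matrix_vector_mult_scaleR v_def walk_add)
  then show ?thesis
    using v walk_vec_pos[OF w norm_heading[OF w u], of n k n] by (simp add: ln_mult v_def)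
qed

lemma increment_int:
  assumes u: "norm u = 1"
  shows "integrable \<Omega> (\<lambda>\<omega>. log_stretch n k (heading u n \<omega>) \<omega>)"
    "integrable \<Omega> (\<lambda>\<omega>. (log_stretch n k (heading u n \<omega>) \<omega>)\<^sup>2)"
proof -
  have le: "\<bar>log_stretch n k (heading u n \<omega>) \<omega>\<bar> \<le> log_norm_sum n k \<omega>" if "\<omega> \<in> space \<Omega>" for \<omega>
    by (rule abs_ln_walk_vec_le[OF that norm_heading[OF that u]])
  show "integrable \<Omega> (\<lambda>\<omega>. log_stretch n k (heading u n \<omega>) \<omega>)"
    by (rule Bochner_Integration.integrable_bound[OF log_norm_sum_int(1)[of n k]])
       (auto intro!: AE_I2 order_trans[OF le abs_ge_self])
  have "(log_stretch n k (heading u n \<omega>) \<omega>)\<^sup>2 \<le> (log_norm_sum n k \<omega>)\<^sup>2" if "\<omega> \<in> space \<Omega>" for \<omega>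
    using le[OF that] log_norm_sum_nonneg[OF that, of n k] by (intro power2_le_iff_abs_le[THEN iffD2]) auto
  then show "integrable \<Omega> (\<lambda>\<omega>. (log_stretch n k (heading u n \<omega>) \<omega>)\<^sup>2)"
    by (intro Bochner_Integration.integrable_bound[OF log_norm_sum_sq(1)[of n k]]) (auto intro!: AE_I2)
qed

lemma drift_heading_int:
  assumes u: "norm u = 1" shows "integrable \<Omega> (\<lambda>\<omega>. drift n k (heading u n \<omega>))"
  by (rule P.integrable_const_bound[of _ "real k * (1 + C)"])
     (auto intro!: AE_I2 abs_drift_le norm_heading u)

lemma heading_splice: "heading u n (splice n \<omega> \<omega>') = heading u n \<omega>"
  by (simp add: heading_def walk_splice_past)

text \<open>Given the past, the expected stretch of the next block is the drift at the current heading.\<close>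
lemma drift_split:
  assumes u: "norm u = 1"
  shows "drift 0 (n + k) u = drift 0 n u + (\<integral>\<omega>. drift n k (heading u n \<omega>) \<partial>\<Omega>)"
proof -
  have "drift 0 (n + k) u = (\<integral>\<omega>. log_stretch 0 n u \<omega> + log_stretch n k (heading u n \<omega>) \<omega> \<partial>\<Omega>)"
    unfolding drift_def by (rule Bochner_Integration.integral_cong) (auto simp: ln_walk_split[OF _ u])
  also have "\<dots> = drift 0 n u + (\<integral>\<omega>. log_stretch n k (heading u n \<omega>) \<omega> \<partial>\<Omega>)"
    unfolding drift_def by (rule Bochner_Integration.integral_add[OF walk_vec_int(1)[OF u] increment_int(1)[OF u]])
  also have "(\<integral>\<omega>. log_stretch n k (heading u n \<omega>) \<omega> \<partial>\<Omega>) = (\<integral>\<omega>. drift n k (heading u n \<omega>) \<partial>\<Omega>)"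
    by (subst splice_integral(1)[where n = n, OF increment_int(1)[OF u, of n k]])
       (simp add: walk_splice_future heading_splice drift_def)
  finally show ?thesis .
qed

lemma drift_split_lower:
  assumes u: "norm u = 1" and c: "\<And>v. norm v = 1 \<Longrightarrow> c \<le> drift n k v"
  shows "drift 0 n u + c \<le> drift 0 (n + k) u"
proof -
  have "c = (\<integral>\<omega>. c \<partial>\<Omega>)" using P.prob_space by simp
  also have "\<dots> \<le> (\<integral>\<omega>. drift n k (heading u n \<omega>) \<partial>\<Omega>)"
    by (rule integral_mono[OF _ drift_heading_int[OF u]]) (auto intro: c norm_heading u)
  finally show ?thesis unfolding drift_split[OF u] by simp
qed

text \<open>The norms at the two times are compared through the stretch of one fixed vector. This costs
  \<open>\<epsilon> n\<close>, which is harmless because only exponential rates matter.\<close>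
lemma mean_log_increase:
  assumes \<epsilon>: "0 < \<epsilon>"
  shows "\<exists>R\<ge>0. \<forall>n k. mean_log 0 n + (- ln \<rho> / 4 - \<epsilon>) * real k - \<epsilon> * real n - R \<le> mean_log 0 (n + k)"
proof -
  from uniform_expansion[OF \<epsilon>] obtain R where R: "0 \<le> R"
    and ue: "\<And>n k u. norm u = 1 \<Longrightarrow> mean_log n k - (\<epsilon> * real k + R) \<le> drift n k u"
    unfolding mean_log_def drift_def by blast
  have "mean_log 0 n + (- ln \<rho> / 4 - \<epsilon>) * real k - \<epsilon> * real n - 2 * R \<le> mean_log 0 (n + k)" for n k
  proof -
    have u: "norm (axis 1 1 :: real^2) = 1" by simp
    have "real k * (- ln \<rho> / 4) \<le> mean_log n k" unfolding mean_log_def by (rule mean_log_norm_growth)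
    then have c: "real k * (- ln \<rho> / 4) - (\<epsilon> * real k + R) \<le> drift n k v" if "norm v = 1" for v
      using ue[OF that, of n k] by linarith
    have "drift 0 n (axis 1 1) + (real k * (- ln \<rho> / 4) - (\<epsilon> * real k + R)) \<le> drift 0 (n + k) (axis 1 1)"
      by (rule drift_split_lower[OF u c])
    moreover have "mean_log 0 n - (\<epsilon> * real n + R) \<le> drift 0 n (axis 1 1)" by (rule ue[OF u])
    moreover have "drift 0 (n + k) (axis 1 1) \<le> mean_log 0 (n + k)" by (rule drift_le[OF u])
    ultimately show ?thesis by (simp add: algebra_simps)
  qed
  with R show ?thesis by (intro exI[of _ "2 * R"]) simp
qed

text \<open>Resampling a block while keeping its past turns its stretch into the drift. The differences
  therefore have mean zero given the past, and are orthogonal.\<close>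
lemma block_strong_law:
  assumes u: "norm u = 1"
  shows "AE \<omega> in \<Omega>. (\<lambda>N. (\<Sum>j<N. log_stretch (j * k) k (heading u (j * k) \<omega>) \<omega>
      - drift (j * k) k (heading u (j * k) \<omega>)) / real N) \<longlonglongrightarrow> 0"
proof -
  define h where "h j \<omega> = log_stretch (j * k) k (heading u (j * k) \<omega>) \<omega>" for j \<omega>
  define d where "d j \<omega> = drift (j * k) k (heading u (j * k) \<omega>)" for j \<omega>
  define D where "D j \<omega> = h j \<omega> - d j \<omega>" for j \<omega>
  define c where "c = real k * (1 + C)"
  have [measurable]: "h j \<in> borel_measurable \<Omega>" "d j \<in> borel_measurable \<Omega>" for j
    unfolding h_def d_def by measurable
  then have Dm: "D j \<in> borel_measurable \<Omega>" for j unfolding D_def by measurable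
  have bnd: "(D j \<omega>)\<^sup>2 \<le> 2 * (log_norm_sum (j * k) k \<omega>)\<^sup>2 + 2 * c\<^sup>2" if w: "\<omega> \<in> space \<Omega>" for j \<omega>
  proof -
    have nh: "norm (heading u (j * k) \<omega>) = 1" by (rule norm_heading[OF w u])
    have "(h j \<omega>)\<^sup>2 \<le> (log_norm_sum (j * k) k \<omega>)\<^sup>2"
      using abs_ln_walk_vec_le[OF w nh, of "j * k" k] log_norm_sum_nonneg[OF w, of "j * k" k]
      unfolding h_def by (intro power2_le_iff_abs_le[THEN iffD2]) auto
    moreover have "(d j \<omega>)\<^sup>2 \<le> c\<^sup>2"
      using abs_drift_le[OF nh, of "j * k" k] C_nonneg unfolding d_def c_def
      by (intro power2_le_iff_abs_le[THEN iffD2]) auto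
    moreover have "(D j \<omega>)\<^sup>2 \<le> 2 * (h j \<omega>)\<^sup>2 + 2 * (d j \<omega>)\<^sup>2"
      unfolding D_def by (rule square_diff_le)
    ultimately show ?thesis by linarith
  qed
  have ib: "integrable \<Omega> (\<lambda>\<omega>. 2 * (log_norm_sum (j * k) k \<omega>)\<^sup>2 + 2 * c\<^sup>2)" for j
    using log_norm_sum_sq(1) by simp
  have D2: "integrable \<Omega> (\<lambda>\<omega>. (D j \<omega>)\<^sup>2)" for j
    by (rule Bochner_Integration.integrable_bound[OF ib[of j]])
       (use Dm bnd in \<open>auto intro!: AE_I2 order_trans[OF bnd abs_ge_self]\<close>)
  have D2': "(\<integral>\<omega>. (D j \<omega>)\<^sup>2 \<partial>\<Omega>) \<le> 2 * ((real k)\<^sup>2 * C) + 2 * c\<^sup>2" for j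
  proof -
    have "(\<integral>\<omega>. (D j \<omega>)\<^sup>2 \<partial>\<Omega>) \<le> (\<integral>\<omega>. 2 * (log_norm_sum (j * k) k \<omega>)\<^sup>2 + 2 * c\<^sup>2 \<partial>\<Omega>)"
      by (rule integral_mono[OF D2 ib]) (rule bnd)
    also have "\<dots> = 2 * (\<integral>\<omega>. (log_norm_sum (j * k) k \<omega>)\<^sup>2 \<partial>\<Omega>) + 2 * c\<^sup>2"
      using log_norm_sum_sq(1) P.prob_space by simp
    finally show ?thesis using log_norm_sum_sq(2)[of "j * k" k] by linarith
  qed
  have orth: "(\<integral>\<omega>. D i \<omega> * D j \<omega> \<partial>\<Omega>) = 0" if ij: "i < j" for i j
  proof -
    have le: "i * k + k \<le> j * k"
      using mult_le_mono1[of "Suc i" j k] ij by simp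
    have le0: "i * k \<le> j * k" by (rule add_leD1[OF le])
    have past: "D i (splice (j * k) \<omega> \<omega>') = D i \<omega>" for \<omega> \<omega>'
      using le le0 by (simp add: D_def h_def d_def heading_def walk_splice_past)
    have fut: "D j (splice (j * k) \<omega> \<omega>') = log_stretch (j * k) k (heading u (j * k) \<omega>) \<omega>' - d j \<omega>" for \<omega> \<omega>'
      by (simp add: D_def h_def d_def heading_splice walk_splice_future)
    have "(\<integral>\<omega>. D i \<omega> * D j \<omega> \<partial>\<Omega>) = (\<integral>\<omega>. \<integral>\<omega>'. D i (splice (j * k) \<omega> \<omega>') * D j (splice (j * k) \<omega> \<omega>') \<partial>\<Omega> \<partial>\<Omega>)"
      by (rule splice_integral(1)[OF Cauchy_Schwarz_integral(1)[OF Dm Dm D2 D2]])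
    also have "\<dots> = (\<integral>\<omega>. 0 \<partial>\<Omega>)"
    proof (rule Bochner_Integration.integral_cong[OF refl])
      fix \<omega> assume w: "\<omega> \<in> space \<Omega>"
      have nh: "norm (heading u (j * k) \<omega>) = 1" by (rule norm_heading[OF w u])
      have "(\<integral>\<omega>'. log_stretch (j * k) k (heading u (j * k) \<omega>) \<omega>' - d j \<omega> \<partial>\<Omega>) = 0"
        using walk_vec_int(1)[OF nh, of "j * k" k] P.prob_space by (simp add: d_def drift_def)
      then show "(\<integral>\<omega>'. D i (splice (j * k) \<omega> \<omega>') * D j (splice (j * k) \<omega> \<omega>') \<partial>\<Omega>) = 0"
        unfolding past fut by simp
    qed
    finally show ?thesis by simp
  qed
  have "AE \<omega> in \<Omega>. (\<lambda>N. (\<Sum>j<N. D j \<omega>) / real N) \<longlonglongrightarrow> 0"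
    by (rule orthogonal_strong_law[OF Dm D2 D2' orth])
  then show ?thesis by (simp add: D_def h_def d_def)
qed

lemma log_norm_sum_sublinear:
  "AE \<omega> in \<Omega>. (\<lambda>N. log_norm_sum (N * k) k \<omega> / real (Suc N)) \<longlonglongrightarrow> 0"
proof -
  have "AE \<omega> in \<Omega>. (\<lambda>N. (log_norm_sum (N * k) k \<omega> / real (Suc N))\<^sup>2) \<longlonglongrightarrow> 0"
  proof (rule AE_tendsto_zero_of_summable[OF _ _ _ summable_inverse_square[of "(real k)\<^sup>2 * C"]])
    fix q
    show "integrable \<Omega> (\<lambda>\<omega>. (log_norm_sum (q * k) k \<omega> / real (Suc q))\<^sup>2)"
      unfolding power_divide by (intro integrable_divide log_norm_sum_sq)
    show "(\<integral>\<omega>. (log_norm_sum (q * k) k \<omega> / real (Suc q))\<^sup>2 \<partial>\<Omega>) \<le> (real k)\<^sup>2 * C / (real (Suc q))\<^sup>2"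
      using log_norm_sum_sq(2)[of "q * k" k] by (simp add: power_divide divide_right_mono)
  qed simp
  then show ?thesis by eventually_elim (rule tendsto_zero_of_square)
qed

text \<open>The inverse of the additional block has the same norm as the block itself, so the norm can
  neither grow nor shrink by more than this factor.\<close>
lemma walk_norm_split:
  assumes w: "\<omega> \<in> space \<Omega>"
  shows "\<bar>log_norm 0 (n + k) \<omega> - log_norm 0 n \<omega>\<bar> \<le> log_norm n k \<omega>"
proof -
  define A where "A = walk n k \<omega>"
  define B where "B = walk 0 n \<omega>"
  have AB: "walk 0 (n + k) \<omega> = A ** B" using walk_add[of 0 n k \<omega>] by (simp add: A_def B_def)
  have pos: "0 < norm A" "0 < norm B" "0 < norm (A ** B)"
    unfolding AB[symmetric] unfolding A_def B_def by (rule walk_norm_pos[OF w])+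
  have "A \<in> SL2" unfolding A_def by (rule walk_SL2[OF w])
  then have "B = adj2 A ** (A ** B)" by (simp add: matrix_mul_assoc adj2_mult_self)
  then have "norm B \<le> norm A * norm (A ** B)"
    using norm_matrix_matrix_le[of "adj2 A" "A ** B"] by simp
  then have "ln (norm B) \<le> ln (norm A * norm (A ** B))" using pos by (subst ln_le_cancel_iff) auto
  moreover have "ln (norm (A ** B)) \<le> ln (norm A * norm B)"
    using norm_matrix_matrix_le[of A B] pos by (subst ln_le_cancel_iff) auto
  ultimately show ?thesis using pos unfolding AB by (simp add: ln_mult A_def[symmetric] B_def[symmetric])
qed

lemma mean_log_split: "\<bar>mean_log 0 (n + k) - mean_log 0 n\<bar> \<le> mean_log n k"
proof -
  have "\<bar>mean_log 0 (n + k) - mean_log 0 n\<bar> = \<bar>\<integral>\<omega>. log_norm 0 (n + k) \<omega> - log_norm 0 n \<omega> \<partial>\<Omega>\<bar>"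
    unfolding mean_log_def using walk_norm_int(1) by simp
  also have "\<dots> \<le> (\<integral>\<omega>. \<bar>log_norm 0 (n + k) \<omega> - log_norm 0 n \<omega>\<bar> \<partial>\<Omega>)" by (rule integral_abs_bound)
  also have "\<dots> \<le> mean_log n k"
    unfolding mean_log_def by (rule integral_mono) (use walk_norm_int(1) walk_norm_split in auto)
  finally show ?thesis .
qed

lemma mean_log_blocks_le: "mean_log 0 (J * k) \<le> ln 2 + (\<Sum>j<J. mean_log (j * k) k)"
proof (induction J)
  case 0
  show ?case using walk_norm_int(2)[of 0 0] by (simp add: mean_log_def)
next
  case (Suc J)
  have "mean_log 0 (Suc J * k) \<le> mean_log 0 (J * k) + mean_log (J * k) k"
    using mean_log_split[of "J * k" k] by (simp add: add.commute)
  with Suc show ?case by simp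
qed

text \<open>In blocks of length \<open>k\<close>, the logarithmic stretch of \<open>u\<close> is the sum of the drifts plus an
  orthogonal sum of lower order. Each drift agrees with the mean logarithmic norm of its block up
  to \<open>\<epsilon> k / 4\<close>, whatever the heading, and the same holds for the expectations. The random
  stretch and the mean logarithmic norm of the whole product are thus close to the same
  deterministic sum over blocks.\<close>
lemma walk_vec_deviation:
  assumes u: "norm u = 1" and \<epsilon>: "0 < \<epsilon>"
  shows "AE \<omega> in \<Omega>. eventually (\<lambda>n. \<bar>log_stretch 0 n u \<omega> - mean_log 0 n\<bar> \<le> \<epsilon> * real n) sequentially"
proof -
  from uniform_expansion[of "\<epsilon> / 8"] \<epsilon> obtain R where R: "0 \<le> R"
    and ue: "\<And>n k u. norm u = 1 \<Longrightarrow> mean_log n k - (\<epsilon> / 8 * real k + R) \<le> drift n k u"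
    unfolding mean_log_def drift_def by auto
  \<comment> \<open>blocks so long that the additive error \<open>R\<close> is a small multiple of their length\<close>
  obtain k :: nat where k: "8 * R / \<epsilon> + 1 < real k" using reals_Archimedean2 by blast
  have k0: "0 < k"
  proof -
    have "0 \<le> 8 * R / \<epsilon>" using R \<epsilon> by simp
    with k show ?thesis by (intro gr0I) auto
  qed
  have "R \<le> \<epsilon> / 8 * real k"
  proof -
    have "8 * R / \<epsilon> \<le> real k" using k by linarith
    then show ?thesis using \<epsilon> by (simp add: field_simps)
  qed
  then have low: "mean_log n k - \<epsilon> / 4 * real k \<le> drift n k v" if "norm v = 1" for n v
    using ue[OF that, of n k] by linarith
  define B where "B J = (\<Sum>j<J. mean_log (j * k) k)" for J
  define c where "c = \<epsilon> / 4 * real k"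
  have drift_low: "B J - real J * c \<le> drift 0 (J * k) u" for J
  proof (induction J)
    case 0 then show ?case by (simp add: B_def drift_def u)
  next
    case (Suc J)
    have "drift 0 (J * k) u + (mean_log (J * k) k - c) \<le> drift 0 (J * k + k) u"
      unfolding c_def by (rule drift_split_lower[OF u low])
    with Suc show ?case by (simp add: B_def add.commute distrib_right)
  qed
  have meanB: "B J - real J * c \<le> mean_log 0 (J * k)" "mean_log 0 (J * k) \<le> ln 2 + B J" for J
    using drift_low[of J] drift_le[OF u, of 0 "J * k"] mean_log_blocks_le[of J k] by (auto simp: B_def)
  define D where "D j \<omega> = log_stretch (j * k) k (heading u (j * k) \<omega>) \<omega>
      - drift (j * k) k (heading u (j * k) \<omega>)" for j \<omega>
  define Q where "Q = 2 * ln 2 + real k * (1 + C)"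
  have key: "\<bar>log_stretch 0 n u \<omega> - mean_log 0 n\<bar>
      \<le> \<bar>\<Sum>j<n div k. D j \<omega>\<bar> + real (n div k) * c + log_norm_sum (n div k * k) k \<omega> + Q"
    if w: "\<omega> \<in> space \<Omega>" for n \<omega>
  proof -
    define J where "J = n div k"
    define r where "r = n mod k"
    have n: "n = J * k + r" by (simp add: J_def r_def)
    have r: "r \<le> k" using k0 by (simp add: r_def less_imp_le)
    have sum_le: "log_norm_sum (J * k) r \<omega> \<le> log_norm_sum (J * k) k \<omega>"
      unfolding log_norm_sum_def using r by (intro sum_mono2 ln_norm_SL2_nonneg component_SL2[OF w]) auto
    have 1: "\<bar>log_stretch 0 n u \<omega> - log_stretch 0 (J * k) u \<omega>\<bar> \<le> log_norm_sum (J * k) k \<omega>"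
      using ln_walk_split[OF w u, of "J * k" r] abs_ln_walk_vec_le[OF w norm_heading[OF w u], of "J * k" r "J * k"] sum_le
      unfolding n by linarith
    have 2: "\<bar>mean_log 0 n - mean_log 0 (J * k)\<bar> \<le> ln 2 + real k * (1 + C)"
    proof -
      have "\<bar>mean_log 0 n - mean_log 0 (J * k)\<bar> \<le> mean_log (J * k) r" unfolding n by (rule mean_log_split)
      also have "\<dots> \<le> ln 2 + real r * (1 + C)" unfolding mean_log_def by (rule walk_norm_int(2))
      also have "\<dots> \<le> ln 2 + real k * (1 + C)" using r C_nonneg by (intro add_left_mono mult_right_mono) auto
      finally show ?thesis .
    qed
    define G where "G J = (\<Sum>j<J. drift (j * k) k (heading u (j * k) \<omega>))" for J
    have 3: "log_stretch 0 (J * k) u \<omega> = (\<Sum>j<J. D j \<omega>) + G J" for J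
    proof (induction J)
      case 0 then show ?case by (simp add: u G_def)
    next
      case (Suc J)
      then show ?case using ln_walk_split[OF w u, of "J * k" k] by (simp add: D_def G_def add.commute)
    qed
    have 4: "G J \<le> B J" unfolding G_def B_def by (intro sum_mono drift_le norm_heading w u)
    have 5: "B J - real J * c \<le> G J"
    proof -
      have "(\<Sum>j<J. mean_log (j * k) k - c) \<le> G J"
        unfolding G_def c_def by (intro sum_mono low norm_heading w u)
      then show ?thesis by (simp add: sum_subtractf B_def)
    qed
    have "0 \<le> ln (2::real)" "0 \<le> real J * c" using \<epsilon> by (simp_all add: c_def)
    then have "\<bar>log_stretch 0 (J * k) u \<omega> - mean_log 0 (J * k)\<bar> \<le> \<bar>\<Sum>j<J. D j \<omega>\<bar> + real J * c + ln 2"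
      unfolding 3 using 4 5 meanB[of J] by linarith
    then show ?thesis using 1 2 unfolding Q_def J_def[symmetric] by linarith
  qed
  have "AE \<omega> in \<Omega>. (\<lambda>N. (\<Sum>j<N. D j \<omega>) / real N) \<longlonglongrightarrow> 0"
    unfolding D_def by (rule block_strong_law[OF u])
  with log_norm_sum_sublinear[of k] AE_space show ?thesis
  proof eventually_elim
    case (elim \<omega>)
    have top: "filterlim (\<lambda>n. n div k) at_top sequentially"
      unfolding filterlim_at_top
    proof
      fix Z
      show "eventually (\<lambda>n. Z \<le> n div k) sequentially"
        using eventually_ge_at_top[of "Z * k"]
        by eventually_elim (use k0 in \<open>simp add: less_eq_div_iff_mult_less_eq\<close>)
    qed
    have e8: "0 < \<epsilon> / 8" using \<epsilon> by simp
    have ev1: "eventually (\<lambda>n. \<bar>(\<Sum>j<n div k. D j \<omega>) / real (n div k)\<bar> < \<epsilon> / 8) sequentially"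
      using tendstoD[OF filterlim_compose[OF elim(3) top] e8] by (simp add: dist_real_def)
    have ev2: "eventually (\<lambda>n. \<bar>log_norm_sum (n div k * k) k \<omega> / real (Suc (n div k))\<bar> < \<epsilon> / 8) sequentially"
      using tendstoD[OF filterlim_compose[OF elim(1) top] e8] by (simp add: dist_real_def)
    have ev3: "eventually (\<lambda>n. Q \<le> \<epsilon> / 4 * real n) sequentially"
      using \<epsilon> by real_asymp
    have ev4: "eventually (\<lambda>n. 1 \<le> n div k) sequentially"
      using top by (simp add: filterlim_at_top)
    from ev1 ev2 ev3 ev4 show ?case
    proof eventually_elim
      case (elim n)
      define J where "J = n div k"
      have J: "1 \<le> J" using elim(4) by (simp add: J_def)
      have Jn: "real J * real k \<le> real n"
        unfolding J_def of_nat_mult[symmetric] of_nat_le_iff by (rule div_times_less_eq_dividend)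
      have Jn': "real J \<le> real n"
      proof -
        have "real J * 1 \<le> real J * real k" using k0 by (intro mult_left_mono) auto
        with Jn show ?thesis by simp
      qed
      have "\<bar>\<Sum>j<J. D j \<omega>\<bar> \<le> \<epsilon> / 8 * real J"
      proof -
        have "\<bar>\<Sum>j<J. D j \<omega>\<bar> / real J \<le> \<epsilon> / 8"
          using elim(1) unfolding J_def[symmetric] abs_divide by simp
        then show ?thesis using J by (simp add: pos_divide_le_eq)
      qed
      also have "\<dots> \<le> \<epsilon> / 8 * real n" using Jn' \<epsilon> by (intro mult_left_mono) auto
      finally have a: "\<bar>\<Sum>j<J. D j \<omega>\<bar> \<le> \<epsilon> / 8 * real n" .
      have "log_norm_sum (J * k) k \<omega> \<le> \<epsilon> / 8 * real (Suc J)"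
      proof -
        have "log_norm_sum (J * k) k \<omega> / real (Suc J) \<le> \<epsilon> / 8"
          using elim(2) unfolding J_def[symmetric] by linarith
        then show ?thesis by (simp add: pos_divide_le_eq)
      qed
      also have "\<dots> \<le> \<epsilon> / 8 * (2 * real n)" using Jn' J \<epsilon> by (intro mult_left_mono) auto
      finally have b: "log_norm_sum (J * k) k \<omega> \<le> \<epsilon> / 4 * real n" by simp
      have "real J * c = \<epsilon> / 4 * (real J * real k)" by (simp add: c_def)
      also have "\<dots> \<le> \<epsilon> / 4 * real n" using Jn \<epsilon> by (intro mult_left_mono) auto
      finally have d: "real J * c \<le> \<epsilon> / 4 * real n" .
      have "0 \<le> \<epsilon> * real n" using \<epsilon> by simp
      then show ?case using key[OF \<open>\<omega> \<in> space \<Omega>\<close>, of n] a b d elim(3) unfolding J_def[symmetric] by linarith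
    qed
  qed
qed

lemma log_norm_law:
  assumes \<epsilon>: "0 < \<epsilon>"
  shows "AE \<omega> in \<Omega>. eventually (\<lambda>n. \<bar>log_norm 0 n \<omega> - mean_log 0 n\<bar> \<le> \<epsilon> * real n) sequentially"
proof -
  have n12: "norm (axis 1 1 :: real^2) = 1" "norm (axis 2 1 :: real^2) = 1" by simp_all
  have e2: "0 < \<epsilon> / 2" using \<epsilon> by simp
  from walk_vec_deviation[OF n12(1) e2] walk_vec_deviation[OF n12(2) e2] AE_space show ?thesis
  proof eventually_elim
    case (elim \<omega>)
    have "eventually (\<lambda>n. ln 2 \<le> \<epsilon> / 2 * real n) sequentially" using \<epsilon> by real_asymp
    from elim(1) elim(2) this show ?case
    proof eventually_elim
      case (elim n)
      have w: "\<omega> \<in> space \<Omega>" by fact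
      note p = walk_vec_pos[OF w n12(1), of 0 n] walk_vec_pos[OF w n12(2), of 0 n] walk_norm_pos[OF w, of 0 n]
      have up: "log_norm 0 n \<omega> \<le> ln 2 + x"
        if "norm (walk 0 n \<omega>) \<le> 2 * y" "ln y = x" "0 < y" for x y
      proof -
        have "log_norm 0 n \<omega> \<le> ln (2 * y)" using that p(3) by (subst ln_le_cancel_iff) linarith+
        then show ?thesis using that by (simp add: ln_mult)
      qed
      have "norm (walk 0 n \<omega>) \<le> 2 * norm (walk 0 n \<omega> *v axis 1 1) \<or> norm (walk 0 n \<omega>) \<le> 2 * norm (walk 0 n \<omega> *v axis 2 1)"
        using norm_le_columns[of "walk 0 n \<omega>"] by linarith
      then have "log_norm 0 n \<omega> \<le> mean_log 0 n + \<epsilon> * real n"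
      proof
        assume "norm (walk 0 n \<omega>) \<le> 2 * norm (walk 0 n \<omega> *v axis 1 1)"
        from up[OF this refl p(1)] elim show ?thesis by linarith
      next
        assume "norm (walk 0 n \<omega>) \<le> 2 * norm (walk 0 n \<omega> *v axis 2 1)"
        from up[OF this refl p(2)] elim show ?thesis by linarith
      qed
      moreover have "log_stretch 0 n (axis 1 1) \<omega> \<le> log_norm 0 n \<omega>"
        by (rule ln_walk_vec_le_norm[OF w n12(1)])
      moreover have "0 \<le> \<epsilon> / 2 * real n" using \<epsilon> by simp
      ultimately show ?case using elim(1) by linarith
    qed
  qed
qed

end

section \<open>The contracted direction\<close>

text \<open>Pull back a unit vector that the inverse stretches by at least half of its norm.\<close>
lemma ex_contracted_vector:
  assumes T: "T \<in> SL2"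
  shows "\<exists>w. norm w = 1 \<and> norm T * norm (T *v w) \<le> 2"
proof -
  obtain e :: "real^2" where e: "norm e = 1" "norm (adj2 T) \<le> 2 * norm (adj2 T *v e)"
    using ex_axis_norm_ge by blast
  define y where "y = norm (adj2 T *v e)"
  have y: "0 < y"
    using SL2_vec_eq_0_iff[OF adj2_SL2[OF T], of e] e(1) by (force simp: y_def)
  define w where "w = sgn (adj2 T *v e)"
  have "T *v w = e /\<^sub>R y"
    by (simp add: w_def sgn_div_norm y_def matrix_vector_mult_scaleR mult_adj2_vec[OF T])
  then have "norm (T *v w) = 1 / y" using y e(1) by (simp add: divide_inverse)
  then have "norm T * norm (T *v w) = norm T / y" by simp
  also have "\<dots> \<le> 2" using e(2) y by (simp add: y_def[symmetric] pos_divide_le_eq)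
  finally have "norm T * norm (T *v w) \<le> 2" .
  moreover have "norm w = 1" using y by (auto simp: w_def norm_sgn y_def)
  ultimately show ?thesis by blast
qed

text \<open>With \<open>c\<close> the inner product, the squares of the two sides are \<open>2 - 2 c\<close> and \<open>4 (1 - c) (1 + c)\<close>. Nonnegativity
  of \<open>c\<close> selects one of the two unit vectors on a line.\<close>
lemma dist_le_wedge:
  assumes w: "norm w = 1" "norm w' = 1" and i: "0 \<le> w \<bullet> (w' :: real^2)"
  shows "norm (w' - w) \<le> 2 * \<bar>wedge w w'\<bar>"
proof (rule power2_le_imp_le)
  define c where "c = w \<bullet> w'"
  have c1: "c \<le> 1" using norm_cauchy_schwarz[of w w'] w by (simp add: c_def)
  have c: "c = w$1 * w'$1 + w$2 * w'$2" by (simp add: c_def inner_vec_def sum_2)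
  have n: "(w$1)\<^sup>2 + (w$2)\<^sup>2 = 1" "(w'$1)\<^sup>2 + (w'$2)\<^sup>2 = 1" using w power2_norm_2 by (metis one_power2)+
  have "(norm (w' - w))\<^sup>2 = ((w'$1)\<^sup>2 + (w'$2)\<^sup>2) + ((w$1)\<^sup>2 + (w$2)\<^sup>2) - 2 * c"
    unfolding power2_norm_2 c by (simp add: power2_eq_square algebra_simps)
  then have d: "(norm (w' - w))\<^sup>2 = 2 - 2 * c" by (simp add: n)
  have "(wedge w w')\<^sup>2 + c\<^sup>2 = ((w$1)\<^sup>2 + (w$2)\<^sup>2) * ((w'$1)\<^sup>2 + (w'$2)\<^sup>2)"
    by (simp add: wedge_def c power2_eq_square algebra_simps)
  then have "(wedge w w')\<^sup>2 = 1 - c\<^sup>2" by (simp add: n)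
  also have "\<dots> = (1 - c) * (1 + c)" by (simp add: power2_eq_square algebra_simps)
  finally have "4 * (wedge w w')\<^sup>2 = (1 - c) * (4 * (1 + c))" by simp
  moreover have "(1 - c) * 2 \<le> (1 - c) * (4 * (1 + c))"
    using c1 i by (intro mult_left_mono) (auto simp: c_def)
  ultimately show "(norm (w' - w))\<^sup>2 \<le> (2 * \<bar>wedge w w'\<bar>)\<^sup>2"
    unfolding d by (simp add: power_mult_distrib)
qed simp

lemma ex_contracted_sequence:
  fixes T :: "nat \<Rightarrow> real^2^2"
  assumes T: "\<And>n. T n \<in> SL2"
  shows "\<exists>w. \<forall>n. norm (w n) = 1 \<and> norm (T n) * norm (T n *v w n) \<le> 2 \<and> 0 \<le> w n \<bullet> w (Suc n)"
proof -
  let ?P = "\<lambda>n x. norm x = 1 \<and> norm (T n) * norm (T n *v x) \<le> 2"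
  have "\<exists>w. \<forall>n. ?P n (w n) \<and> 0 \<le> w n \<bullet> w (Suc n)"
  proof (rule dependent_nat_choice)
    show "\<exists>x. ?P 0 x" by (rule ex_contracted_vector[OF T])
    fix x n assume "?P n x"
    obtain y where y: "norm y = 1" "norm (T (Suc n)) * norm (T (Suc n) *v y) \<le> 2"
      using ex_contracted_vector[OF T] by blast
    show "\<exists>y. ?P (Suc n) y \<and> 0 \<le> x \<bullet> y"
    proof (cases "0 \<le> x \<bullet> y")
      case True then show ?thesis using y by blast
    next
      case False
      have "T (Suc n) *v (- y) = - (T (Suc n) *v y)" by (simp add: vec2_eq_iff matrix_vector_nth_2)
      then show ?thesis using y False by (intro exI[of _ "- y"]) auto
    qed
  qed
  then show ?thesis by blast
qed

text \<open>The wedge product is invariant under \<open>T\<close>, and \<open>T\<close> contracts both vectors: the second one because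
  \<open>A T\<close> does and \<open>A\<inverse>\<close> cannot undo more than its norm.\<close>
lemma contracted_sequence_step:
  assumes T: "T \<in> SL2" and A: "A \<in> SL2"
    and w: "norm w = 1" "norm T * norm (T *v w) \<le> 2"
    and w': "norm w' = 1" "norm (A ** T) * norm ((A ** T) *v w') \<le> 2"
    and i: "0 \<le> w \<bullet> w'"
  shows "norm (w' - w) \<le> 8 * (norm A)\<^sup>2 / (norm T)\<^sup>2"
proof -
  have pos: "0 < norm A" "0 < norm T" "0 < norm (A ** T)"
    using norm_SL2_ge_1[OF A] norm_SL2_ge_1[OF T] norm_SL2_ge_1[OF matrix_mult_SL2[OF A T]] by linarith+
  have "norm T \<le> norm A * norm (A ** T)"
  proof -
    have "T = adj2 A ** (A ** T)" using A by (simp add: matrix_mul_assoc adj2_mult_self)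
    then show ?thesis using norm_matrix_matrix_le[of "adj2 A" "A ** T"] by simp
  qed
  moreover have "norm (T *v w') \<le> norm A * norm ((A ** T) *v w')"
    using norm_le_SL2_vec[OF A, of "T *v w'"] by (simp add: matrix_vector_mul_assoc)
  ultimately have "norm T * norm (T *v w') \<le> (norm A * norm (A ** T)) * (norm A * norm ((A ** T) *v w'))"
    by (intro mult_mono) auto
  also have "\<dots> = (norm A)\<^sup>2 * (norm (A ** T) * norm ((A ** T) *v w'))" by (simp add: power2_eq_square)
  also have "\<dots> \<le> (norm A)\<^sup>2 * 2" by (intro mult_left_mono w') simp
  finally have 1: "norm T * norm (T *v w') \<le> (norm A)\<^sup>2 * 2" .
  have "\<bar>wedge w w'\<bar> \<le> norm (T *v w) * norm (T *v w')"
    using abs_wedge_le[of "T *v w" "T *v w'"] by (simp add: wedge_SL2[OF T])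
  then have "(norm T)\<^sup>2 * \<bar>wedge w w'\<bar> \<le> (norm T)\<^sup>2 * (norm (T *v w) * norm (T *v w'))"
    by (intro mult_left_mono) auto
  also have "\<dots> = (norm T * norm (T *v w)) * (norm T * norm (T *v w'))" by (simp add: power2_eq_square)
  also have "\<dots> \<le> 2 * ((norm A)\<^sup>2 * 2)" by (intro mult_mono w(2) 1) auto
  finally have "\<bar>wedge w w'\<bar> \<le> 4 * (norm A)\<^sup>2 / (norm T)\<^sup>2"
    using pos by (simp add: pos_le_divide_eq mult.commute)
  then show ?thesis using dist_le_wedge[OF w(1) w'(1) i] by simp
qed

text \<open>The steps of the contracted directions are of size \<open>exp (-2 L m)\<close> up to subexponential factors,
  and up to such factors \<open>L\<close> grows at least linearly from any time \<open>n\<close> on. So the directions converge, and the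
  distance from the limit \<open>v\<close> at time \<open>n\<close> is of order \<open>exp (-2 L n)\<close>. The matrix \<open>T n\<close>, of norm
  about \<open>exp (L n)\<close>, then maps \<open>v\<close> to length at most about \<open>exp (- L n)\<close>; it cannot be
  shorter, because \<open>1 \<le> norm (T n) * norm (T n *v v)\<close>.\<close>
lemma contracted_direction_converges:
  fixes A :: "nat \<Rightarrow> real^2^2" and L :: "nat \<Rightarrow> real"
  defines "T \<equiv> matrix_prod A"
  assumes A: "\<And>n. 1 \<le> n \<Longrightarrow> A n \<in> SL2" and lam: "0 < lam"
    and law: "\<And>\<epsilon>. 0 < \<epsilon> \<Longrightarrow> eventually (\<lambda>n. \<bar>ln (norm (T n)) - L n\<bar> \<le> \<epsilon> * real n) sequentially"
    and inc: "\<And>\<epsilon>. 0 < \<epsilon> \<Longrightarrow> \<exists>R\<ge>0. \<forall>n k. L n + (lam - \<epsilon>) * real k - \<epsilon> * real n - R \<le> L (n + k)"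
    and sub: "(\<lambda>n. ln (norm (A (Suc n))) / real (Suc n)) \<longlonglongrightarrow> 0"
  shows "\<exists>v. norm v = 1 \<and> (\<lambda>n. norm (T n *v v)) \<longlonglongrightarrow> 0
      \<and> (\<lambda>n. 1 / real n * (ln (norm (T n *v v)) + L n)) \<longlonglongrightarrow> 0"
proof -
  have TS: "T n \<in> SL2" for n unfolding T_def by (rule matrix_prod_SL2) (rule A)
  have Tpos: "0 < norm (T n)" for n using norm_SL2_ge_1[OF TS, of n] by linarith
  have Apos: "0 < norm (A (Suc n))" for n using norm_SL2_ge_1[OF A, of "Suc n"] by (rule less_le_trans[OF zero_less_one]) simp
  obtain w where w: "\<And>n. norm (w n) = 1" "\<And>n. norm (T n) * norm (T n *v w n) \<le> 2" "\<And>n. 0 \<le> w n \<bullet> w (Suc n)"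
    using ex_contracted_sequence[of T, OF TS] by blast
  have step: "norm (w (Suc n) - w n) \<le> 8 * (norm (A (Suc n)))\<^sup>2 / (norm (T n))\<^sup>2" for n
    by (rule contracted_sequence_step[OF TS A w(1,2) w(1) _ w(3)]) (use w(2)[of "Suc n"] in \<open>auto simp: T_def\<close>)
  \<comment> \<open>the exponent 6 adds the errors of the two logarithms and of the growth of \<open>L\<close>, each of them doubled\<close>
  have tail: "\<exists>K\<ge>0. eventually (\<lambda>n. \<forall>k. norm (w (n + k) - w n) \<le> K * exp (- 2 * L n + 6 * \<epsilon> * real n)) sequentially"
    and bstep: "\<exists>K. eventually (\<lambda>n. norm (w (Suc n) - w n) \<le> K * exp (- lam) ^ n) sequentially"
    if \<epsilon>: "0 < \<epsilon>" "\<epsilon> \<le> lam / 6" for \<epsilon>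
  proof -
    obtain R where R: "0 \<le> R" "\<And>n k. L n + (lam - \<epsilon>) * real k - \<epsilon> * real n - R \<le> L (n + k)"
      using inc[OF \<epsilon>(1)] by blast
    define q where "q = exp (- lam)"
    have q: "0 < q" "q < 1" using lam by (auto simp: q_def)
    define K0 where "K0 = 8 * exp (2 * \<epsilon> + 2 * R)"
    have ev1: "eventually (\<lambda>n. \<bar>ln (norm (A (Suc n))) / real (Suc n)\<bar> < \<epsilon>) sequentially"
      using tendstoD[OF sub \<epsilon>(1)] by (simp add: dist_real_def)
    have ev: "eventually (\<lambda>n. ln (norm (A (Suc n))) \<le> \<epsilon> * real (Suc n) \<and> L n - \<epsilon> * real n \<le> ln (norm (T n))) sequentially"
      using ev1 law[OF \<epsilon>(1)]
    proof eventually_elim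
      case (elim n)
      then have "ln (norm (A (Suc n))) / real (Suc n) \<le> \<epsilon>" by linarith
      then have "ln (norm (A (Suc n))) \<le> \<epsilon> * real (Suc n)" by (simp add: pos_divide_le_eq)
      with elim show ?case by linarith
    qed
    then obtain n0 where n0: "\<And>n. n0 \<le> n \<Longrightarrow> ln (norm (A (Suc n))) \<le> \<epsilon> * real (Suc n)"
      "\<And>n. n0 \<le> n \<Longrightarrow> L n - \<epsilon> * real n \<le> ln (norm (T n))"
      unfolding eventually_sequentially by blast
    have b: "norm (w (Suc (n + i)) - w (n + i)) \<le> K0 * exp (- 2 * L n + 6 * \<epsilon> * real n) * q ^ i"
      if n: "n0 \<le> n" for n i
    proof -
      define m where "m = n + i"
      have m: "n0 \<le> m" using n by (simp add: m_def)
      have "(norm (A (Suc m)))\<^sup>2 / (norm (T m))\<^sup>2 = exp (2 * ln (norm (A (Suc m))) - 2 * ln (norm (T m)))"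
        using Apos[of m] Tpos[of m] by (simp add: exp_diff exp_double)
      also have "\<dots> \<le> exp (2 * \<epsilon> + 2 * R + (- 2 * L n + 6 * \<epsilon> * real n) + real i * (- lam))"
      proof -
        have "L n + (lam - \<epsilon>) * real i - \<epsilon> * real n - R \<le> L m" unfolding m_def by (rule R(2))
        moreover have "ln (norm (A (Suc m))) \<le> \<epsilon> * real n + \<epsilon> * real i + \<epsilon>"
          using n0(1)[OF m] by (simp add: m_def algebra_simps)
        moreover have "L m - \<epsilon> * real n - \<epsilon> * real i \<le> ln (norm (T m))"
          using n0(2)[OF m] by (simp add: m_def algebra_simps)
        moreover have "6 * \<epsilon> * real i \<le> lam * real i" using \<epsilon> by (intro mult_right_mono) auto
        ultimately show ?thesis by (simp add: algebra_simps)
      qed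
      also have "\<dots> = exp (2 * \<epsilon> + 2 * R) * exp (- 2 * L n + 6 * \<epsilon> * real n) * q ^ i"
        by (simp only: exp_add q_def exp_of_nat_mult)
      finally show ?thesis using step[of m] unfolding K0_def m_def by simp
    qed
    have "norm (w (n + k) - w n) \<le> K0 / (1 - q) * exp (- 2 * L n + 6 * \<epsilon> * real n)" if n: "n0 \<le> n" for n k
    proof -
      define E where "E = exp (- 2 * L n + 6 * \<epsilon> * real n)"
      have "w (n + k) - w n = (\<Sum>i<k. w (Suc (n + i)) - w (n + i))"
        using sum_lessThan_telescope[of "\<lambda>i. w (n + i)" k] by simp
      then have "norm (w (n + k) - w n) \<le> (\<Sum>i<k. norm (w (Suc (n + i)) - w (n + i)))" by (simp add: norm_sum)
      also have "\<dots> \<le> (\<Sum>i<k. K0 * E * q ^ i)" unfolding E_def by (intro sum_mono b n)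
      also have "\<dots> = K0 * E * (\<Sum>i<k. q ^ i)" by (simp add: sum_distrib_left)
      also have "(\<Sum>i<k. q ^ i) \<le> 1 / (1 - q)"
      proof -
        have "(\<Sum>i<k. q ^ i) \<le> (\<Sum>i. q ^ i)"
          using q by (intro sum_le_suminf summable_geometric) auto
        also have "\<dots> = 1 / (1 - q)" using q by (intro suminf_geometric) auto
        finally show ?thesis .
      qed
      then have "K0 * E * (\<Sum>i<k. q ^ i) \<le> K0 * E * (1 / (1 - q))"
        by (intro mult_left_mono) (auto simp: K0_def E_def)
      finally show ?thesis by (simp add: E_def)
    qed
    then show "\<exists>K\<ge>0. eventually (\<lambda>n. \<forall>k. norm (w (n + k) - w n) \<le> K * exp (- 2 * L n + 6 * \<epsilon> * real n)) sequentially"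
      using q by (intro exI[of _ "K0 / (1 - q)"]) (auto simp: eventually_sequentially K0_def)
    show "\<exists>K. eventually (\<lambda>n. norm (w (Suc n) - w n) \<le> K * exp (- lam) ^ n) sequentially"
    proof (intro exI)
      show "eventually (\<lambda>n. norm (w (Suc n) - w n) \<le> K0 * exp (- 2 * L n0 + 6 * \<epsilon> * real n0) / q ^ n0 * exp (- lam) ^ n) sequentially"
        using eventually_ge_at_top[of n0]
      proof eventually_elim
        case (elim n)
        then have "norm (w (Suc n) - w n) \<le> K0 * exp (- 2 * L n0 + 6 * \<epsilon> * real n0) * q ^ (n - n0)"
          using b[of n0 "n - n0"] by simp
        also have "q ^ (n - n0) = q ^ n / q ^ n0" using elim q by (simp add: power_diff)
        finally show ?case by (simp add: q_def)
      qed
    qed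
  qed
  \<comment> \<open>a single tolerance gives the limit; the rate is then recovered for every tolerance at the same limit\<close>
  obtain K where K: "eventually (\<lambda>n. norm (w (Suc n) - w n) \<le> K * exp (- lam) ^ n) sequentially"
    using bstep[of "lam / 6"] lam by auto
  have "summable (\<lambda>n. w (Suc n) - w n)"
    by (rule summable_comparison_test_ev[OF K]) (use lam in \<open>auto intro!: summable_mult summable_geometric\<close>)
  then obtain l where "(\<lambda>n. \<Sum>i<n. w (Suc i) - w i) \<longlonglongrightarrow> l" by (auto simp: summable_def sums_def)
  then have "(\<lambda>n. w n - w 0) \<longlonglongrightarrow> l" by (simp add: sum_lessThan_telescope)
  then have wlim: "w \<longlonglongrightarrow> l + w 0" using tendsto_add[OF _ tendsto_const, of "\<lambda>n. w n - w 0" l sequentially "w 0"] by simp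
  define v where "v = l + w 0"
  have wv: "w \<longlonglongrightarrow> v" using wlim by (simp add: v_def)
  have nv: "norm v = 1"
    using LIMSEQ_unique[OF tendsto_norm[OF wv], of 1] w(1) by simp
  have Tv: "0 < norm (T n *v v)" for n
    using SL2_vec_eq_0_iff[OF TS, of n v] nv by force
  have upper: "\<exists>K'. eventually (\<lambda>n. ln (norm (T n *v v)) + L n \<le> K' + 7 * \<epsilon> * real n) sequentially"
    and lower: "eventually (\<lambda>n. - \<epsilon> * real n \<le> ln (norm (T n *v v)) + L n) sequentially"
    if \<epsilon>: "0 < \<epsilon>" "\<epsilon> \<le> lam / 6" for \<epsilon>
  proof -
    show "eventually (\<lambda>n. - \<epsilon> * real n \<le> ln (norm (T n *v v)) + L n) sequentially"
      using law[OF \<epsilon>(1)]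
    proof eventually_elim
      case (elim n)
      have "1 \<le> norm (T n) * norm (T n *v v)" using norm_le_SL2_vec[OF TS, of v n] nv by simp
      then have "ln 1 \<le> ln (norm (T n) * norm (T n *v v))" using Tpos Tv by (subst ln_le_cancel_iff) auto
      then have "0 \<le> ln (norm (T n)) + ln (norm (T n *v v))" using Tpos[of n] Tv[of n] by (simp add: ln_mult)
      with elim show ?case by linarith
    qed
    obtain K where K: "0 \<le> K" "eventually (\<lambda>n. \<forall>k. norm (w (n + k) - w n) \<le> K * exp (- 2 * L n + 6 * \<epsilon> * real n)) sequentially"
      using tail[OF \<epsilon>] by blast
    have "eventually (\<lambda>n. ln (norm (T n *v v)) + L n \<le> ln (2 + K) + 7 * \<epsilon> * real n) sequentially"
      using K(2) law[OF \<epsilon>(1)]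
    proof eventually_elim
      case (elim n)
      have "(\<lambda>k. norm (w (k + n) - w n)) \<longlonglongrightarrow> norm (v - w n)"
        by (intro tendsto_norm tendsto_diff LIMSEQ_ignore_initial_segment[OF wv] tendsto_const)
      then have d: "norm (v - w n) \<le> K * exp (- 2 * L n + 6 * \<epsilon> * real n)"
        by (rule LIMSEQ_le_const2) (use elim(1) in \<open>auto simp: add.commute\<close>)
      have t: "ln (norm (T n)) \<le> L n + \<epsilon> * real n" "- ln (norm (T n)) \<le> - L n + \<epsilon> * real n"
        using elim(2) by linarith+
      have t1: "norm (T n) \<le> exp (L n + \<epsilon> * real n)"
        using t(1) Tpos[of n] by (metis exp_le_cancel_iff exp_ln)
      have t2: "1 / norm (T n) \<le> exp (- L n + \<epsilon> * real n)"
        using t(2) Tpos[of n] by (metis exp_le_cancel_iff exp_ln exp_minus inverse_eq_divide)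
      define E where "E = exp (- L n + 7 * \<epsilon> * real n)"
      have "T n *v v = T n *v w n + T n *v (v - w n)"
        by (simp add: vec2_eq_iff matrix_vector_nth_2 algebra_simps)
      then have "norm (T n *v v) \<le> norm (T n *v w n) + norm (T n *v (v - w n))"
        by (simp add: norm_triangle_ineq)
      also have "norm (T n *v w n) \<le> 2 * (1 / norm (T n))"
        using w(2)[of n] Tpos[of n] by (simp add: pos_le_divide_eq mult.commute)
      also have "\<dots> \<le> 2 * E"
      proof -
        have "exp (- L n + \<epsilon> * real n) \<le> E" using \<epsilon> by (simp add: E_def)
        with t2 show ?thesis by linarith
      qed
      also have "norm (T n *v (v - w n)) \<le> norm (T n) * norm (v - w n)" by (rule norm_matrix_vector_le)
      also have "\<dots> \<le> exp (L n + \<epsilon> * real n) * (K * exp (- 2 * L n + 6 * \<epsilon> * real n))"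
        by (intro mult_mono t1 d) auto
      also have "\<dots> = K * E"
        by (simp add: E_def exp_add[symmetric] algebra_simps)
      finally have "norm (T n *v v) \<le> (2 + K) * E" by (simp add: distrib_right)
      then have "ln (norm (T n *v v)) \<le> ln ((2 + K) * E)"
        using Tv[of n] K(1) by (subst ln_le_cancel_iff) (auto simp: E_def)
      also have "\<dots> = ln (2 + K) + (- L n + 7 * \<epsilon> * real n)" using K(1) by (simp add: ln_mult E_def)
      finally show ?case by simp
    qed
    then show "\<exists>K'. eventually (\<lambda>n. ln (norm (T n *v v)) + L n \<le> K' + 7 * \<epsilon> * real n) sequentially" by blast
  qed
  have lim: "(\<lambda>n. 1 / real n * (ln (norm (T n *v v)) + L n)) \<longlonglongrightarrow> 0"
  proof (rule tendstoI)
    fix e :: real assume e: "0 < e"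
    define \<epsilon> where "\<epsilon> = min (e / 10) (lam / 6)"
    have \<epsilon>: "0 < \<epsilon>" "\<epsilon> \<le> lam / 6" "\<epsilon> \<le> e / 10" using e lam by (auto simp: \<epsilon>_def)
    obtain K' where K': "eventually (\<lambda>n. ln (norm (T n *v v)) + L n \<le> K' + 7 * \<epsilon> * real n) sequentially"
      using upper[OF \<epsilon>(1,2)] by blast
    have "eventually (\<lambda>n. K' \<le> \<epsilon> * real n) sequentially" using \<epsilon>(1) by real_asymp
    from K' lower[OF \<epsilon>(1,2)] this eventually_gt_at_top[of 0]
    show "eventually (\<lambda>n. dist (1 / real n * (ln (norm (T n *v v)) + L n)) 0 < e) sequentially"
    proof eventually_elim
      case (elim n)
      have n: "0 < real n" using elim(4) by simp
      have "0 < \<epsilon> * real n" "10 * (\<epsilon> * real n) \<le> e * real n" using \<epsilon> n by simp_all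
      then have "\<bar>ln (norm (T n *v v)) + L n\<bar> < e * real n" using elim by linarith
      then show ?case using n by (simp add: dist_real_def abs_mult pos_divide_less_eq)
    qed
  qed
  have zero: "(\<lambda>n. norm (T n *v v)) \<longlonglongrightarrow> 0"
  proof -
    define \<epsilon> where "\<epsilon> = lam / 20"
    have \<epsilon>: "0 < \<epsilon>" "\<epsilon> \<le> lam / 6" using lam by (auto simp: \<epsilon>_def)
    obtain K' where K': "eventually (\<lambda>n. ln (norm (T n *v v)) + L n \<le> K' + 7 * \<epsilon> * real n) sequentially"
      using upper[OF \<epsilon>] by blast
    obtain R where R: "\<And>n k. L n + (lam - \<epsilon>) * real k - \<epsilon> * real n - R \<le> L (n + k)"
      using inc[OF \<epsilon>(1)] by blast
    have "eventually (\<lambda>n. norm (T n *v v) \<le> exp (K' + R - L 0 - lam / 2 * real n)) sequentially"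
      using K'
    proof eventually_elim
      case (elim n)
      have "L 0 + (lam - \<epsilon>) * real n - R \<le> L n" using R[of 0 n] by simp
      moreover have "0 \<le> lam * real n" using lam by simp
      ultimately have "ln (norm (T n *v v)) \<le> K' + R - L 0 - lam / 2 * real n"
        using elim by (simp add: \<epsilon>_def algebra_simps)
      then show ?case using Tv[of n] by (metis exp_le_cancel_iff exp_ln)
    qed
    moreover have "(\<lambda>n. exp (K' + R - L 0 - lam / 2 * real n)) \<longlonglongrightarrow> 0" using lam by real_asymp
    ultimately show ?thesis
      by (intro tendsto_sandwich[of "\<lambda>_. 0" "\<lambda>n. norm (T n *v v)" sequentially "\<lambda>n. exp (K' + R - L 0 - lam / 2 * real n)" 0]) simp_all
  qed
  show ?thesis using nv zero lim by blast
qed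

section \<open>From the moment condition to the theorem\<close>

lemma op_norm_meas [measurable]: "op_norm \<in> borel_measurable borel"
proof -
  have le: "op_norm A \<le> op_norm B + norm (A - B)" for A B
  proof -
    have bl: "bounded_linear (\<lambda>v. X *v v)" for X :: "real^2^2"
      by (simp add: linear_linear matrix_vector_mul_linear)
    have "op_norm A = onorm (\<lambda>v. B *v v + (A - B) *v v)"
      unfolding op_norm_def by (simp add: matrix_vector_mult_add_rdistrib[symmetric])
    also have "\<dots> \<le> op_norm B + op_norm (A - B)" unfolding op_norm_def by (rule onorm_triangle[OF bl bl])
    finally show ?thesis using op_norm_le_norm[of "A - B"] by linarith
  qed
  have "1-lipschitz_on UNIV op_norm"
  proof (rule lipschitz_onI)
    fix A B
    show "dist (op_norm A) (op_norm B) \<le> 1 * dist A B"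
      using le[of A B] le[of B A] by (simp add: dist_norm norm_minus_commute abs_le_iff)
  qed simp
  then show ?thesis by (intro borel_measurable_continuous_onI lipschitz_on_continuous_on)
qed

text \<open>The square of the logarithm is dominated by the power of exponent \<open>\<gamma>\<close>.\<close>
lemma log_norm_square_moment:
  assumes \<kappa>: "\<kappa> \<in> prob_measures_SL2" and \<gamma>: "0 < \<gamma>"
    and mom: "(\<integral>\<^sup>+A. ennreal (op_norm A powr \<gamma>) \<partial>\<kappa>) < ennreal C"
  defines "C' \<equiv> 4 / \<gamma>\<^sup>2 * (2 powr \<gamma> * C)"
  shows "integrable \<kappa> (\<lambda>A. (ln (norm A))\<^sup>2)" "(\<integral>A. (ln (norm A))\<^sup>2 \<partial>\<kappa>) \<le> C'"
proof -
  have [measurable]: "(\<lambda>A. A) \<in> measurable \<kappa> borel" by (rule prob_measures_SL2D[OF \<kappa>])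
  have C: "0 < C"
  proof (rule ccontr)
    assume "\<not> 0 < C" then have "ennreal C = 0" by (simp add: ennreal_neg)
    with mom show False by simp
  qed
  have pt: "(ln (norm A))\<^sup>2 \<le> 4 / \<gamma>\<^sup>2 * 2 powr \<gamma> * (op_norm A powr \<gamma>)" if A: "A \<in> SL2" for A
  proof -
    have n1: "1 \<le> norm A" by (rule norm_SL2_ge_1[OF A])
    have "ln (norm A) \<le> norm A powr (\<gamma> / 2) / (\<gamma> / 2)" by (rule ln_powr_bound[OF n1]) (use \<gamma> in simp)
    then have "(ln (norm A))\<^sup>2 \<le> (norm A powr (\<gamma> / 2) / (\<gamma> / 2))\<^sup>2" using n1 by (intro power_mono) auto
    also have "\<dots> = 4 / \<gamma>\<^sup>2 * (norm A powr (\<gamma> / 2))\<^sup>2" by (simp add: power_divide)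
    also have "(norm A powr (\<gamma> / 2))\<^sup>2 = norm A powr \<gamma>" by (simp add: power2_eq_square powr_add[symmetric])
    also have "norm A powr \<gamma> \<le> (2 * op_norm A) powr \<gamma>"
      using norm_le_op_norm[of A] \<gamma> by (intro powr_mono2) auto
    also have "(2 * op_norm A) powr \<gamma> = 2 powr \<gamma> * op_norm A powr \<gamma>"
    proof -
      have "0 \<le> op_norm A" using norm_le_op_norm[of A] norm_ge_zero[of A] by linarith
      then show ?thesis by (simp add: powr_mult)
    qed
    finally show ?thesis by (simp add: mult.assoc divide_right_mono mult_left_mono)
  qed
  have "(\<integral>\<^sup>+A. ennreal ((ln (norm A))\<^sup>2) \<partial>\<kappa>) \<le> (\<integral>\<^sup>+A. ennreal (4 / \<gamma>\<^sup>2 * 2 powr \<gamma>) * ennreal (op_norm A powr \<gamma>) \<partial>\<kappa>)"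
    by (rule nn_integral_mono) (use pt in \<open>auto simp: prob_measures_SL2D(3)[OF \<kappa>] ennreal_mult[symmetric] intro!: ennreal_leI\<close>)
  also have "\<dots> = ennreal (4 / \<gamma>\<^sup>2 * 2 powr \<gamma>) * (\<integral>\<^sup>+A. ennreal (op_norm A powr \<gamma>) \<partial>\<kappa>)"
    by (rule nn_integral_cmult) measurable
  also have "\<dots> \<le> ennreal (4 / \<gamma>\<^sup>2 * 2 powr \<gamma>) * ennreal C"
    using mom by (intro mult_left_mono) auto
  also have "\<dots> = ennreal C'" using C by (subst ennreal_mult[symmetric]) (auto simp: C'_def)
  finally have le: "(\<integral>\<^sup>+A. ennreal ((ln (norm A))\<^sup>2) \<partial>\<kappa>) \<le> ennreal C'" .
  show i: "integrable \<kappa> (\<lambda>A. (ln (norm A))\<^sup>2)"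
    by (rule integrableI_bounded) (use le in \<open>auto simp: less_top[symmetric] top_unique\<close>)
  have C'0: "0 \<le> C'" using C by (simp add: C'_def)
  have "ennreal (\<integral>A. (ln (norm A))\<^sup>2 \<partial>\<kappa>) \<le> ennreal C'"
    using le nn_integral_eq_integral[OF i] by simp
  then show "(\<integral>A. (ln (norm A))\<^sup>2 \<partial>\<kappa>) \<le> C'" using C'0 by (simp add: ennreal_le_iff)
qed

text \<open>Markov's inequality at the level \<open>l\<^sup>2 \<ge> C / e\<close>.\<close>
lemma tight_of_log_moment:
  assumes KS: "K \<subseteq> prob_measures_SL2"
    and int: "\<And>\<kappa>. \<kappa> \<in> K \<Longrightarrow> integrable \<kappa> (\<lambda>A. (ln (norm A))\<^sup>2)"
    and le: "\<And>\<kappa>. \<kappa> \<in> K \<Longrightarrow> (\<integral>A. (ln (norm A))\<^sup>2 \<partial>\<kappa>) \<le> C" and e: "0 < e"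
  shows "\<exists>M. \<forall>\<kappa>\<in>K. measure \<kappa> {A \<in> SL2. M < norm A} \<le> e"
proof (intro exI ballI)
  define l where "l = \<bar>C\<bar> / e + 1"
  have l: "1 \<le> l" "\<bar>C\<bar> \<le> e * l\<^sup>2"
  proof -
    show l1: "1 \<le> l" using e by (simp add: l_def)
    have "\<bar>C\<bar> = e * (l - 1)" using e by (simp add: l_def)
    also have "\<dots> \<le> e * l\<^sup>2"
    proof (rule mult_left_mono)
      have "l * 1 \<le> l * l" using l1 by (intro mult_left_mono) auto
      then show "l - 1 \<le> l\<^sup>2" by (simp add: power2_eq_square)
    qed (use e in simp)
    finally show "\<bar>C\<bar> \<le> e * l\<^sup>2" .
  qed
  fix \<kappa> assume k: "\<kappa> \<in> K"
  then have \<kappa>: "\<kappa> \<in> prob_measures_SL2" using KS by blast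
  interpret prob_space \<kappa> by (rule prob_measures_SL2D[OF \<kappa>])
  have [measurable]: "(\<lambda>A. A) \<in> measurable \<kappa> borel" by (rule prob_measures_SL2D[OF \<kappa>])
  define G where "G = {A \<in> SL2. exp l < norm A}"
  have G: "G \<in> sets \<kappa>"
  proof -
    have "G = {A \<in> space \<kappa>. exp l < norm A}" by (simp add: G_def prob_measures_SL2D(3)[OF \<kappa>])
    also have "\<dots> \<in> sets \<kappa>" by measurable
    finally show ?thesis .
  qed
  have "l\<^sup>2 * measure \<kappa> G = (\<integral>A. l\<^sup>2 * indicator G A \<partial>\<kappa>)" using G by simp
  also have "\<dots> \<le> (\<integral>A. (ln (norm A))\<^sup>2 \<partial>\<kappa>)"
  proof (rule integral_mono[OF _ int[OF k]])
    show "integrable \<kappa> (\<lambda>A. l\<^sup>2 * indicator G A)" using G by (auto simp: emeasure_eq_measure)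
    fix A assume "A \<in> space \<kappa>"
    show "l\<^sup>2 * indicator G A \<le> (ln (norm A))\<^sup>2"
    proof (cases "A \<in> G")
      case True
      then have "exp l \<le> norm A" by (simp add: G_def)
      then have "l \<le> ln (norm A)" by (metis exp_gt_zero ln_exp ln_le_cancel_iff order_less_le_trans)
      then show ?thesis using True l(1) by (simp add: power_mono)
    qed simp
  qed
  also have "\<dots> \<le> e * l\<^sup>2" using le[OF k] l(2) by linarith
  finally have "l\<^sup>2 * measure \<kappa> G \<le> l\<^sup>2 * e" by (simp add: mult.commute)
  then have "measure \<kappa> G \<le> e" using l(1) by simp
  then show "measure \<kappa> {A \<in> SL2. exp l < norm A} \<le> e" by (simp add: G_def)
qed

context sl2_walk begin

text \<open>The Frobenius and operator norms differ by a factor of at most two.\<close>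
lemma mean_log_norm_close: "\<bar>mean_log_norm \<mu> n - mean_log 0 n\<bar> \<le> ln 2"
proof -
  define J where "J = {1..n}"
  have J: "finite J" "J \<subseteq> {1..}" by (auto simp: J_def)
  have mp: "(\<lambda>A. matrix_prod A k) \<in> borel_measurable (\<Pi>\<^sub>M i\<in>J. \<mu> i)" if "k \<le> n" for k
    using that
  proof (induction k)
    case (Suc k)
    have "(\<lambda>A. A (Suc k)) \<in> borel_measurable (\<Pi>\<^sub>M i\<in>J. \<mu> i)"
      by (rule measurable_compose[OF measurable_component_singleton[of "Suc k" J \<mu>] prob_measures_SL2D(4)[OF \<mu>[of "Suc k"]]])
         (use Suc.prems in \<open>simp add: J_def\<close>)
    moreover have "(\<lambda>A. matrix_prod A k) \<in> borel_measurable (\<Pi>\<^sub>M i\<in>J. \<mu> i)" using Suc by simp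
    ultimately show ?case by simp
  qed simp
  have eq: "mean_log_norm \<mu> n = (\<integral>\<omega>. ln (op_norm (walk 0 n \<omega>)) \<partial>\<Omega>)"
  proof -
    have "mean_log_norm \<mu> n = (\<integral>A. ln (op_norm (matrix_prod A n)) \<partial>(distr \<Omega> (\<Pi>\<^sub>M i\<in>J. \<mu> i) (\<lambda>x. restrict x J)))"
      unfolding distr_PiM_restrict_finite[OF J] by (simp add: mean_log_norm_def J_def)
    also have "\<dots> = (\<integral>\<omega>. ln (op_norm (matrix_prod (restrict \<omega> J) n)) \<partial>\<Omega>)"
      by (rule integral_distr) (use mp[OF order_refl] J in \<open>auto intro: measurable_restrict_subset\<close>)
    also have "\<dots> = (\<integral>\<omega>. ln (op_norm (walk 0 n \<omega>)) \<partial>\<Omega>)"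
    proof (rule Bochner_Integration.integral_cong[OF refl])
      fix \<omega>
      have "matrix_prod (restrict \<omega> J) n = matrix_prod \<omega> n" by (rule matrix_prod_cong) (simp add: J_def)
      then show "ln (op_norm (matrix_prod (restrict \<omega> J) n)) = ln (op_norm (walk 0 n \<omega>))" by (simp add: walk_def)
    qed
    finally show ?thesis .
  qed
  have pt: "\<bar>ln (op_norm (walk 0 n \<omega>)) - log_norm 0 n \<omega>\<bar> \<le> ln 2" if w: "\<omega> \<in> space \<Omega>" for \<omega>
  proof -
    have p: "0 < norm (walk 0 n \<omega>)" by (rule walk_norm_pos[OF w])
    then have q: "0 < op_norm (walk 0 n \<omega>)" using norm_le_op_norm[of "walk 0 n \<omega>"] by linarith
    have "ln (op_norm (walk 0 n \<omega>)) \<le> log_norm 0 n \<omega>"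
      using op_norm_le_norm[of "walk 0 n \<omega>"] p q by (subst ln_le_cancel_iff) linarith+
    moreover have "log_norm 0 n \<omega> \<le> ln (2 * op_norm (walk 0 n \<omega>))"
      using norm_le_op_norm[of "walk 0 n \<omega>"] p q by (subst ln_le_cancel_iff) linarith+
    ultimately show ?thesis using q by (simp add: ln_mult)
  qed
  have i: "integrable \<Omega> (\<lambda>\<omega>. ln (op_norm (walk 0 n \<omega>)) - log_norm 0 n \<omega>)"
    by (rule P.integrable_const_bound[of _ "ln 2"]) (use pt in auto)
  have i': "integrable \<Omega> (\<lambda>\<omega>. ln (op_norm (walk 0 n \<omega>)))"
    using Bochner_Integration.integrable_add[OF i walk_norm_int(1)[of 0 n]] by simp
  have "mean_log_norm \<mu> n - mean_log 0 n = (\<integral>\<omega>. ln (op_norm (walk 0 n \<omega>)) - log_norm 0 n \<omega> \<partial>\<Omega>)"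
    unfolding eq mean_log_def by (rule Bochner_Integration.integral_diff[OF i' walk_norm_int(1), symmetric])
  also have "\<bar>\<dots>\<bar> \<le> (\<integral>\<omega>. \<bar>ln (op_norm (walk 0 n \<omega>)) - log_norm 0 n \<omega>\<bar> \<partial>\<Omega>)" by (rule integral_abs_bound)
  also have "\<dots> \<le> (\<integral>\<omega>. ln 2 \<partial>\<Omega>)" by (rule integral_mono) (use i pt in auto)
  also have "\<dots> = ln 2" using P.prob_space by simp
  finally show ?thesis .
qed

lemma AE_contracted_direction:
  "AE A in \<Omega>. \<exists>v::real^2. norm v = 1
           \<and> (\<lambda>n. norm (matrix_prod A n *v v)) \<longlonglongrightarrow> 0
           \<and> (\<lambda>n. 1 / real n * (ln (norm (matrix_prod A n *v v)) + mean_log_norm \<mu> n)) \<longlonglongrightarrow> 0"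
proof -
  \<comment> \<open>countably many tolerances, so that one null set serves all of them\<close>
  have "AE \<omega> in \<Omega>. \<forall>q. eventually (\<lambda>n. \<bar>log_norm 0 n \<omega> - mean_log 0 n\<bar> \<le> 1 / real (Suc q) * real n) sequentially"
    unfolding AE_all_countable by (intro allI log_norm_law) simp
  with log_norm_sum_sublinear[of 1] AE_space show ?thesis
  proof eventually_elim
    case (elim \<omega>)
    have walk0: "walk 0 n \<omega> = matrix_prod \<omega> n" for n by (simp add: walk_def)
    have lam: "0 < - ln \<rho> / 4" using \<rho> by simp
    have comp: "\<omega> n \<in> SL2" if "1 \<le> n" for n by (rule component_SL2[OF elim(2) that])
    have law: "eventually (\<lambda>n. \<bar>ln (norm (matrix_prod \<omega> n)) - mean_log 0 n\<bar> \<le> \<epsilon> * real n) sequentially" if e: "0 < \<epsilon>" for \<epsilon>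
    proof -
      obtain q where q: "inverse (real (Suc q)) < \<epsilon>" using reals_Archimedean[OF e] by blast
      from elim(3)[rule_format, of q] show ?thesis
      proof eventually_elim
        case (elim n)
        have "1 / real (Suc q) * real n \<le> \<epsilon> * real n"
          using q by (intro mult_right_mono) (auto simp: inverse_eq_divide)
        with elim show ?case unfolding walk0 by linarith
      qed
    qed
    have sub: "(\<lambda>n. ln (norm (\<omega> (Suc n))) / real (Suc n)) \<longlonglongrightarrow> 0"
      using elim(1) by (simp add: log_norm_sum_def)
    obtain v where v: "norm v = 1" "(\<lambda>n. norm (matrix_prod \<omega> n *v v)) \<longlonglongrightarrow> 0"
      "(\<lambda>n. 1 / real n * (ln (norm (matrix_prod \<omega> n *v v)) + mean_log 0 n)) \<longlonglongrightarrow> 0"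
      using contracted_direction_converges[OF comp lam law mean_log_increase sub] by blast
    have "(\<lambda>n. 1 / real n * (mean_log_norm \<mu> n - mean_log 0 n)) \<longlonglongrightarrow> 0"
    proof (rule Lim_null_comparison)
      show "eventually (\<lambda>n. norm (1 / real n * (mean_log_norm \<mu> n - mean_log 0 n)) \<le> ln 2 / real n) sequentially"
        using mean_log_norm_close by (intro always_eventually) (simp add: abs_mult divide_right_mono)
      show "(\<lambda>n. ln 2 / real n) \<longlonglongrightarrow> 0" by real_asymp
    qed
    from tendsto_add[OF v(3) this]
    have "(\<lambda>n. 1 / real n * (ln (norm (matrix_prod \<omega> n *v v)) + mean_log_norm \<mu> n)) \<longlonglongrightarrow> 0"
      by (simp add: add_divide_distrib[symmetric])
    with v show ?case by blast
  qed
qed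

end

theorem proposition1p2:
  fixes K :: "(real^2^2) measure set" and \<mu> :: "nat \<Rightarrow> (real^2^2) measure"
  assumes compact: "compactin weak_topology_SL2 K"
    and moment: "\<exists>\<gamma>>0. \<exists>C. \<forall>\<kappa>\<in>K. (\<integral>\<^sup>+A. ennreal (op_norm A powr \<gamma>) \<partial>\<kappa>) < ennreal C"
    and measures: "\<forall>\<kappa>\<in>K. \<not> (\<exists>\<nu>\<^sub>1\<in>prob_measures_RP1. \<exists>\<nu>\<^sub>2\<in>prob_measures_RP1.
           AE A in \<kappa>. distr \<nu>\<^sub>1 RP1_borel (proj_map A) = \<nu>\<^sub>2)"
    and seq: "\<forall>i\<ge>1. \<mu> i \<in> K"
  shows "AE A in (\<Pi>\<^sub>M i\<in>{1..}. \<mu> i). \<exists>v::real^2. norm v = 1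
           \<and> (\<lambda>n. norm (matrix_prod A n *v v)) \<longlonglongrightarrow> 0
           \<and> (\<lambda>n. 1 / real n * (ln (norm (matrix_prod A n *v v)) + mean_log_norm \<mu> n)) \<longlonglongrightarrow> 0"
proof -
  have KS: "K \<subseteq> prob_measures_SL2"
    using compactin_subset_topspace[OF compact] by (simp add: topspace_weak_topology_SL2)
  obtain \<gamma> C0 where \<gamma>: "0 < \<gamma>" "\<And>\<kappa>. \<kappa> \<in> K \<Longrightarrow> (\<integral>\<^sup>+A. ennreal (op_norm A powr \<gamma>) \<partial>\<kappa>) < ennreal C0"
    using moment by blast
  define C where "C = 4 / \<gamma>\<^sup>2 * (2 powr \<gamma> * C0)"
  have C: "integrable \<kappa> (\<lambda>A. (ln (norm A))\<^sup>2)" "(\<integral>A. (ln (norm A))\<^sup>2 \<partial>\<kappa>) \<le> C" if "\<kappa> \<in> K" for \<kappa>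
    using log_norm_square_moment[OF _ \<gamma>(1) \<gamma>(2)[OF that]] that KS by (auto simp: C_def)
  obtain \<rho> where \<rho>: "0 < \<rho>" "\<rho> < 1"
    "\<And>\<kappa> f. \<kappa> \<in> K \<Longrightarrow> unit_L2 f \<Longrightarrow> energy (avg \<kappa> f) \<le> \<rho> * energy f"
    using spectral_gap[OF compact tight_of_log_moment[OF KS C] measures] by blast
  \<comment> \<open>the law with index 0 lies outside the product; giving it a value in \<open>K\<close> makes the bounds hold for all indices\<close>
  define \<mu>' where "\<mu>' i = (if i = 0 then \<mu> 1 else \<mu> i)" for i
  have \<mu>': "\<mu>' i \<in> K" for i using seq by (auto simp: \<mu>'_def)
  interpret sl2_walk \<mu>' \<rho> C
    by unfold_locales (use \<mu>' KS \<rho> C in auto)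
  have product: "(\<Pi>\<^sub>M i\<in>{1..}. \<mu> i) = (\<Pi>\<^sub>M i\<in>{1..}. \<mu>' i)" by (rule PiM_cong) (auto simp: \<mu>'_def)
  have mean: "mean_log_norm \<mu> n = mean_log_norm \<mu>' n" for n
  proof -
    have "(\<Pi>\<^sub>M i\<in>{1..n}. \<mu> i) = (\<Pi>\<^sub>M i\<in>{1..n}. \<mu>' i)" by (rule PiM_cong) (auto simp: \<mu>'_def)
    then show ?thesis by (simp add: mean_log_norm_def)
  qed
  show ?thesis unfolding product mean by (rule AE_contracted_direction)
qed

end
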